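(* Let $f:\mathcal G\to\mathbb R$ be a weighted graph parameter. Then the following are equivalent: (a) $f$ is testable. (b) For every $\varepsilon>0$ there is a positive integer $k$ such that for every weighted graph $G\in\mathcal G$ satisfying $\max_i \alpha_i(G)/\alpha_G\le 1/k$, $$|f(G)-\mathbb E(f(\xi(k,G)))|\le\varepsilon .$$ (c) For every convergent sequence $(G_n)$ of weighted graphs in $\mathcal G$ with $\max_i\alpha_i(G_n)/\alpha_{G_n}\to0$, the real sequence $f(G_n)$ is also convergent as $n\to\infty$. (d) $f$ can be extended to graphons in the following sense: there is a functional $\tilde f:\mathcal W_{[0,1]}\to\mathbb R$ that is continuous in the cut-norm and such that $\tilde f(W_{G_n})-f(G_n)\to0$ whenever $(G_n)$ is a sequence in $\mathcal G$ with $\max_i\alpha_i(G_n)/\alpha_{G_n}\to0$ as $n\to\infty$. (e) For every $\varepsilon>0$ there are a real $\varepsilon_0>0$ and an integer $n_0>0$ such that if $G_1,G_2\in\mathcal G$ satisfy $\max_i\alpha_i(G_1)/\alpha_{G_1}\le1/n_0$, $\max_i\alpha_i(G_2)/\alpha_{G_2}\le1/n_0$ and $\delta_\square(G_1,G_2)<\varepsilon_0$, then $|f(G_1)-f(G_2)|<\varepsilon$.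
   Context: $\mathcal G$ is the set of all finite weighted graphs $G$ on vertex sets $V(G)=[n]=\{1,\dots,n\}$ with vertex-weights $\alpha_i=\alpha_i(G)>0$ and edge-weights $\beta_{ij}=\beta_{ji}\in[0,1]$ ($i,j\in[n]$). Put $\alpha_G=\sum_{i=1}^n\alpha_i$. Simple graphs are regarded as elements of $\mathcal G$ with all vertex-weights $1$ and edge-weights $0$ or $1$ (no loops). A weighted graph parameter is a function $f:\mathcal G\to\mathbb R$ invariant under isomorphism of weighted graphs. Random sample: $\xi(k,G)$ is the random simple graph on vertex set $[k]$ obtained by choosing $k$ vertices $\Phi(1),\dots,\Phi(k)$ of $G$ independently, with replacement, each equal to $i$ with probability $\alpha_i/\alpha_G$, and then, given these, joining each pair $u\neq v$ in $[k]$ by an edge conditionally independently with probability $\beta_{\Phi(u)\Phi(v)}$. Testability: $f$ is testable if for every $\varepsilon>0$ there is a positive integer $k$ such that every $G\in\mathcal G$ with $\max_i\alpha_i(G)/\alpha_G\le1/k$ satisfies $\mathbb P(|f(G)-f(\xi(k,G))|>\varepsilon)\le\varepsilon$. Convergence: for a simple graph $F$ on $[k]$, $t(F,G)=\frac1{\alpha_G^k}\sum_{\Phi:[k]\to V(G)}\prod_{i=1}^k\alpha_{\Phi(i)}\prod_{ij\in E(F)}\beta_{\Phi(i)\Phi(j)}$. A sequence $(G_n)$ in $\mathcal G$ is convergent if $t(F,G_n)$ converges for every simple graph $F$. Graphons: $\mathcal W_{[0,1]}$ is the set of symmetric measurable functions $W:[0,1]^2\to[0,1]$. The cut-norm of a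 bounded symmetric measurable $W$ is $\|W\|_\square=\sup_{S,T\subset[0,1]}|\iint_{S\times T}W\,dx\,dy|$ (sup over measurable sets), and $\delta_\square(W,U)=\inf_\nu\|W-U^\nu\|_\square$ over measure preserving bijections $\nu$ of $[0,1]$, where $U^\nu(x,y)=U(\nu(x),\nu(y))$. Graphons at $\delta_\square$-distance $0$ are identified, so graphon functionals are understood to take equal values on such graphons. For $G\in\mathcal G$, $W_G\in\mathcal W_{[0,1]}$ is the stepfunction obtained by dividing $[0,1]$ into consecutive intervals $I_1,\dots,I_n$ of lengths $\alpha_i/\alpha_G$ and setting $W_G=\beta_{ij}$ on $I_i\times I_j$. For $G,G'\in\mathcal G$, $\delta_\square(G,G')=\delta_\square(W_G,W_{G'})$. *)

theory Defs
  imports "HOL-Probability.Probability"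
begin

datatype wgraph =
  WGraph (nverts: nat) (vweight: "nat \<Rightarrow> real") (eweight: "nat \<Rightarrow> nat \<Rightarrow> real")

definition verts :: "wgraph \<Rightarrow> nat set" where
  "verts G = {1..nverts G}"

(* Weights are required to vanish outside the vertex set, so that the elements of this set
   correspond bijectively to weighted graphs on [n]. Loops (i = j) are allowed. *)
definition wgraphs :: "wgraph set" where
  "wgraphs = {G. 1 \<le> nverts G
     \<and> (\<forall>i\<in>verts G. 0 < vweight G i)
     \<and> (\<forall>i\<in>verts G. \<forall>j\<in>verts G.
          0 \<le> eweight G i j \<and> eweight G i j \<le> 1 \<and> eweight G i j = eweight G j i)
     \<and> (\<forall>i. i \<notin> verts G \<longrightarrow> vweight G i = 0)
     \<and> (\<forall>i j. i \<notin> verts G \<or> j \<notin> verts G \<longrightarrow> eweight G i j = 0)}"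

definition total_weight :: "wgraph \<Rightarrow> real" where
  "total_weight G = (\<Sum>i\<in>verts G. vweight G i)"

definition max_rel_weight :: "wgraph \<Rightarrow> real" where
  "max_rel_weight G = Max (vweight G ` verts G) / total_weight G"

definition simple_graphs :: "wgraph set" where
  "simple_graphs = {G \<in> wgraphs.
     (\<forall>i\<in>verts G. vweight G i = 1)
     \<and> (\<forall>i\<in>verts G. \<forall>j\<in>verts G. eweight G i j \<in> {0, 1})
     \<and> (\<forall>i\<in>verts G. eweight G i i = 0)}"

(* Each undirected edge is represented once, by its increasing pair of end points. *)
definition simple_edges :: "wgraph \<Rightarrow> (nat \<times> nat) set" where
  "simple_edges F = {(i, j). i \<in> verts F \<and> j \<in> verts F \<and> i < j \<and> eweight F i j = 1}"

definition wgraph_iso :: "wgraph \<Rightarrow> wgraph \<Rightarrow> bool" where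
  "wgraph_iso G H \<longleftrightarrow> (\<exists>\<pi>. bij_betw \<pi> (verts G) (verts H)
     \<and> (\<forall>i\<in>verts G. vweight H (\<pi> i) = vweight G i)
     \<and> (\<forall>i\<in>verts G. \<forall>j\<in>verts G. eweight H (\<pi> i) (\<pi> j) = eweight G i j))"

definition wgraph_parameter :: "(wgraph \<Rightarrow> real) \<Rightarrow> bool" where
  "wgraph_parameter f \<longleftrightarrow> (\<forall>G\<in>wgraphs. \<forall>H\<in>wgraphs. wgraph_iso G H \<longrightarrow> f G = f H)"

definition vertex_pmf :: "wgraph \<Rightarrow> nat pmf" where
  "vertex_pmf G = embed_pmf (\<lambda>i. if i \<in> verts G then vweight G i / total_weight G else 0)"

definition simple_graph_of :: "nat \<Rightarrow> (nat \<times> nat) set \<Rightarrow> wgraph" where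
  "simple_graph_of k E = WGraph k
     (\<lambda>i. if i \<in> {1..k} then 1 else 0)
     (\<lambda>i j. if (i, j) \<in> E \<or> (j, i) \<in> E then 1 else 0)"

definition pairs :: "nat \<Rightarrow> (nat \<times> nat) set" where
  "pairs k = {(u, v). 1 \<le> u \<and> u < v \<and> v \<le> k}"

definition random_sample :: "nat \<Rightarrow> wgraph \<Rightarrow> wgraph pmf" where
  "random_sample k G =
     bind_pmf (Pi_pmf {1..k} 0 (\<lambda>_. vertex_pmf G)) (\<lambda>\<Phi>.
       map_pmf (\<lambda>X. simple_graph_of k {e. X e})
         (Pi_pmf (pairs k) False (\<lambda>(u, v). bernoulli_pmf (eweight G (\<Phi> u) (\<Phi> v)))))"

definition testable :: "(wgraph \<Rightarrow> real) \<Rightarrow> bool" where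
  "testable f \<longleftrightarrow> (\<forall>\<epsilon>>0. \<exists>k\<ge>1. \<forall>G\<in>wgraphs. max_rel_weight G \<le> 1 / real k \<longrightarrow>
     measure_pmf.prob (random_sample k G) {H. \<bar>f G - f H\<bar> > \<epsilon>} \<le> \<epsilon>)"

definition hom_density :: "wgraph \<Rightarrow> wgraph \<Rightarrow> real" where
  "hom_density F G = 1 / total_weight G ^ nverts F *
     (\<Sum>\<Phi>\<in>verts F \<rightarrow>\<^sub>E verts G.
        (\<Prod>i\<in>verts F. vweight G (\<Phi> i)) * (\<Prod>(i, j)\<in>simple_edges F. eweight G (\<Phi> i) (\<Phi> j)))"

definition convergent_wgraphs :: "(nat \<Rightarrow> wgraph) \<Rightarrow> bool" where
  "convergent_wgraphs G \<longleftrightarrow> (\<forall>F\<in>simple_graphs. convergent (\<lambda>n. hom_density F (G n)))"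

(* Only the values on the unit square matter: cut_norm below integrates over subsets of it.
   Measurability is Lebesgue measurability. *)
definition graphons :: "(real \<Rightarrow> real \<Rightarrow> real) set" where
  "graphons = {W.
     (\<lambda>z. W (fst z) (snd z)) \<in> borel_measurable (lebesgue_on ({0..1} \<times> {0..1}))
     \<and> (\<forall>x\<in>{0..1}. \<forall>y\<in>{0..1}. 0 \<le> W x y \<and> W x y \<le> 1 \<and> W x y = W y x)}"

definition cut_norm :: "(real \<Rightarrow> real \<Rightarrow> real) \<Rightarrow> real" where
  "cut_norm W = (SUP (S, T) \<in> sets (lebesgue_on {0..1}) \<times> sets (lebesgue_on {0..1}).
     \<bar>LINT z : S \<times> T | lebesgue. W (fst z) (snd z)\<bar>)"

definition mp_bijections :: "(real \<Rightarrow> real) set" where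
  "mp_bijections = {\<nu>. bij_betw \<nu> {0..1} {0..1}
     \<and> \<nu> \<in> lebesgue_on {0..1} \<rightarrow>\<^sub>M lebesgue_on {0..1}
     \<and> distr (lebesgue_on {0..1}) (lebesgue_on {0..1}) \<nu> = lebesgue_on {0..1}}"

definition cut_dist :: "(real \<Rightarrow> real \<Rightarrow> real) \<Rightarrow> (real \<Rightarrow> real \<Rightarrow> real) \<Rightarrow> real" where
  "cut_dist W U = (INF \<nu>\<in>mp_bijections. cut_norm (\<lambda>x y. W x y - U (\<nu> x) (\<nu> y)))"

(* The consecutive intervals are [0, a 1], (a 1, a 2], ..., (a (n-1), 1], where a i is the
   normalised weight of the first i vertices. *)
definition vertex_interval :: "wgraph \<Rightarrow> nat \<Rightarrow> real set" where
  "vertex_interval G i =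
     (let a = (\<lambda>m. (\<Sum>j=1..m. vweight G j) / total_weight G)
      in {a (i - 1)<..a i} \<union> (if i = 1 then {0} else {}))"

definition graphon_of :: "wgraph \<Rightarrow> real \<Rightarrow> real \<Rightarrow> real" where
  "graphon_of G x y = (\<Sum>i\<in>verts G. \<Sum>j\<in>verts G.
     eweight G i j * indicator (vertex_interval G i) x * indicator (vertex_interval G j) y)"

definition wgraph_cut_dist :: "wgraph \<Rightarrow> wgraph \<Rightarrow> real" where
  "wgraph_cut_dist G H = cut_dist (graphon_of G) (graphon_of H)"

(* Graphons at distance 0 are identified, so a functional has to respect this identification. *)
definition graphon_functional :: "((real \<Rightarrow> real \<Rightarrow> real) \<Rightarrow> real) \<Rightarrow> bool" where
  "graphon_functional g \<longleftrightarrow> (\<forall>W\<in>graphons. \<forall>U\<in>graphons. cut_dist W U = 0 \<longrightarrow> g W = g U)"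

definition cut_norm_continuous :: "((real \<Rightarrow> real \<Rightarrow> real) \<Rightarrow> real) \<Rightarrow> bool" where
  "cut_norm_continuous g \<longleftrightarrow> (\<forall>W\<in>graphons. \<forall>\<epsilon>>0. \<exists>\<delta>>0. \<forall>U\<in>graphons.
     cut_norm (\<lambda>x y. U x y - W x y) < \<delta> \<longrightarrow> \<bar>g U - g W\<bar> < \<epsilon>)"

lemma total_weight_pos:
  assumes "G \<in> wgraphs" shows "0 < total_weight G"
  unfolding total_weight_def using assms
  by (intro sum_pos) (auto simp: wgraphs_def verts_def)

lemma pmf_vertex_pmf:
  assumes "G \<in> wgraphs"
  shows "pmf (vertex_pmf G) i = (if i \<in> verts G then vweight G i / total_weight G else 0)"
proof -
  let ?p = "\<lambda>i. if i \<in> verts G then vweight G i / total_weight G else 0"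
  have nn: "0 \<le> ?p i" for i
    using assms total_weight_pos[OF assms] by (auto simp: wgraphs_def intro!: divide_nonneg_pos less_imp_le)
  have fin: "finite (verts G)" by (simp add: verts_def)
  have "(\<integral>\<^sup>+ x. ennreal (?p x) \<partial>count_space UNIV) = (\<Sum>x\<in>verts G. ennreal (?p x))"
    by (rule nn_integral_count_space'[OF fin]) auto
  also have "\<dots> = ennreal (\<Sum>x\<in>verts G. ?p x)"
    by (rule sum_ennreal) (use nn in blast)
  also have "(\<Sum>x\<in>verts G. ?p x) = (\<Sum>x\<in>verts G. vweight G x) / total_weight G"
    by (simp add: sum_divide_distrib)
  also have "\<dots> = 1"
    using total_weight_pos[OF assms] by (simp add: total_weight_def)
  finally have one: "(\<integral>\<^sup>+ x. ennreal (?p x) \<partial>count_space UNIV) = 1" by simp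
  show ?thesis
    unfolding vertex_pmf_def by (rule pmf_embed_pmf[OF nn one])
qed

lemma set_random_sample_subset:
  assumes "1 \<le> k" shows "set_pmf (random_sample k G) \<subseteq> simple_graphs"
proof
  fix H assume "H \<in> set_pmf (random_sample k G)"
  then obtain X \<Phi> where H: "H = simple_graph_of k {e. X e}"
    and X: "X \<in> set_pmf (Pi_pmf (pairs k) False (\<lambda>(u, v). bernoulli_pmf (eweight G (\<Phi> u) (\<Phi> v))))"
    by (auto simp: random_sample_def)
  have "pairs k \<subseteq> {1..k} \<times> {1..k}" by (auto simp: pairs_def)
  then have fin: "finite (pairs k)" by (rule finite_subset) simp
  have "X e \<Longrightarrow> e \<in> pairs k" for e
    using set_Pi_pmf_subset[OF fin] X by fastforce
  then show "H \<in> simple_graphs"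
    using assms unfolding H
    by (fastforce simp: simple_graphs_def wgraphs_def verts_def simple_graph_of_def pairs_def)
qed

lemma id_mp_bijections: "(\<lambda>x. x) \<in> mp_bijections"
  using bij_betw_id[of "{0..1::real}"]
  by (simp add: mp_bijections_def distr_id id_def)

lemma vertex_interval_disjoint:
  assumes G: "G \<in> wgraphs" and i: "i \<in> verts G" and j: "j \<in> verts G"
    and x: "x \<in> vertex_interval G i" "x \<in> vertex_interval G j"
  shows "i = j"
proof -
  define a where "a = (\<lambda>m. (\<Sum>j=1..m. vweight G j) / total_weight G)"
  have nn: "0 \<le> vweight G j" for j
    using G unfolding wgraphs_def by (cases "j \<in> verts G") (auto intro: less_imp_le)
  have mono: "a m \<le> a n" if "m \<le> n" for m n
    unfolding a_def using that total_weight_pos[OF G] nn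
    by (intro divide_right_mono sum_mono2) auto
  have nonneg: "0 \<le> a m" for m
    using mono[of 0 m] by (simp add: a_def)
  have False if "m < n" "1 \<le> m" "x \<in> vertex_interval G m" "x \<in> vertex_interval G n" for m n
  proof -
    have "a (n - 1) < x" using that by (simp add: vertex_interval_def Let_def a_def)
    moreover have "x \<le> a m"
      using that nonneg[of m]
      by (auto simp: vertex_interval_def Let_def a_def split: if_splits)
    moreover have "a m \<le> a (n - 1)" using that by (intro mono) simp
    ultimately show False by simp
  qed
  then show ?thesis
    using i j x by (metis atLeastAtMost_iff linorder_neqE_nat verts_def)
qed

lemma vertex_interval_cover:
  assumes G: "G \<in> wgraphs" and x: "x \<in> {0..1}"
  shows "\<exists>i\<in>verts G. x \<in> vertex_interval G i"
proof -
  define a where "a = (\<lambda>m. (\<Sum>j=1..m. vweight G j) / total_weight G)"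
  have one: "a (nverts G) = 1"
    using total_weight_pos[OF G] by (simp add: a_def total_weight_def verts_def)
  have n: "1 \<le> nverts G" using G by (simp add: wgraphs_def)
  show ?thesis
  proof (cases "x = 0")
    case True
    with n show ?thesis
      by (intro bexI[of _ 1]) (simp_all add: vertex_interval_def Let_def verts_def)
  next
    case False
    define i where "i = (LEAST m. x \<le> a m)"
    have ex: "x \<le> a (nverts G)" using one x by simp
    have le: "x \<le> a i" unfolding i_def by (rule LeastI[of "\<lambda>m. x \<le> a m", OF ex])
    have "i \<le> nverts G" unfolding i_def by (rule Least_le[of "\<lambda>m. x \<le> a m", OF ex])
    moreover have "i \<noteq> 0"
    proof
      assume "i = 0"
      then have "a i = 0" by (simp add: a_def)
      with le False x show False by simp
    qed
    moreover have "a (i - 1) < x"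
      using not_less_Least[of "i - 1" "\<lambda>m. x \<le> a m"] \<open>i \<noteq> 0\<close> by (simp add: i_def)
    ultimately show ?thesis
      using le by (intro bexI[of _ i]) (auto simp: vertex_interval_def Let_def verts_def a_def)
  qed
qed

lemma graphon_of_eq:
  assumes G: "G \<in> wgraphs" and i: "i \<in> verts G" and j: "j \<in> verts G"
    and x: "x \<in> vertex_interval G i" and y: "y \<in> vertex_interval G j"
  shows "graphon_of G x y = eweight G i j"
proof -
  have fin: "finite (verts G)" by (simp add: verts_def)
  have *: "indicator (vertex_interval G k) x = (if k = i then 1 else (0::real))"
    "indicator (vertex_interval G k) y = (if k = j then 1 else (0::real))" if "k \<in> verts G" for k
    using vertex_interval_disjoint[OF G that i _ x] vertex_interval_disjoint[OF G that j _ y] x y by (fastforce simp: indicator_def)+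
  have "graphon_of G x y = (\<Sum>k\<in>verts G. \<Sum>l\<in>verts G.
     eweight G k l * (if k = i then 1 else 0) * (if l = j then 1 else 0))"
    unfolding graphon_of_def by (intro sum.cong refl) (simp add: *)
  also have "\<dots> = (\<Sum>k\<in>verts G. eweight G k j * (if k = i then 1 else 0))"
    using fin j by (intro sum.cong refl) (simp add: if_distrib cong: if_cong)
  also have "\<dots> = eweight G i j"
    using fin i by (simp add: if_distrib cong: if_cong)
  finally show ?thesis .
qed

lemma graphon_of_in_graphons:
  assumes G: "G \<in> wgraphs" shows "graphon_of G \<in> graphons"
proof -
  have [measurable]: "vertex_interval G i \<in> sets borel" for i
    by (simp add: vertex_interval_def Let_def)
  have "(\<lambda>z. graphon_of G (fst z) (snd z)) \<in> borel_measurable borel"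
    unfolding graphon_of_def borel_prod[symmetric] by measurable
  then have "(\<lambda>z. graphon_of G (fst z) (snd z)) \<in> borel_measurable lebesgue"
    by (simp add: measurable_completion)
  then have "(\<lambda>z. graphon_of G (fst z) (snd z)) \<in> borel_measurable (lebesgue_on ({0..1} \<times> {0..1}))"
    by (rule measurable_restrict_space1)
  moreover have "0 \<le> graphon_of G x y \<and> graphon_of G x y \<le> 1 \<and> graphon_of G x y = graphon_of G y x"
    if xy: "x \<in> {0..1}" "y \<in> {0..1}" for x y
  proof -
    obtain i j where ij: "i \<in> verts G" "x \<in> vertex_interval G i"
      "j \<in> verts G" "y \<in> vertex_interval G j"
      using vertex_interval_cover[OF G] xy by meson
    show ?thesis
      using G ij graphon_of_eq[OF G ij(1) ij(3) ij(2) ij(4)] graphon_of_eq[OF G ij(3) ij(1) ij(4) ij(2)]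
      by (auto simp: wgraphs_def)
  qed
  ultimately show ?thesis by (simp add: graphons_def)
qed

end

theory Submission
  imports Defs "HOL-Library.Diagonal_Subsequence"
begin

text \<open>
  The finite core is the sampling lemma: with high probability a sample \<open>\<xi>(k, G)\<close> is close to \<open>G\<close> in the
  cut distance, uniformly in \<open>G\<close>. By weak regularity \<open>G\<close> is close to a bounded function of finitely many vertex
  classes. The sampled matrix minus the sampled class function has small 4-cycle density in the mean, and the
  4-cycle density bounds the fourth power of the cut norm. The class frequencies of the sample concentrate,
  which gives a coupling of the vertices of \<open>G\<close> with those of the sample that mostly respects the classes.
  A coupling is realised by an exchange of finitely many intervals, and conversely a measure preserving
  bijection induces a coupling, so that cut distances of graphs are cut norms of finite matrices.

  Convergence of homomorphism densities means convergence of the laws of all samples. Hence (a) and (b) give (c),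
  as nearby graphs have a common typical sample. The counting lemma and a diagonal subsequence give (e) from (c),
  and the sampling lemma gives (a) from (e). The extension in (d) is a limit along \<open>L\<^sup>1\<close>
  approximations. For the converse, convergent sequences of graphs are Cauchy in the cut distance, and the space of
  graphons is complete.
\<close>

subsection \<open>Cut norms of finite weighted matrices\<close>

text \<open>In (a) and (b) one number \<open>k\<close> is both the sample size and the threshold for
  the vertex weights, and an estimate for one \<open>k\<close> says nothing about larger
  \<open>k\<close>. Clause (e) is therefore the hub: it yields the sampling estimate for all large
  \<open>k\<close>. Thus (a) gives (b) only by way of (e), combined with a bound on \<open>f\<close>
  that exists because samples of a fixed size take finitely many values. Bounds are carried as
  predicates, \<open>cut_le\<close> and \<open>overlay_le\<close>, with an explicit constant, so
  that no supremum or infimum has to be attained. Fractional vertex weights do no harm anywhere,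
  because a bilinear form on a box is extremal at sets. The probabilistic part needs only second
  moments of class frequencies, averages over 4-cycles and Markov's inequality. Two points of
  measure theory shape the second half. Lebesgue measure on the square is the completion of a
  product measure, so facts about products are carried over up to null sets. The inverse of a
  measure preserving bijection is not assumed to be measurable, so invariance of the cut norm is
  shown for step kernels, where only the measures of level sets count.\<close>

definition cut_le :: "'a set \<Rightarrow> ('a \<Rightarrow> real) \<Rightarrow> ('a \<Rightarrow> 'a \<Rightarrow> real) \<Rightarrow> real \<Rightarrow> bool" where
  "cut_le I x m c \<longleftrightarrow> (\<forall>S\<subseteq>I. \<forall>T\<subseteq>I. \<bar>\<Sum>i\<in>S. \<Sum>j\<in>T. x i * x j * m i j\<bar> \<le> c)"

lemma cut_le_nonneg: "cut_le I x m c \<Longrightarrow> 0 \<le> c"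
  unfolding cut_le_def by (drule spec[of _ "{}"]) auto

lemma cut_leD: "cut_le I x m c \<Longrightarrow> S \<subseteq> I \<Longrightarrow> T \<subseteq> I \<Longrightarrow> \<bar>\<Sum>i\<in>S. \<Sum>j\<in>T. x i * x j * m i j\<bar> \<le> c"
  unfolding cut_le_def by blast

lemma cut_le_uminus: "cut_le I x m c \<Longrightarrow> cut_le I x (\<lambda>i j. - m i j) c"
  unfolding cut_le_def by (simp add: sum_negf)

text \<open>On the box of all \<open>s\<close> between 0 and \<open>x\<close> a linear form is
  largest at the corner that keeps the coordinates with positive coefficient.\<close>

lemma linear_form_le_vertex:
  fixes x s r :: "'a \<Rightarrow> real"
  assumes "finite I" and s: "\<And>i. i \<in> I \<Longrightarrow> 0 \<le> s i \<and> s i \<le> x i"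
  shows "\<exists>S\<subseteq>I. (\<Sum>i\<in>I. s i * r i) \<le> (\<Sum>i\<in>S. x i * r i)"
proof (intro exI conjI)
  let ?S = "{i\<in>I. 0 < r i}"
  show "?S \<subseteq> I" by blast
  have "(\<Sum>i\<in>I. s i * r i) \<le> (\<Sum>i\<in>I. if 0 < r i then x i * r i else 0)"
  proof (rule sum_mono)
    fix i assume "i \<in> I"
    with s[OF this] show "s i * r i \<le> (if 0 < r i then x i * r i else 0)"
      by (auto intro!: mult_right_mono simp: mult_nonneg_nonpos)
  qed
  also have "\<dots> = (\<Sum>i\<in>?S. x i * r i)"
    using assms(1) by (simp add: sum.inter_filter)
  finally show "(\<Sum>i\<in>I. s i * r i) \<le> (\<Sum>i\<in>?S. x i * r i)" .
qed

text \<open>The form is linear in \<open>s\<close> and in \<open>t\<close> separately, so each can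
  be pushed to a corner of its box, that is, to a set. This lets tests by sets control a measurable
  set that cuts through vertex classes, a partly used fibre of a map, or a product of weights in the
  unit interval.\<close>

lemma cut_le_fractional:
  assumes "finite I" and c: "cut_le I x m c"
    and s: "\<And>i. i \<in> I \<Longrightarrow> 0 \<le> s i \<and> s i \<le> x i"
    and t: "\<And>i. i \<in> I \<Longrightarrow> 0 \<le> t i \<and> t i \<le> x i"
  shows "\<bar>\<Sum>i\<in>I. \<Sum>j\<in>I. s i * t j * m i j\<bar> \<le> c"
proof -
  have *: "(\<Sum>i\<in>I. \<Sum>j\<in>I. s i * t j * m i j) \<le> c" if c: "cut_le I x m c" for m
  proof -
    obtain S where S: "S \<subseteq> I" "(\<Sum>i\<in>I. s i * (\<Sum>j\<in>I. t j * m i j)) \<le> (\<Sum>i\<in>S. x i * (\<Sum>j\<in>I. t j * m i j))"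
      using linear_form_le_vertex[of I s x "\<lambda>i. \<Sum>j\<in>I. t j * m i j"] assms(1) s by auto
    obtain T where T: "T \<subseteq> I" "(\<Sum>j\<in>I. t j * (\<Sum>i\<in>S. x i * m i j)) \<le> (\<Sum>j\<in>T. x j * (\<Sum>i\<in>S. x i * m i j))"
      using linear_form_le_vertex[of I t x "\<lambda>j. \<Sum>i\<in>S. x i * m i j"] assms(1) t by auto
    have "(\<Sum>i\<in>I. \<Sum>j\<in>I. s i * t j * m i j) = (\<Sum>i\<in>I. s i * (\<Sum>j\<in>I. t j * m i j))"
      by (simp add: sum_distrib_left mult.assoc)
    also note S(2)
    also have "(\<Sum>i\<in>S. x i * (\<Sum>j\<in>I. t j * m i j)) = (\<Sum>j\<in>I. t j * (\<Sum>i\<in>S. x i * m i j))"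
      unfolding sum_distrib_left by (subst sum.swap) (rule sum.cong[OF refl], rule sum.cong[OF refl], simp)
    also note T(2)
    also have "(\<Sum>j\<in>T. x j * (\<Sum>i\<in>S. x i * m i j)) = (\<Sum>i\<in>S. \<Sum>j\<in>T. x i * x j * m i j)"
      unfolding sum_distrib_left by (subst sum.swap) (rule sum.cong[OF refl], rule sum.cong[OF refl], simp)
    also have "\<dots> \<le> c" using cut_leD[OF c S(1) T(1)] by linarith
    finally show ?thesis .
  qed
  show ?thesis
    using *[OF c] *[OF cut_le_uminus[OF c]] by (simp add: sum_negf)
qed

text \<open>Splitting \<open>p\<close> and \<open>q\<close> into positive and negative parts, scaled
  into the unit interval, leaves four fractional tests; hence the factor 4.\<close>

lemma cut_le_signed:
  assumes I: "finite I" and c: "cut_le I x m c" and x: "\<And>i. i \<in> I \<Longrightarrow> 0 \<le> x i"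
    and p: "\<And>i. i \<in> I \<Longrightarrow> \<bar>p i\<bar> \<le> M" and q: "\<And>i. i \<in> I \<Longrightarrow> \<bar>q i\<bar> \<le> N" and M: "0 \<le> M" "0 \<le> N"
  shows "\<bar>\<Sum>i\<in>I. \<Sum>j\<in>I. x i * x j * m i j * (p i * q j)\<bar> \<le> 4 * M * N * c"
proof (cases "M = 0 \<or> N = 0")
  case True
  then have "x i * x j * m i j * (p i * q j) = 0" if "i \<in> I" "j \<in> I" for i j
    using p[OF that(1)] q[OF that(2)] by auto
  then have "(\<Sum>i\<in>I. \<Sum>j\<in>I. x i * x j * m i j * (p i * q j)) = 0" by (intro sum.neutral ballI)
  then show ?thesis using cut_le_nonneg[OF c] True by auto
next
  case False
  then have pos: "0 < M" "0 < N" using M by auto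
  define P where "P = (\<lambda>(\<sigma>::bool) i. (if \<sigma> then max 0 (p i) else max 0 (- p i)) / M)"
  define Q where "Q = (\<lambda>(\<sigma>::bool) i. (if \<sigma> then max 0 (q i) else max 0 (- q i)) / N)"
  define B where "B = (\<lambda>\<sigma> \<tau>. \<Sum>i\<in>I. \<Sum>j\<in>I. (x i * P \<sigma> i) * (x j * Q \<tau> j) * m i j)"
  have P01: "0 \<le> P \<sigma> i" "P \<sigma> i \<le> 1" if "i \<in> I" for \<sigma> i
    using p[OF that] pos by (auto simp: P_def field_simps)
  have Q01: "0 \<le> Q \<sigma> i" "Q \<sigma> i \<le> 1" if "i \<in> I" for \<sigma> i
    using q[OF that] pos by (auto simp: Q_def field_simps)
  have pP: "p i = M * (P True i - P False i)" for i
    using pos by (auto simp: P_def max_def field_simps)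
  have qQ: "q i = N * (Q True i - Q False i)" for i
    using pos by (auto simp: Q_def max_def field_simps)
  have Bc: "\<bar>B \<sigma> \<tau>\<bar> \<le> c" for \<sigma> \<tau>
    unfolding B_def
    by (rule cut_le_fractional[OF I c]) (auto intro!: mult_left_le mult_nonneg_nonneg x P01 Q01)
  have "(\<Sum>i\<in>I. \<Sum>j\<in>I. x i * x j * m i j * (p i * q j))
     = M * N * (B True True - B True False - B False True + B False False)"
    unfolding B_def sum_subtractf[symmetric] sum.distrib[symmetric] sum_distrib_left
    by (intro sum.cong refl) (simp add: pP qQ algebra_simps)
  also have "\<bar>\<dots>\<bar> = M * N * \<bar>B True True - B True False - B False True + B False False\<bar>"
    using pos by (simp add: abs_mult)
  also have "\<dots> \<le> M * N * (4 * c)"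
    using Bc[of True True] Bc[of True False] Bc[of False True] Bc[of False False] pos
    by (intro mult_left_mono) auto
  finally show ?thesis by (simp add: mult_ac)
qed

lemma sum_swap3: "(\<Sum>a\<in>A. \<Sum>b\<in>B. \<Sum>c\<in>C. f a b c) = (\<Sum>b\<in>B. \<Sum>c\<in>C. \<Sum>a\<in>A. f a b c)"
  by (rule trans[OF sum.swap], rule sum.cong[OF refl], rule sum.swap)

lemma sum_swap4: "(\<Sum>a\<in>A. \<Sum>b\<in>B. \<Sum>c\<in>C. \<Sum>d\<in>D. f a b c d) = (\<Sum>c\<in>C. \<Sum>d\<in>D. \<Sum>a\<in>A. \<Sum>b\<in>B. f a b c d)"
  by (rule trans[OF sum.cong[OF refl sum_swap3] sum_swap3])

text \<open>Each step subtracts a multiple \<open>\<plusminus>\<epsilon>\<close> of the indicator of a rectangle witnessing a large cut, which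
  lowers the energy by at least \<open>\<epsilon>\<^sup>2\<close>.\<close>
lemma weak_regularity:
  fixes x :: "'a \<Rightarrow> real"
  assumes I: "finite I" and x: "\<And>i. i \<in> I \<Longrightarrow> 0 \<le> x i" and x1: "(\<Sum>i\<in>I. x i) = 1" and e: "0 < e"
    and en: "(\<Sum>i\<in>I. \<Sum>j\<in>I. x i * x j * (m i j)\<^sup>2) \<le> real n * e\<^sup>2"
  shows "\<exists>(c::'a \<Rightarrow> nat) h. (\<forall>i. c i < 4 ^ n) \<and> (\<forall>p q. \<bar>h p q\<bar> \<le> real n * e)
    \<and> cut_le I x (\<lambda>i j. m i j - h (c i) (c j)) e"
  using en
proof (induction n arbitrary: m)
  case 0
  then have z: "(\<Sum>i\<in>I. \<Sum>j\<in>I. x i * x j * (m i j)\<^sup>2) \<le> 0" by simp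
  have nn: "0 \<le> x i * x j * (m i j)\<^sup>2" if "i \<in> I" "j \<in> I" for i j using x that by simp
  have "(\<Sum>i\<in>I. \<Sum>j\<in>I. x i * x j * (m i j)\<^sup>2) = 0"
    using nn by (intro antisym z sum_nonneg)
  then have "\<forall>i\<in>I. (\<Sum>j\<in>I. x i * x j * (m i j)\<^sup>2) = 0"
    using nn I by (subst (asm) sum_nonneg_eq_0_iff) (auto intro: sum_nonneg)
  then have "x i * x j * (m i j)\<^sup>2 = 0" if "i \<in> I" "j \<in> I" for i j
    using nn I that by (metis (no_types, lifting) sum_nonneg_eq_0_iff)
  then have "x i * x j * m i j = 0" if "i \<in> I" "j \<in> I" for i j
    using that by auto
  then have "(\<Sum>i\<in>S. \<Sum>j\<in>T. x i * x j * m i j) = 0" if "S \<subseteq> I" "T \<subseteq> I" for S T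
    using that by (intro sum.neutral ballI) blast
  then have "cut_le I x m e" using e unfolding cut_le_def by simp
  then show ?case by (intro exI[of _ "\<lambda>_. 0"] exI[of _ "\<lambda>_ _. 0"]) simp
next
  case (Suc n)
  show ?case
  proof (cases "cut_le I x m e")
    case True
    then show ?thesis using e
      by (intro exI[of _ "\<lambda>_. 0"] exI[of _ "\<lambda>_ _. 0"]) simp
  next
    case False
    then obtain S T where ST: "S \<subseteq> I" "T \<subseteq> I" "e < \<bar>\<Sum>i\<in>S. \<Sum>j\<in>T. x i * x j * m i j\<bar>"
      unfolding cut_le_def by (auto simp: not_le)
    define \<sigma> where "\<sigma> = sgn (\<Sum>i\<in>S. \<Sum>j\<in>T. x i * x j * m i j)"
    have s1: "\<bar>\<sigma>\<bar> \<le> 1" "\<sigma>\<^sup>2 \<le> 1" by (auto simp: \<sigma>_def sgn_if)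
    define b where "b = (\<lambda>i j. (of_bool (i \<in> S) * of_bool (j \<in> T) :: real))"
    define m' where "m' = (\<lambda>i j. m i j - \<sigma> * e * b i j)"
    have ip: "(\<Sum>i\<in>I. \<Sum>j\<in>I. x i * x j * m i j * b i j) = (\<Sum>i\<in>S. \<Sum>j\<in>T. x i * x j * m i j)"
    proof -
      have "(\<Sum>i\<in>I. \<Sum>j\<in>I. x i * x j * m i j * b i j) = (\<Sum>i\<in>I. of_bool (i\<in>S) * (\<Sum>j\<in>I. of_bool (j \<in> T) * (x i * x j * m i j)))"
        unfolding sum_distrib_left by (intro sum.cong refl) (simp add: b_def mult_ac)
      also have "\<dots> = (\<Sum>i\<in>S. \<Sum>j\<in>T. x i * x j * m i j)"
        using ST by (simp add: sum_of_bool_mult_eq[OF I] Int_absorb1)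
      finally show ?thesis .
    qed
    have bb: "(\<Sum>i\<in>I. \<Sum>j\<in>I. x i * x j * (b i j)\<^sup>2) \<le> 1"
    proof -
      have "(\<Sum>i\<in>I. \<Sum>j\<in>I. x i * x j * (b i j)\<^sup>2) \<le> (\<Sum>i\<in>I. \<Sum>j\<in>I. x i * x j)"
        by (intro sum_mono) (auto simp: b_def x)
      also have "\<dots> = 1" by (simp add: sum_distrib_left[symmetric] x1)
      finally show ?thesis .
    qed
    have "(\<Sum>i\<in>I. \<Sum>j\<in>I. x i * x j * (m' i j)\<^sup>2)
      = (\<Sum>i\<in>I. \<Sum>j\<in>I. x i * x j * (m i j)\<^sup>2) - 2 * e * (\<sigma> * (\<Sum>i\<in>I. \<Sum>j\<in>I. x i * x j * m i j * b i j))
         + \<sigma>\<^sup>2 * e\<^sup>2 * (\<Sum>i\<in>I. \<Sum>j\<in>I. x i * x j * (b i j)\<^sup>2)"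
      unfolding sum_distrib_left sum_subtractf[symmetric] sum.distrib[symmetric]
      by (intro sum.cong refl) (simp add: m'_def power2_eq_square algebra_simps)
    also have "\<sigma> * (\<Sum>i\<in>I. \<Sum>j\<in>I. x i * x j * m i j * b i j) = \<bar>\<Sum>i\<in>S. \<Sum>j\<in>T. x i * x j * m i j\<bar>"
      unfolding ip \<sigma>_def by (simp add: sgn_if abs_if)
    also have "(\<Sum>i\<in>I. \<Sum>j\<in>I. x i * x j * (m i j)\<^sup>2) - 2 * e * \<bar>\<Sum>i\<in>S. \<Sum>j\<in>T. x i * x j * m i j\<bar>
         + \<sigma>\<^sup>2 * e\<^sup>2 * (\<Sum>i\<in>I. \<Sum>j\<in>I. x i * x j * (b i j)\<^sup>2)
      \<le> real (Suc n) * e\<^sup>2 - 2 * e * e + e\<^sup>2"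
    proof -
      have "\<sigma>\<^sup>2 * e\<^sup>2 * (\<Sum>i\<in>I. \<Sum>j\<in>I. x i * x j * (b i j)\<^sup>2) \<le> (1 * e\<^sup>2) * 1"
        by (intro mult_mono bb s1) (auto intro!: sum_nonneg mult_nonneg_nonneg x)
      moreover have "2 * e * e \<le> 2 * e * \<bar>\<Sum>i\<in>S. \<Sum>j\<in>T. x i * x j * m i j\<bar>"
        using ST(3) e by (intro mult_left_mono) auto
      ultimately show ?thesis using Suc.prems by linarith
    qed
    also have "\<dots> = real n * e\<^sup>2" by (simp add: power2_eq_square algebra_simps)
    finally obtain c h where ch: "\<And>i. c i < (4::nat) ^ n" "\<And>p q. \<bar>h p q\<bar> \<le> real n * e"
      "cut_le I x (\<lambda>i j. m' i j - h (c i) (c j)) e"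
      using Suc.IH by blast
    \<comment> \<open>A base 4 digit is appended to the class number: its high bit records
      membership in \<open>S\<close>, its low bit membership in \<open>T\<close>. The new function
      \<open>h'\<close> reads the row bit through \<open>mod 4\<close> and the column bit through
      parity.\<close>
    define c' where "c' = (\<lambda>i. 4 * c i + 2 * of_bool (i \<in> S) + of_bool (i \<in> T))"
    define h' where "h' = (\<lambda>p q. h (p div 4) (q div 4) + \<sigma> * e * (of_bool (2 \<le> p mod 4) * of_bool (odd q)))"
    have "c' i < 4 ^ Suc n" for i
      using ch(1)[of i] by (auto simp: c'_def of_bool_def)
    moreover have "\<bar>h' p q\<bar> \<le> real (Suc n) * e" for p q
    proof -
      have "\<bar>h' p q\<bar> \<le> \<bar>h (p div 4) (q div 4)\<bar> + \<bar>\<sigma> * e\<bar>"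
        by (auto simp: h'_def)
      also have "\<dots> \<le> real n * e + 1 * e"
        using s1 e by (intro add_mono ch(2)) (auto simp: abs_mult intro!: mult_right_mono)
      finally show ?thesis by (simp add: algebra_simps)
    qed
    moreover have "m i j - h' (c' i) (c' j) = m' i j - h (c i) (c j)" for i j
    proof -
      have "c' i div 4 = c i" for i by (auto simp: c'_def of_bool_def)
      moreover have "2 \<le> c' i mod 4 \<longleftrightarrow> i \<in> S" by (auto simp: c'_def of_bool_def)
      moreover have "odd (c' j) \<longleftrightarrow> j \<in> T" by (auto simp: c'_def of_bool_def)
      ultimately show ?thesis by (simp add: h'_def m'_def b_def)
    qed
    ultimately show ?thesis using ch(3)
      by (intro exI[of _ c'] exI[of _ h']) (simp add: )
  qed
qed

section \<open>Four-cycle densities and the cut norm\<close>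

lemma weighted_square_le:
  fixes x s r :: "'a \<Rightarrow> real"
  assumes s: "\<And>i. i \<in> I \<Longrightarrow> \<bar>s i\<bar> \<le> x i" and x1: "(\<Sum>i\<in>I. x i) \<le> 1"
  shows "(\<Sum>i\<in>I. s i * r i)\<^sup>2 \<le> (\<Sum>i\<in>I. x i * (r i)\<^sup>2)"
proof -
  have x: "0 \<le> x i" if "i \<in> I" for i using s[OF that] by linarith
  have "\<bar>\<Sum>i\<in>I. s i * r i\<bar> \<le> (\<Sum>i\<in>I. \<bar>s i\<bar> * \<bar>r i\<bar>)"
    by (rule order_trans[OF sum_abs]) (simp add: abs_mult)
  \<comment> \<open>With \<open>x i\<close> split into two square roots, Cauchy-Schwarz separates
    the total weight, which is at most 1.\<close>
  also have "\<dots> \<le> (\<Sum>i\<in>I. sqrt (x i) * (sqrt (x i) * \<bar>r i\<bar>))"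
    using s x by (intro sum_mono) (auto simp: mult.assoc[symmetric] intro!: mult_right_mono)
  finally have "(\<Sum>i\<in>I. s i * r i)\<^sup>2 \<le> (\<Sum>i\<in>I. sqrt (x i) * (sqrt (x i) * \<bar>r i\<bar>))\<^sup>2"
    by (simp add: abs_le_square_iff[symmetric])
  also have "\<dots> \<le> (\<Sum>i\<in>I. (sqrt (x i))\<^sup>2) * (\<Sum>i\<in>I. (sqrt (x i) * \<bar>r i\<bar>)\<^sup>2)"
    by (rule Cauchy_Schwarz_ineq_sum)
  also have "\<dots> = (\<Sum>i\<in>I. x i) * (\<Sum>i\<in>I. x i * (r i)\<^sup>2)"
    using x by (simp add: power_mult_distrib cong: sum.cong)
  also have "\<dots> \<le> 1 * (\<Sum>i\<in>I. x i * (r i)\<^sup>2)"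
    using x1 by (intro mult_right_mono sum_nonneg) (auto simp: x)
  finally show ?thesis by simp
qed

text \<open>The density of the 4-cycle \<open>i\<close>, \<open>j\<close>, \<open>i'\<close>,
  \<open>j'\<close>, where \<open>i\<close> and \<open>i'\<close> are row indices and
  \<open>j\<close> and \<open>j'\<close> column indices; \<open>m\<close> need not be
  symmetric.\<close>

definition c4 :: "'a set \<Rightarrow> ('a \<Rightarrow> real) \<Rightarrow> ('a \<Rightarrow> 'a \<Rightarrow> real) \<Rightarrow> real" where
  "c4 I x m = (\<Sum>i\<in>I. \<Sum>i'\<in>I. \<Sum>j\<in>I. \<Sum>j'\<in>I. x i * x i' * x j * x j' * (m i j * m i' j * m i' j' * m i j'))"

text \<open>Two applications of Cauchy-Schwarz: the first squares the sum over columns and so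
  doubles the column index, the second, over pairs of columns, doubles the row index. No constant is
  lost, since the weights have total at most 1.\<close>

lemma c4_bilinear:
  assumes s: "\<And>i. i \<in> I \<Longrightarrow> \<bar>s i\<bar> \<le> x i" and t: "\<And>i. i \<in> I \<Longrightarrow> \<bar>t i\<bar> \<le> x i"
    and x1: "(\<Sum>i\<in>I. x i) \<le> 1"
  shows "(\<Sum>i\<in>I. \<Sum>j\<in>I. s i * t j * m i j) ^ 4 \<le> c4 I x m"
proof -
  have x: "0 \<le> x i" if "i \<in> I" for i using s[OF that] by linarith
  \<comment> \<open>The weighted number of common neighbours of the columns \<open>j\<close> and
    \<open>j'\<close>.\<close>
  define K where "K = (\<lambda>j j'. \<Sum>i\<in>I. x i * (m i j * m i j'))"
  have x2: "(\<Sum>p\<in>I\<times>I. x (fst p) * x (snd p)) \<le> 1"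
  proof -
    have "(\<Sum>p\<in>I\<times>I. x (fst p) * x (snd p)) = (\<Sum>i\<in>I. x i) * (\<Sum>i\<in>I. x i)"
      by (simp add: sum_product sum.cartesian_product case_prod_beta)
    also have "\<dots> \<le> 1" using x1 by (simp add: mult_le_one sum_nonneg x)
    finally show ?thesis .
  qed
  have "(\<Sum>i\<in>I. \<Sum>j\<in>I. s i * t j * m i j)\<^sup>2 = (\<Sum>i\<in>I. s i * (\<Sum>j\<in>I. t j * m i j))\<^sup>2"
    by (simp add: sum_distrib_left mult.assoc)
  also have "\<dots> \<le> (\<Sum>i\<in>I. x i * (\<Sum>j\<in>I. t j * m i j)\<^sup>2)"
    by (rule weighted_square_le[OF s x1])
  also have "\<dots> = (\<Sum>i\<in>I. \<Sum>j\<in>I. \<Sum>j'\<in>I. x i * ((t j * m i j) * (t j' * m i j')))"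
    unfolding power2_eq_square sum_product by (simp add: sum_distrib_left)
  also have "\<dots> = (\<Sum>j\<in>I. \<Sum>j'\<in>I. \<Sum>i\<in>I. x i * ((t j * m i j) * (t j' * m i j')))"
    by (rule sum_swap3)
  also have "\<dots> = (\<Sum>j\<in>I. \<Sum>j'\<in>I. (t j * t j') * K j j')"
    by (simp add: K_def sum_distrib_left mult_ac)
  also have "\<dots> = (\<Sum>p\<in>I\<times>I. (t (fst p) * t (snd p)) * K (fst p) (snd p))"
    by (simp add: sum.cartesian_product case_prod_beta)
  finally have "(\<Sum>i\<in>I. \<Sum>j\<in>I. s i * t j * m i j)\<^sup>2 \<le> (\<Sum>p\<in>I\<times>I. (t (fst p) * t (snd p)) * K (fst p) (snd p))" .
  then have "((\<Sum>i\<in>I. \<Sum>j\<in>I. s i * t j * m i j)\<^sup>2)\<^sup>2 \<le> (\<Sum>p\<in>I\<times>I. (t (fst p) * t (snd p)) * K (fst p) (snd p))\<^sup>2"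
    by (rule power_mono) simp
  also have "\<dots> \<le> (\<Sum>p\<in>I\<times>I. (x (fst p) * x (snd p)) * (K (fst p) (snd p))\<^sup>2)"
    by (rule weighted_square_le) (use t x x2 in \<open>auto simp: abs_mult intro!: mult_mono\<close>)
  also have "\<dots> = (\<Sum>j\<in>I. \<Sum>j'\<in>I. (x j * x j') * (K j j')\<^sup>2)"
    by (simp add: sum.cartesian_product case_prod_beta)
  also have "\<dots> = (\<Sum>j\<in>I. \<Sum>j'\<in>I. \<Sum>i\<in>I. \<Sum>i'\<in>I. x i * x i' * x j * x j' * (m i j * m i' j * m i' j' * m i j'))"
    unfolding K_def power2_eq_square sum_product by (simp add: sum_distrib_left mult_ac)
  also have "\<dots> = c4 I x m"
    unfolding c4_def by (rule sum_swap4)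
  finally show ?thesis by simp
qed

text \<open>With \<open>i'\<close> and \<open>j'\<close> fixed, the factors \<open>m i j'\<close>
  and \<open>m i' j\<close> depend on one summation variable each, so the sum over \<open>i\<close>
  and \<open>j\<close> is a signed test of \<open>m\<close>; the remaining entry costs one more
  factor \<open>M\<close>. Together with \<open>c4_bilinear\<close> this ties the cut norm to the
  4-cycle density for bounded entries.\<close>

lemma c4_le_cut:
  assumes I: "finite I" and c: "cut_le I x m c" and x: "\<And>i. i \<in> I \<Longrightarrow> 0 \<le> x i" and x1: "(\<Sum>i\<in>I. x i) = 1"
    and m: "\<And>i j. \<bar>m i j\<bar> \<le> M"
  shows "c4 I x m \<le> 4 * M ^ 3 * c"
proof -
  have M: "0 \<le> M" using m[of undefined undefined] by linarith
  have "c4 I x m = (\<Sum>i\<in>I. \<Sum>i'\<in>I. \<Sum>j'\<in>I. \<Sum>j\<in>I. x i * x i' * x j * x j' * (m i j * m i' j * m i' j' * m i j'))"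
    unfolding c4_def by (rule sum.cong[OF refl], rule sum.cong[OF refl], rule sum.swap)
  also have "\<dots> = (\<Sum>i'\<in>I. \<Sum>j'\<in>I. \<Sum>i\<in>I. \<Sum>j\<in>I. x i * x i' * x j * x j' * (m i j * m i' j * m i' j' * m i j'))"
    by (rule sum_swap3)
  also have "\<dots> = (\<Sum>i'\<in>I. \<Sum>j'\<in>I. (x i' * x j') * (m i' j' * (\<Sum>i\<in>I. \<Sum>j\<in>I. x i * x j * m i j * (m i j' * m i' j))))"
    unfolding sum_distrib_left by (intro sum.cong refl) (simp add: mult_ac)
  also have "\<dots> \<le> (\<Sum>i'\<in>I. \<Sum>j'\<in>I. (x i' * x j') * (M * (4 * M * M * c)))"
  proof (intro sum_mono mult_left_mono mult_nonneg_nonneg x)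
    fix i' j'
    have "\<bar>m i' j' * (\<Sum>i\<in>I. \<Sum>j\<in>I. x i * x j * m i j * (m i j' * m i' j))\<bar> \<le> M * (4 * M * M * c)"
      unfolding abs_mult using cut_le_signed[OF I c x, of "\<lambda>i. m i j'" M "m i'" M] m M
      by (intro mult_mono) auto
    then show "m i' j' * (\<Sum>i\<in>I. \<Sum>j\<in>I. x i * x j * m i j * (m i j' * m i' j)) \<le> M * (4 * M * M * c)" by linarith
  qed
  also have "\<dots> = M * (4 * M * M * c)"
    by (simp add: sum_distrib_right[symmetric] sum_distrib_left[symmetric] x1)
  finally show ?thesis by (simp add: power3_eq_cube mult_ac)
qed

subsection \<open>Couplings and overlays\<close>

text \<open>A subset of \<open>K\<close> takes from each fibre of \<pi> a mass between 0 and
  \<open>x i\<close>, so it acts as a fractional test on \<open>I\<close>. With the projections of a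
  coupling as \<pi>, bounds for two graphs are lifted to a common index set.\<close>

lemma cut_le_pullback:
  assumes fin: "finite K" "finite I" and pi: "\<pi> ` K \<subseteq> I" and X: "\<And>p. p \<in> K \<Longrightarrow> 0 \<le> X p"
    and x: "\<And>i. i \<in> I \<Longrightarrow> (\<Sum>p\<in>{p\<in>K. \<pi> p = i}. X p) = x i"
    and c: "cut_le I x m e"
  shows "cut_le K X (\<lambda>p q. m (\<pi> p) (\<pi> q)) e"
  unfolding cut_le_def
proof (intro allI impI)
  fix S T assume ST: "S \<subseteq> K" "T \<subseteq> K"
  have finST: "finite S" "finite T" using ST fin finite_subset by blast+
  define w where "w = (\<lambda>S i. \<Sum>p\<in>{p\<in>S. \<pi> p = i}. X p)"
  have w: "0 \<le> w S i \<and> w S i \<le> x i" if "S \<subseteq> K" "i \<in> I" for S i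
    unfolding w_def x[OF that(2), symmetric] using that X fin
    by (auto intro!: sum_nonneg sum_mono2)
  have grp: "(\<Sum>p\<in>S. X p * f (\<pi> p)) = (\<Sum>i\<in>I. w S i * f i)" if "S \<subseteq> K" for S f
  proof -
    have "(\<Sum>p\<in>S. X p * f (\<pi> p)) = (\<Sum>i\<in>I. \<Sum>p\<in>{p\<in>S. \<pi> p = i}. X p * f (\<pi> p))"
      using that pi fin by (intro sum.group[symmetric]) (auto intro: finite_subset)
    also have "\<dots> = (\<Sum>i\<in>I. w S i * f i)"
      unfolding w_def sum_distrib_right by (intro sum.cong refl) auto
    finally show ?thesis .
  qed
  have "(\<Sum>p\<in>S. \<Sum>q\<in>T. X p * X q * m (\<pi> p) (\<pi> q)) = (\<Sum>p\<in>S. X p * (\<Sum>q\<in>T. X q * m (\<pi> p) (\<pi> q)))"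
    by (simp add: sum_distrib_left mult_ac)
  also have "\<dots> = (\<Sum>p\<in>S. X p * (\<Sum>j\<in>I. w T j * m (\<pi> p) j))"
    using grp[OF ST(2)] by simp
  also have "\<dots> = (\<Sum>i\<in>I. w S i * (\<Sum>j\<in>I. w T j * m i j))"
    by (rule grp[OF ST(1)])
  also have "\<dots> = (\<Sum>i\<in>I. \<Sum>j\<in>I. w S i * w T j * m i j)"
    by (simp add: sum_distrib_left mult_ac)
  also have "\<bar>\<dots>\<bar> \<le> e"
    by (rule cut_le_fractional[OF fin(2) c]) (use w ST in auto)
  finally show "\<bar>\<Sum>p\<in>S. \<Sum>q\<in>T. X p * X q * m (\<pi> p) (\<pi> q)\<bar> \<le> e" .
qed

definition coupling :: "'a set \<Rightarrow> 'b set \<Rightarrow> ('a \<Rightarrow> real) \<Rightarrow> ('b \<Rightarrow> real) \<Rightarrow> ('a \<times> 'b \<Rightarrow> real) \<Rightarrow> bool" where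
  "coupling I J x y X \<longleftrightarrow> (\<forall>i\<in>I. \<forall>j\<in>J. 0 \<le> X (i, j)) \<and> (\<forall>i\<in>I. (\<Sum>j\<in>J. X (i, j)) = x i)
     \<and> (\<forall>j\<in>J. (\<Sum>i\<in>I. X (i, j)) = y j)"

lemma coupling_fst:
  assumes "coupling I J x y X" "finite I" "finite J" "i \<in> I"
  shows "(\<Sum>p\<in>{p\<in>I \<times> J. fst p = i}. X p) = x i"
proof -
  have "{p\<in>I \<times> J. fst p = i} = Pair i ` J" using assms(4) by auto
  then show ?thesis using assms by (simp add: sum.reindex inj_on_def coupling_def)
qed

lemma coupling_snd:
  assumes "coupling I J x y X" "finite I" "finite J" "j \<in> J"
  shows "(\<Sum>p\<in>{p\<in>I \<times> J. snd p = j}. X p) = y j"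
proof -
  have "{p\<in>I \<times> J. snd p = j} = (\<lambda>i. (i, j)) ` I" using assms(4) by auto
  then show ?thesis using assms by (simp add: sum.reindex inj_on_def coupling_def)
qed

lemma coupling_sum:
  assumes "coupling I J x y X" "finite I" "finite J" "(\<Sum>i\<in>I. x i) = 1"
  shows "(\<Sum>p\<in>I \<times> J. X p) = 1"
  using assms sum.cartesian_product[of "\<lambda>i j. X (i, j)" J I] by (simp add: coupling_def)

text \<open>A point of class \<open>k\<close> sends the share \<open>mn k / P k\<close> of its mass
  into the same class, proportionally to \<open>y\<close>, and the rest into the surplus of the
  other side, whose total is \<eta>; the shares add up to 1. Exchanging the roles of
  \<open>P\<close> and \<open>Q\<close> gives the other marginal.\<close>

lemma class_coupling_marginal:
  fixes y :: "'b \<Rightarrow> real"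
  assumes fin: "finite J" "finite K" and d: "d ` J \<subseteq> K" and y: "\<And>j. j \<in> J \<Longrightarrow> 0 \<le> y j"
    and Q: "\<And>k. Q k = (\<Sum>j\<in>{j\<in>J. d j = k}. y j)" and P: "\<And>k. 0 \<le> P k" and mn: "\<And>k. mn k = min (P k) (Q k)"
    and eta: "(\<Sum>k\<in>K. P k - mn k) = \<eta>" "(\<Sum>k\<in>K. Q k - mn k) = \<eta>" and k: "k \<in> K" "P k \<noteq> 0"
  shows "(\<Sum>j\<in>J. y j * (of_bool (k = d j) * (mn k / (P k * Q k)) + (1 - mn k / P k) * (1 - mn (d j) / Q (d j)) / \<eta>)) = 1"
proof -
  have Q0: "0 \<le> Q k" for k unfolding Q using y by (auto intro!: sum_nonneg)
  have gen: "a * (b + r * s / \<eta>) = a * b + r / \<eta> * (a * s)" for a b r s :: real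
    by (simp add: distrib_left mult_ac)
  have 1: "(\<Sum>j\<in>J. y j * (of_bool (k = d j) * (mn k / (P k * Q k)))) = Q k * (mn k / (P k * Q k))"
  proof -
    have "(\<Sum>j\<in>J. y j * (of_bool (k = d j) * (mn k / (P k * Q k)))) = (\<Sum>j\<in>J. of_bool (k = d j) * (y j * (mn k / (P k * Q k))))"
      by (simp add: mult_ac)
    also have "\<dots> = (\<Sum>j\<in>{j\<in>J. d j = k}. y j * (mn k / (P k * Q k)))"
      by (subst sum_of_bool_mult_eq[OF fin(1)]) (auto intro: sum.cong)
    finally show ?thesis unfolding Q[of k] sum_distrib_right .
  qed
  have 2: "(\<Sum>j\<in>J. y j * (1 - mn (d j) / Q (d j))) = \<eta>"
  proof -
    have "(\<Sum>j\<in>J. y j * (1 - mn (d j) / Q (d j))) = (\<Sum>k\<in>K. \<Sum>j\<in>{j\<in>J. d j = k}. y j * (1 - mn (d j) / Q (d j)))"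
      using d fin by (intro sum.group[symmetric]) auto
    also have "\<dots> = (\<Sum>k\<in>K. Q k * (1 - mn k / Q k))"
      unfolding Q sum_distrib_right by (intro sum.cong refl) auto
    also have "\<dots> = (\<Sum>k\<in>K. Q k - mn k)"
      using P Q0 by (intro sum.cong refl) (auto simp: mn right_diff_distrib)
    finally show ?thesis using eta by simp
  qed
  have "(\<Sum>j\<in>J. y j * (of_bool (k = d j) * (mn k / (P k * Q k)) + (1 - mn k / P k) * (1 - mn (d j) / Q (d j)) / \<eta>))
    = (\<Sum>j\<in>J. y j * (of_bool (k = d j) * (mn k / (P k * Q k)))) + (1 - mn k / P k) / \<eta> * (\<Sum>j\<in>J. y j * (1 - mn (d j) / Q (d j)))"
    unfolding sum_distrib_left sum.distrib[symmetric] using gen by (intro sum.cong refl)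
  also have "\<dots> = Q k * (mn k / (P k * Q k)) + (1 - mn k / P k) / \<eta> * \<eta>"
    unfolding 1 2 ..
  also have "Q k * (mn k / (P k * Q k)) = mn k / P k"
    using P[of k] Q0[of k] by (auto simp: mn min_def field_simps)
  also have "mn k / P k + (1 - mn k / P k) / \<eta> * \<eta> = 1"
  \<comment> \<open>For \<eta> = 0 the quotient is 0 by convention, and \<open>mn k / P k\<close>
    alone equals 1, because no class has a surplus.\<close>
  proof (cases "\<eta> = 0")
    case True
    have "(\<Sum>k\<in>K. P k - mn k) = 0" using eta(1) True by simp
    then have "\<forall>k\<in>K. P k - mn k = 0"
      using fin by (subst (asm) sum_nonneg_eq_0_iff) (auto simp: mn)
    then show ?thesis using k True by simp
  qed simp
  finally show ?thesis .
qed

text \<open>A maximal coupling of the class distributions, spread proportionally within the classes: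
  the common mass \<open>min (P k) (Q k)\<close> stays in class \<open>k\<close>, and the two
  surpluses are coupled independently. Only surplus mass can change its class, and it amounts to
  half the sum on the right.\<close>

lemma class_coupling:
  fixes x :: "'a \<Rightarrow> real" and y :: "'b \<Rightarrow> real"
  assumes fin: "finite I" "finite J" "finite K" and cd: "c ` I \<subseteq> K" "d ` J \<subseteq> K"
    and x: "\<And>i. i \<in> I \<Longrightarrow> 0 \<le> x i" "(\<Sum>i\<in>I. x i) = 1" and y: "\<And>j. j \<in> J \<Longrightarrow> 0 \<le> y j" "(\<Sum>j\<in>J. y j) = 1"
  shows "\<exists>X. coupling I J x y X \<and>
    (\<Sum>p\<in>{p\<in>I \<times> J. c (fst p) \<noteq> d (snd p)}. X p)
      \<le> (\<Sum>k\<in>K. \<bar>(\<Sum>i\<in>{i\<in>I. c i = k}. x i) - (\<Sum>j\<in>{j\<in>J. d j = k}. y j)\<bar>)"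
proof -
  define P where "P = (\<lambda>k. \<Sum>i\<in>{i\<in>I. c i = k}. x i)"
  define Q where "Q = (\<lambda>k. \<Sum>j\<in>{j\<in>J. d j = k}. y j)"
  define mn where "mn = (\<lambda>k. min (P k) (Q k))"
  define \<eta> where "\<eta> = (\<Sum>k\<in>K. P k - mn k)"
  have P0: "0 \<le> P k" for k unfolding P_def using x by (auto intro!: sum_nonneg)
  have Q0: "0 \<le> Q k" for k unfolding Q_def using y by (auto intro!: sum_nonneg)
  have sP: "(\<Sum>k\<in>K. P k) = 1" unfolding P_def using sum.group[OF fin(1,3) cd(1), of x] x by simp
  have sQ: "(\<Sum>k\<in>K. Q k) = 1" unfolding Q_def using sum.group[OF fin(2,3) cd(2), of y] y by simp
  have eta: "(\<Sum>k\<in>K. P k - mn k) = \<eta>" "(\<Sum>k\<in>K. Q k - mn k) = \<eta>"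
    using sP sQ by (simp_all add: \<eta>_def sum_subtractf)
  have eta0: "0 \<le> \<eta>" unfolding \<eta>_def by (auto intro!: sum_nonneg simp: mn_def)
  define R where "R = (\<lambda>i j. (1 - mn (c i) / P (c i)) * (1 - mn (d j) / Q (d j)) / \<eta>)"
  define Z where "Z = (\<lambda>i j. of_bool (c i = d j) * (mn (c i) / (P (c i) * Q (c i))) + R i j)"
  define X where "X = (\<lambda>(i, j). x i * y j * Z i j)"
  have fP: "0 \<le> 1 - mn k / P k" for k using P0[of k] Q0[of k] by (auto simp: mn_def field_simps min_def)
  have fQ: "0 \<le> 1 - mn k / Q k" for k using P0[of k] Q0[of k] by (auto simp: mn_def field_simps min_def)
  have R0: "0 \<le> R i j" for i j using fP fQ eta0 by (simp add: R_def)
  have Z0: "0 \<le> Z i j" for i j using P0 Q0 R0 by (auto simp: Z_def mn_def intro!: add_nonneg_nonneg)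
  have row: "(\<Sum>j\<in>J. X (i, j)) = x i" if i: "i \<in> I" for i
  \<comment> \<open>The quotients are meaningless for a class of mass 0, but all points of such a
    class have weight 0.\<close>
  proof (cases "P (c i) = 0")
    case True
    then have "\<forall>i'\<in>{i'\<in>I. c i' = c i}. x i' = 0"
      unfolding P_def using x fin by (subst (asm) sum_nonneg_eq_0_iff) auto
    then have "x i = 0" using i by blast
    then show ?thesis by (simp add: X_def)
  next
    case False
    have "(\<Sum>j\<in>J. X (i, j)) = x i * (\<Sum>j\<in>J. y j * Z i j)"
      by (simp add: X_def sum_distrib_left mult_ac)
    also have "(\<Sum>j\<in>J. y j * Z i j) = 1"
      unfolding Z_def R_def
      by (rule class_coupling_marginal[OF fin(2,3) cd(2) y(1) fun_cong[OF Q_def] P0 fun_cong[OF mn_def] eta]) (use i cd False in auto)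
    finally show ?thesis by simp
  qed
  have col: "(\<Sum>i\<in>I. X (i, j)) = y j" if j: "j \<in> J" for j
  proof (cases "Q (d j) = 0")
    case True
    then have "\<forall>i'\<in>{i'\<in>J. d i' = d j}. y i' = 0"
      unfolding Q_def using y fin by (subst (asm) sum_nonneg_eq_0_iff) auto
    then have "y j = 0" using j by blast
    then show ?thesis by (simp add: X_def)
  next
    case False
    have mn': "mn k = min (Q k) (P k)" for k by (simp add: mn_def min.commute)
    have "(\<Sum>i\<in>I. X (i, j)) = y j * (\<Sum>i\<in>I. x i * (of_bool (d j = c i) * (mn (d j) / (Q (d j) * P (d j))) + (1 - mn (d j) / Q (d j)) * (1 - mn (c i) / P (c i)) / \<eta>))"
      unfolding sum_distrib_left by (intro sum.cong refl) (auto simp: X_def Z_def R_def mult_ac)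
    also have "(\<Sum>i\<in>I. x i * (of_bool (d j = c i) * (mn (d j) / (Q (d j) * P (d j))) + (1 - mn (d j) / Q (d j)) * (1 - mn (c i) / P (c i)) / \<eta>)) = 1"
      by (rule class_coupling_marginal[OF fin(1,3) cd(1) x(1) fun_cong[OF P_def] Q0 mn' eta(2,1)]) (use j cd False in auto)
    finally show ?thesis by simp
  qed
  have cp: "coupling I J x y X"
    unfolding coupling_def using row col x y Z0 by (auto simp: X_def)
  have sx: "(\<Sum>i\<in>I. x i * (1 - mn (c i) / P (c i))) = \<eta>"
  proof -
    have "(\<Sum>i\<in>I. x i * (1 - mn (c i) / P (c i))) = (\<Sum>k\<in>K. \<Sum>i\<in>{i\<in>I. c i = k}. x i * (1 - mn (c i) / P (c i)))"
      using cd fin by (intro sum.group[symmetric]) auto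
    also have "\<dots> = (\<Sum>k\<in>K. P k * (1 - mn k / P k))"
      unfolding P_def sum_distrib_right by (intro sum.cong refl) auto
    also have "\<dots> = (\<Sum>k\<in>K. P k - mn k)"
      using P0 Q0 by (intro sum.cong refl) (auto simp: mn_def right_diff_distrib)
    finally show ?thesis using eta by simp
  qed
  have sy: "(\<Sum>i\<in>J. y i * (1 - mn (d i) / Q (d i))) = \<eta>"
  proof -
    have "(\<Sum>i\<in>J. y i * (1 - mn (d i) / Q (d i))) = (\<Sum>k\<in>K. \<Sum>i\<in>{i\<in>J. d i = k}. y i * (1 - mn (d i) / Q (d i)))"
      using cd fin by (intro sum.group[symmetric]) auto
    also have "\<dots> = (\<Sum>k\<in>K. Q k * (1 - mn k / Q k))"
      unfolding Q_def sum_distrib_right by (intro sum.cong refl) auto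
    also have "\<dots> = (\<Sum>k\<in>K. Q k - mn k)"
      using P0 Q0 by (intro sum.cong refl) (auto simp: mn_def right_diff_distrib)
    finally show ?thesis using eta by simp
  qed
  have "(\<Sum>p\<in>{p\<in>I \<times> J. c (fst p) \<noteq> d (snd p)}. X p)
    = (\<Sum>p\<in>{p\<in>I \<times> J. c (fst p) \<noteq> d (snd p)}. x (fst p) * y (snd p) * R (fst p) (snd p))"
    by (intro sum.cong refl) (auto simp: X_def Z_def)
  also have "\<dots> \<le> (\<Sum>p\<in>I \<times> J. x (fst p) * y (snd p) * R (fst p) (snd p))"
    using fin x y R0 by (intro sum_mono2) auto
  also have "\<dots> = (\<Sum>i\<in>I. \<Sum>j\<in>J. x i * y j * R i j)"
    by (simp add: sum.cartesian_product case_prod_beta)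
  also have "\<dots> = (\<Sum>i\<in>I. x i * (1 - mn (c i) / P (c i))) * (\<Sum>i\<in>J. y i * (1 - mn (d i) / Q (d i))) / \<eta>"
    unfolding sum_product sum_divide_distrib R_def by (intro sum.cong refl) (simp add: mult_ac)
  also have "\<dots> = \<eta>" unfolding sx sy by simp
  also have "\<dots> \<le> (\<Sum>k\<in>K. \<bar>P k - Q k\<bar>)"
    unfolding \<eta>_def by (intro sum_mono) (auto simp: mn_def)
  finally show ?thesis using cp unfolding P_def Q_def by blast
qed

lemma cut_le_add:
  assumes "cut_le I x m c" "cut_le I x m' c'"
  shows "cut_le I x (\<lambda>i j. m i j + m' i j) (c + c')"
  unfolding cut_le_def
proof (intro allI impI)
  fix S T assume ST: "S \<subseteq> I" "T \<subseteq> I"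
  have "(\<Sum>i\<in>S. \<Sum>j\<in>T. x i * x j * (m i j + m' i j))
     = (\<Sum>i\<in>S. \<Sum>j\<in>T. x i * x j * m i j) + (\<Sum>i\<in>S. \<Sum>j\<in>T. x i * x j * m' i j)"
    by (simp add: distrib_left sum.distrib)
  then show "\<bar>\<Sum>i\<in>S. \<Sum>j\<in>T. x i * x j * (m i j + m' i j)\<bar> \<le> c + c'"
    using cut_leD[OF assms(1) ST] cut_leD[OF assms(2) ST] by linarith
qed

lemma cut_le_diff:
  assumes "cut_le I x m c" "cut_le I x m' c'"
  shows "cut_le I x (\<lambda>i j. m i j - m' i j) (c + c')"
  using cut_le_add[OF assms(1) cut_le_uminus[OF assms(2)]] by simp

text \<open>Replacing an approximating class function by the class averages costs a factor 2 in the cut norm but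
  keeps the values in the unit interval. This bound is what makes the 4-cycle estimate usable.\<close>
lemma cut_le_class_average:
  fixes x :: "'a \<Rightarrow> real" and c :: "'a \<Rightarrow> 'b"
  assumes I: "finite I" and x: "\<And>i. i \<in> I \<Longrightarrow> 0 \<le> x i"
    and m: "\<And>i j. i \<in> I \<Longrightarrow> j \<in> I \<Longrightarrow> 0 \<le> m i j \<and> m i j \<le> 1"
    and c: "cut_le I x (\<lambda>i j. m i j - h (c i) (c j)) e"
  shows "\<exists>h'. (\<forall>p q. 0 \<le> h' p q \<and> h' p q \<le> 1) \<and> cut_le I x (\<lambda>i j. m i j - h' (c i) (c j)) (2 * e)"
proof -
  define C where "C = (\<lambda>S p. {i\<in>S. c i = p})"
  define P where "P = (\<lambda>p. \<Sum>i\<in>C I p. x i)"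
  define h' where "h' = (\<lambda>p q. (\<Sum>i\<in>C I p. \<Sum>j\<in>C I q. x i * x j * m i j) / (P p * P q))"
  have P0: "0 \<le> P p" for p unfolding P_def C_def using x by (auto intro!: sum_nonneg)
  have PP: "P p * P q = (\<Sum>i\<in>C I p. \<Sum>j\<in>C I q. x i * x j)" for p q by (simp add: P_def sum_product)
  have "0 \<le> h' p q" for p q
    unfolding h'_def using P0 x m by (intro divide_nonneg_nonneg sum_nonneg) (auto simp: C_def)
  moreover have "h' p q \<le> 1" for p q
  proof -
    have "(\<Sum>i\<in>C I p. \<Sum>j\<in>C I q. x i * x j * m i j) \<le> P p * P q"
      unfolding PP using x m by (intro sum_mono mult_left_le) (auto simp: C_def)
    then show ?thesis using P0[of p] P0[of q] unfolding h'_def by (intro divide_le_eq_1[THEN iffD2]) (auto simp: less_le)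
  qed
  moreover have "cut_le I x (\<lambda>i j. h' (c i) (c j) - h (c i) (c j)) e"
    unfolding cut_le_def
  proof (intro allI impI)
    fix S T assume ST: "S \<subseteq> I" "T \<subseteq> I"
    \<comment> \<open>The share of class \<open>p\<close> that lies in \<open>S\<close>. Both
      \<open>h'\<close> and \<open>h\<close> are constant on pairs of classes, so \<open>S\<close>
      and \<open>T\<close> enter only through these shares; and on a pair of whole classes
      \<open>h'\<close> may be replaced by \<open>m\<close>, whose average it is. What remains is a
      fractional test of the given approximation.\<close>
    define s where "s = (\<lambda>S p. (\<Sum>i\<in>C S p. x i) / P p)"
    have s01: "0 \<le> s S p" "s S p \<le> 1" if "S \<subseteq> I" for S p
    proof -
      have "0 \<le> (\<Sum>i\<in>C S p. x i)" using x that by (auto intro!: sum_nonneg simp: C_def)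
      moreover have "(\<Sum>i\<in>C S p. x i) \<le> P p" unfolding P_def
        using x that I by (intro sum_mono2) (auto simp: C_def)
      ultimately show "0 \<le> s S p" "s S p \<le> 1" using P0[of p] by (auto simp: s_def divide_le_eq_1)
    qed
    have sP: "(\<Sum>i\<in>C S p. x i) = s S p * P p" if "S \<subseteq> I" for S p
    proof (cases "P p = 0")
      case True
      then have "\<forall>i\<in>C I p. x i = 0"
        unfolding P_def using x I by (subst (asm) sum_nonneg_eq_0_iff) (auto simp: C_def)
      then have "(\<Sum>i\<in>C S p. x i) = 0" using that by (intro sum.neutral) (auto simp: C_def)
      then show ?thesis using True by simp
    qed (simp add: s_def)
    have grp: "(\<Sum>i\<in>S. f i) = (\<Sum>p\<in>c ` I. \<Sum>i\<in>C S p. f i)" if "S \<subseteq> I" for S f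
      unfolding C_def using that I by (intro sum.group[symmetric]) (auto intro: finite_subset)
    have grp2: "(\<Sum>i\<in>S. \<Sum>j\<in>T. f i j) = (\<Sum>p\<in>c ` I. \<Sum>q\<in>c ` I. \<Sum>i\<in>C S p. \<Sum>j\<in>C T q. f i j)"
      if "S \<subseteq> I" "T \<subseteq> I" for S T f
      unfolding grp[OF that(1)] grp[OF that(2)] by (intro sum.cong refl sum.swap)
    have "(\<Sum>i\<in>S. \<Sum>j\<in>T. x i * x j * (h' (c i) (c j) - h (c i) (c j)))
        = (\<Sum>p\<in>c ` I. \<Sum>q\<in>c ` I. \<Sum>i\<in>C S p. \<Sum>j\<in>C T q. x i * x j * (h' p q - h p q))"
      unfolding grp2[OF ST] by (intro sum.cong refl) (auto simp: C_def)
    also have "\<dots> = (\<Sum>p\<in>c ` I. \<Sum>q\<in>c ` I. (s S p * P p) * (s T q * P q) * (h' p q - h p q))"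
      unfolding sP[OF ST(1), symmetric] sP[OF ST(2), symmetric] sum_product by (simp add: sum_distrib_right)
    also have "\<dots> = (\<Sum>p\<in>c ` I. \<Sum>q\<in>c ` I. s S p * s T q * (\<Sum>i\<in>C I p. \<Sum>j\<in>C I q. x i * x j * (m i j - h p q)))"
    proof (intro sum.cong refl)
      fix p q
      have "P p * P q * (h' p q - h p q) = (\<Sum>i\<in>C I p. \<Sum>j\<in>C I q. x i * x j * (m i j - h p q))"
      proof (cases "P p * P q = 0")
        case True
        have "\<forall>i\<in>C I r. x i = 0" if "P r = 0" for r
          using that x I unfolding P_def by (subst (asm) sum_nonneg_eq_0_iff) (auto simp: C_def)
        then have "\<forall>i\<in>C I p. \<forall>j\<in>C I q. x i * x j = 0"
          using True by auto
        then have "(\<Sum>i\<in>C I p. \<Sum>j\<in>C I q. x i * x j * (m i j - h p q)) = 0"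
          by (intro sum.neutral ballI) auto
        then show ?thesis using True by simp
      next
        case False
        then have "P p * P q * h' p q = (\<Sum>i\<in>C I p. \<Sum>j\<in>C I q. x i * x j * m i j)"
          by (simp add: h'_def)
        then show ?thesis
          by (simp add: right_diff_distrib sum_subtractf PP sum_distrib_right)
      qed
      moreover have "s S p * P p * (s T q * P q) * (h' p q - h p q) = s S p * s T q * (P p * P q * (h' p q - h p q))"
        by (simp only: mult_ac)
      ultimately show "s S p * P p * (s T q * P q) * (h' p q - h p q)
        = s S p * s T q * (\<Sum>i\<in>C I p. \<Sum>j\<in>C I q. x i * x j * (m i j - h p q))"
        by (simp only:)
    qed
    also have "\<dots> = (\<Sum>i\<in>I. \<Sum>j\<in>I. (x i * s S (c i)) * (x j * s T (c j)) * (m i j - h (c i) (c j)))"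
      unfolding grp2[OF order_refl order_refl] sum_distrib_left by (intro sum.cong refl) (auto simp: C_def mult_ac)
    also have "\<bar>\<dots>\<bar> \<le> e"
      by (rule cut_le_fractional[OF I c]) (auto intro!: mult_left_le mult_nonneg_nonneg x s01 ST)
    finally show "\<bar>\<Sum>i\<in>S. \<Sum>j\<in>T. x i * x j * (h' (c i) (c j) - h (c i) (c j))\<bar> \<le> e" .
  qed
  then have "cut_le I x (\<lambda>i j. m i j - h' (c i) (c j)) (2 * e)"
    using cut_le_diff[OF c] by fastforce
  ultimately show ?thesis by blast
qed

section \<open>Overlays of weighted graphs\<close>

definition nweight :: "wgraph \<Rightarrow> nat \<Rightarrow> real" where
  "nweight G i = vweight G i / total_weight G"

lemma finite_verts [simp]: "finite (verts G)"
  by (simp add: verts_def)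

lemma nweight_nonneg: "G \<in> wgraphs \<Longrightarrow> 0 \<le> nweight G i"
  using total_weight_pos[of G] unfolding nweight_def wgraphs_def
  by (cases "i \<in> verts G") (auto intro!: divide_nonneg_pos less_imp_le)

lemma sum_nweight: "G \<in> wgraphs \<Longrightarrow> (\<Sum>i\<in>verts G. nweight G i) = 1"
  using total_weight_pos[of G] unfolding nweight_def
  by (simp add: sum_divide_distrib[symmetric] total_weight_def)

lemma eweight_bounds: "G \<in> wgraphs \<Longrightarrow> 0 \<le> eweight G i j" "G \<in> wgraphs \<Longrightarrow> eweight G i j \<le> 1"
  by (cases "i \<in> verts G \<and> j \<in> verts G"; auto simp: wgraphs_def)+

lemma eweight_sym: "G \<in> wgraphs \<Longrightarrow> eweight G i j = eweight G j i"
  unfolding wgraphs_def by (cases "i \<in> verts G \<and> j \<in> verts G") auto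

text \<open>A fractional overlay: the coupling matches the vertices of graphs of any two orders, and
  \<open>c\<close> bounds the cut norm of the difference along it. This describes the cut distance
  by finite data, without an infimum over couplings.\<close>

definition overlay_le :: "wgraph \<Rightarrow> wgraph \<Rightarrow> real \<Rightarrow> bool" where
  "overlay_le G H c \<longleftrightarrow> (\<exists>X. coupling (verts G) (verts H) (nweight G) (nweight H) X \<and>
     cut_le (verts G \<times> verts H) X (\<lambda>p q. eweight G (fst p) (fst q) - eweight H (snd p) (snd q)) c)"

lemma overlay_le_mono: "overlay_le G H c \<Longrightarrow> c \<le> c' \<Longrightarrow> overlay_le G H c'"
  unfolding overlay_le_def cut_le_def by (meson order_trans)

text \<open>Both graphs are compared with the same class function \<open>h\<close>, along the
  coupling of \<open>class_coupling\<close>. The two copies of \<open>h\<close> can differ, by at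
  most \<open>2 * M\<close>, only where one of the two points is misplaced; such pairs have mass at
  most \<open>2 * e3\<close>, which explains \<open>4 * M * e3\<close>.\<close>

lemma overlay_le_from_classes:
  assumes G: "G \<in> wgraphs" and H: "H \<in> wgraphs"
    and c: "\<And>i. c i < (N::nat)" and h: "\<And>p q. \<bar>h p q\<bar> \<le> M"
    and 1: "cut_le (verts G) (nweight G) (\<lambda>i j. eweight G i j - h (c i) (c j)) e1"
    and 2: "cut_le (verts H) (nweight H) (\<lambda>u v. eweight H u v - h (c (\<phi> u)) (c (\<phi> v))) e2"
    and 3: "(\<Sum>k<N. \<bar>(\<Sum>i\<in>{i\<in>verts G. c i = k}. nweight G i) - (\<Sum>u\<in>{u\<in>verts H. c (\<phi> u) = k}. nweight H u)\<bar>) \<le> e3"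
  shows "overlay_le G H (e1 + e2 + 4 * M * e3)"
proof -
  let ?K = "verts G \<times> verts H"
  have M: "0 \<le> M" using h[of 0 0] by linarith
  obtain X where X: "coupling (verts G) (verts H) (nweight G) (nweight H) X"
    and mis: "(\<Sum>p\<in>{p\<in>?K. c (fst p) \<noteq> c (\<phi> (snd p))}. X p) \<le> e3"
    using class_coupling[of "verts G" "verts H" "{..<N}" c "\<lambda>u. c (\<phi> u)" "nweight G" "nweight H"] G H c 3
    by (force simp: nweight_nonneg sum_nweight)
  have X0: "0 \<le> X p" if "p \<in> ?K" for p using X that by (auto simp: coupling_def)
  have X1: "(\<Sum>p\<in>?K. X p) = 1" by (rule coupling_sum[OF X]) (simp_all add: sum_nweight[OF G])
  have A: "cut_le ?K X (\<lambda>p q. eweight G (fst p) (fst q) - h (c (fst p)) (c (fst q))) e1"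
    by (rule cut_le_pullback[where I="verts G" and x="nweight G" and \<pi>=fst and m="\<lambda>i j. eweight G i j - h (c i) (c j)"])
       (use 1 X0 coupling_fst[OF X] in auto)
  have B: "cut_le ?K X (\<lambda>p q. eweight H (snd p) (snd q) - h (c (\<phi> (snd p))) (c (\<phi> (snd q)))) e2"
    by (rule cut_le_pullback[where I="verts H" and x="nweight H" and \<pi>=snd and m="\<lambda>u v. eweight H u v - h (c (\<phi> u)) (c (\<phi> v))"])
       (use 2 X0 coupling_snd[OF X] in auto)
  have C: "cut_le ?K X (\<lambda>p q. h (c (fst p)) (c (fst q)) - h (c (\<phi> (snd p))) (c (\<phi> (snd q)))) (4 * M * e3)"
    unfolding cut_le_def
  proof (intro allI impI)
    fix S T assume ST: "S \<subseteq> ?K" "T \<subseteq> ?K"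
    define b where "b = (\<lambda>p. of_bool (c (fst p) \<noteq> c (\<phi> (snd p))) :: real)"
    have sb: "(\<Sum>p\<in>?K. X p * b p) \<le> e3"
    proof -
      have "(\<Sum>p\<in>?K. X p * b p) = (\<Sum>p\<in>?K. b p * X p)" by (simp add: mult_ac)
      also have "\<dots> = (\<Sum>p\<in>{p\<in>?K. c (fst p) \<noteq> c (\<phi> (snd p))}. X p)"
        unfolding b_def by (subst sum_of_bool_mult_eq) (auto intro: sum.cong)
      finally show ?thesis using mis by simp
    qed
    have "\<bar>\<Sum>p\<in>S. \<Sum>q\<in>T. X p * X q * (h (c (fst p)) (c (fst q)) - h (c (\<phi> (snd p))) (c (\<phi> (snd q))))\<bar>
      \<le> (\<Sum>p\<in>S. \<Sum>q\<in>T. \<bar>X p * X q * (h (c (fst p)) (c (fst q)) - h (c (\<phi> (snd p))) (c (\<phi> (snd q))))\<bar>)"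
      by (rule order_trans[OF sum_abs sum_mono[OF sum_abs]])
    also have "\<dots> \<le> (\<Sum>p\<in>S. \<Sum>q\<in>T. X p * X q * (2 * M * (b p + b q)))"
    proof (intro sum_mono)
      fix p q assume "p \<in> S" "q \<in> T"
      then have XX: "0 \<le> X p * X q" using X0 ST by (auto intro!: mult_nonneg_nonneg)
      have "\<bar>h (c (fst p)) (c (fst q)) - h (c (\<phi> (snd p))) (c (\<phi> (snd q)))\<bar> \<le> 2 * M * (b p + b q)"
        using h[of "c (fst p)" "c (fst q)"] h[of "c (\<phi> (snd p))" "c (\<phi> (snd q))"] M
        by (auto simp: b_def)
      then show "\<bar>X p * X q * (h (c (fst p)) (c (fst q)) - h (c (\<phi> (snd p))) (c (\<phi> (snd q))))\<bar> \<le> X p * X q * (2 * M * (b p + b q))"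
        unfolding abs_mult[of "X p * X q"] abs_of_nonneg[OF XX] using XX by (rule mult_left_mono)
    qed
    also have "\<dots> \<le> (\<Sum>p\<in>?K. \<Sum>q\<in>?K. X p * X q * (2 * M * (b p + b q)))"
    proof (rule order_trans[OF sum_mono sum_mono2])
      show "(\<Sum>q\<in>T. X p * X q * (2 * M * (b p + b q))) \<le> (\<Sum>q\<in>?K. X p * X q * (2 * M * (b p + b q)))" if "p \<in> S" for p
        using that ST X0 M by (intro sum_mono2) (auto simp: b_def intro!: mult_nonneg_nonneg)
    qed (use ST X0 M in \<open>auto simp: b_def intro!: mult_nonneg_nonneg sum_nonneg\<close>)
    also have "\<dots> = 2 * M * ((\<Sum>p\<in>?K. X p * b p) * (\<Sum>q\<in>?K. X q) + (\<Sum>p\<in>?K. X p) * (\<Sum>q\<in>?K. X q * b q))"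
      unfolding sum_product by (simp add: sum_distrib_left sum.distrib algebra_simps)
    also have "\<dots> = 4 * M * (\<Sum>p\<in>?K. X p * b p)" using X1 by simp
    also have "\<dots> \<le> 4 * M * e3" using sb M by (intro mult_left_mono) auto
    finally show "\<bar>\<Sum>p\<in>S. \<Sum>q\<in>T. X p * X q * (h (c (fst p)) (c (fst q)) - h (c (\<phi> (snd p))) (c (\<phi> (snd q))))\<bar> \<le> 4 * M * e3" .
  qed
  have "cut_le ?K X (\<lambda>p q. eweight G (fst p) (fst q) - eweight H (snd p) (snd q)) (e1 + e2 + 4 * M * e3)"
    using cut_le_add[OF cut_le_diff[OF A B] C] by (simp add: algebra_simps)
  then show ?thesis unfolding overlay_le_def using X by blast
qed

subsection \<open>Random samples as finite averages\<close>

text \<open>The expectation of \<open>F\<close> under independent coordinates with laws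
  \<open>w i\<close>, as a finite sum. Normalisation is not built in, so that the algebraic rules
  have no side conditions.\<close>

definition wavg :: "'i set \<Rightarrow> ('i \<Rightarrow> 'a \<Rightarrow> real) \<Rightarrow> 'a set \<Rightarrow> (('i \<Rightarrow> 'a) \<Rightarrow> real) \<Rightarrow> real" where
  "wavg A w V F = (\<Sum>\<Phi>\<in>A \<rightarrow>\<^sub>E V. (\<Prod>i\<in>A. w i (\<Phi> i)) * F \<Phi>)"

text \<open>Fubini for a finite product: one coordinate is drawn separately. Iterating this
  evaluates functions of two or four coordinates.\<close>

lemma wavg_split:
  assumes "finite A" "u \<in> A"
  shows "wavg A w V F = (\<Sum>a\<in>V. w u a * wavg (A - {u}) w V (\<lambda>\<Phi>. F (\<Phi>(u := a))))"
proof -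
  let ?B = "A - {u}"
  have A: "A = insert u ?B" using assms by blast
  have "wavg A w V F = (\<Sum>\<Phi>\<in>insert u ?B \<rightarrow>\<^sub>E V. (\<Prod>i\<in>A. w i (\<Phi> i)) * F \<Phi>)"
    unfolding wavg_def using A by simp
  also have "\<dots> = (\<Sum>(a, \<Phi>)\<in>V \<times> (?B \<rightarrow>\<^sub>E V). (\<Prod>i\<in>A. w i ((\<Phi>(u := a)) i)) * F (\<Phi>(u := a)))"
    unfolding PiE_insert_eq
    by (subst sum.reindex) (auto intro!: inj_combinator simp: case_prod_beta)
  also have "\<dots> = (\<Sum>(a, \<Phi>)\<in>V \<times> (?B \<rightarrow>\<^sub>E V). w u a * ((\<Prod>i\<in>?B. w i (\<Phi> i)) * F (\<Phi>(u := a))))"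
  proof (intro sum.cong refl, clarify)
    fix a \<Phi>
    have "(\<Prod>i\<in>A. w i ((\<Phi>(u := a)) i)) = w u a * (\<Prod>i\<in>?B. w i ((\<Phi>(u := a)) i))"
      using prod.remove[OF assms, of "\<lambda>i. w i ((\<Phi>(u := a)) i)"] by simp
    also have "(\<Prod>i\<in>?B. w i ((\<Phi>(u := a)) i)) = (\<Prod>i\<in>?B. w i (\<Phi> i))"
      by (intro prod.cong) auto
    finally show "(\<Prod>i\<in>A. w i ((\<Phi>(u := a)) i)) * F (\<Phi>(u := a)) = w u a * ((\<Prod>i\<in>?B. w i (\<Phi> i)) * F (\<Phi>(u := a)))"
      by simp
  qed
  also have "\<dots> = (\<Sum>a\<in>V. w u a * wavg ?B w V (\<lambda>\<Phi>. F (\<Phi>(u := a))))"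
    by (simp add: wavg_def sum.cartesian_product[symmetric] sum_distrib_left)
  finally show ?thesis .
qed

lemma wavg_cong: "(\<And>\<Phi>. \<Phi> \<in> A \<rightarrow>\<^sub>E V \<Longrightarrow> F \<Phi> = G \<Phi>) \<Longrightarrow> wavg A w V F = wavg A w V G"
  unfolding wavg_def by (intro sum.cong) auto

lemma wavg_add: "wavg A w V (\<lambda>\<Phi>. F \<Phi> + G \<Phi>) = wavg A w V F + wavg A w V G"
  unfolding wavg_def by (simp add: distrib_left sum.distrib)

lemma wavg_diff: "wavg A w V (\<lambda>\<Phi>. F \<Phi> - G \<Phi>) = wavg A w V F - wavg A w V G"
  unfolding wavg_def by (simp add: right_diff_distrib sum_subtractf)

lemma wavg_cmult: "wavg A w V (\<lambda>\<Phi>. c * F \<Phi>) = c * wavg A w V F"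
  unfolding wavg_def by (simp add: sum_distrib_left mult_ac)

lemma wavg_sum: "wavg A w V (\<lambda>\<Phi>. \<Sum>x\<in>X. F x \<Phi>) = (\<Sum>x\<in>X. wavg A w V (F x))"
  unfolding wavg_def by (simp add: sum_distrib_left sum.swap[of _ X])

lemma wavg_mono:
  assumes "\<And>i a. i \<in> A \<Longrightarrow> a \<in> V \<Longrightarrow> 0 \<le> w i a" "\<And>\<Phi>. \<Phi> \<in> A \<rightarrow>\<^sub>E V \<Longrightarrow> F \<Phi> \<le> G \<Phi>"
  shows "wavg A w V F \<le> wavg A w V G"
  unfolding wavg_def
proof (rule sum_mono)
  fix \<Phi> assume \<Phi>: "\<Phi> \<in> A \<rightarrow>\<^sub>E V"
  have "0 \<le> (\<Prod>i\<in>A. w i (\<Phi> i))" using \<Phi> by (intro prod_nonneg) (auto intro!: assms)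
  then show "(\<Prod>i\<in>A. w i (\<Phi> i)) * F \<Phi> \<le> (\<Prod>i\<in>A. w i (\<Phi> i)) * G \<Phi>"
    using assms(2)[OF \<Phi>] by (intro mult_left_mono)
qed

lemma wavg_const:
  assumes "finite A" "finite V" "\<And>i. i \<in> A \<Longrightarrow> (\<Sum>a\<in>V. w i a) = 1"
  shows "wavg A w V (\<lambda>_. c) = c"
proof -
  have "(\<Sum>\<Phi>\<in>A \<rightarrow>\<^sub>E V. \<Prod>i\<in>A. w i (\<Phi> i)) = (\<Prod>i\<in>A. \<Sum>a\<in>V. w i a)"
    using assms by (intro prod_sum_PiE[symmetric]) auto
  also have "\<dots> = 1" using assms by simp
  finally show ?thesis unfolding wavg_def sum_distrib_right[symmetric] by simp
qed

lemma wavg_1: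
  assumes "finite A" "finite V" "\<And>i. i \<in> A \<Longrightarrow> (\<Sum>a\<in>V. w i a) = 1" "u \<in> A"
  shows "wavg A w V (\<lambda>\<Phi>. h (\<Phi> u)) = (\<Sum>a\<in>V. w u a * h a)"
proof -
  have "wavg (A - {u}) w V (\<lambda>_. h a) = h a" for a using assms by (intro wavg_const) auto
  then show ?thesis by (simp add: wavg_split[OF assms(1,4)])
qed

lemma wavg_2:
  assumes "finite A" "finite V" "\<And>i. i \<in> A \<Longrightarrow> (\<Sum>a\<in>V. w i a) = 1" "u \<in> A" "v \<in> A" "u \<noteq> v"
  shows "wavg A w V (\<lambda>\<Phi>. h (\<Phi> u) (\<Phi> v)) = (\<Sum>a\<in>V. \<Sum>b\<in>V. w u a * w v b * h a b)"
proof -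
  have "wavg (A - {u}) w V (\<lambda>\<Phi>. h a (\<Phi> v)) = (\<Sum>b\<in>V. w v b * h a b)" for a using assms by (intro wavg_1) auto
  then show ?thesis using assms(6) by (simp add: wavg_split[OF assms(1,4)] sum_distrib_left mult_ac)
qed

lemma wavg_4:
  assumes fin: "finite A" "finite V" and w: "\<And>i. i \<in> A \<Longrightarrow> (\<Sum>a\<in>V. w i a) = 1"
    and u: "u1 \<in> A" "u2 \<in> A" "u3 \<in> A" "u4 \<in> A" "distinct [u1, u2, u3, u4]"
  shows "wavg A w V (\<lambda>\<Phi>. h (\<Phi> u1) (\<Phi> u2) (\<Phi> u3) (\<Phi> u4))
    = (\<Sum>a\<in>V. \<Sum>b\<in>V. \<Sum>c\<in>V. \<Sum>d\<in>V. w u1 a * w u2 b * w u3 c * w u4 d * h a b c d)"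
proof -
  have "wavg A w V (\<lambda>\<Phi>. h (\<Phi> u1) (\<Phi> u2) (\<Phi> u3) (\<Phi> u4))
    = (\<Sum>a\<in>V. w u1 a * (\<Sum>b\<in>V. w u2 b * wavg (A - {u1} - {u2}) w V (\<lambda>\<Phi>. h a b (\<Phi> u3) (\<Phi> u4))))"
    using u fin by (subst wavg_split[of A u1], simp, simp, subst wavg_split[of "A - {u1}" u2]) auto
  also have "\<dots> = (\<Sum>a\<in>V. w u1 a * (\<Sum>b\<in>V. w u2 b * (\<Sum>c\<in>V. \<Sum>d\<in>V. w u3 c * w u4 d * h a b c d)))"
    using u fin w by (subst wavg_2) auto
  finally show ?thesis by (simp add: sum_distrib_left mult_ac)
qed

text \<open>\<open>Pi_pmf\<close> has the value \<open>d\<close> outside \<open>A\<close>, while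
  functions in \<open>A \<rightarrow>\<^sub>E V\<close> are \<open>undefined\<close> there; the two
  sets of functions correspond bijectively.\<close>

lemma expectation_Pi_pmf_wavg:
  assumes A: "finite A" and V: "finite V" and p: "\<And>x. x \<in> A \<Longrightarrow> set_pmf (p x) \<subseteq> V"
  shows "measure_pmf.expectation (Pi_pmf A d p) f
    = wavg A (\<lambda>i. pmf (p i)) V (\<lambda>g. f (\<lambda>x. if x \<in> A then g x else d))"
proof -
  let ?ext = "\<lambda>g x. if x \<in> A then g x else d"
  have "measure_pmf.expectation (Pi_pmf A d p) f = (\<Sum>g\<in>PiE_dflt A d (\<lambda>_. V). f g * pmf (Pi_pmf A d p) g)"
  proof (rule integral_measure_pmf_real)
    show "finite (PiE_dflt A d (\<lambda>_. V))" using A V by (rule finite_PiE_dflt)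
    show "g \<in> PiE_dflt A d (\<lambda>_. V)" if "g \<in> set_pmf (Pi_pmf A d p)" for g
      using set_Pi_pmf_subset'[OF A, of d p] that p by (fastforce simp: PiE_dflt_def)
  qed
  also have "\<dots> = (\<Sum>g\<in>?ext ` (A \<rightarrow>\<^sub>E V). f g * pmf (Pi_pmf A d p) g)"
    by (simp add: dflt_image_PiE)
  also have "\<dots> = (\<Sum>g\<in>A \<rightarrow>\<^sub>E V. f (?ext g) * pmf (Pi_pmf A d p) (?ext g))"
  proof (subst sum.reindex)
    show "inj_on ?ext (A \<rightarrow>\<^sub>E V)"
      by (rule inj_onI) (auto simp: fun_eq_iff PiE_def extensional_def, metis)
  qed simp
  also have "\<dots> = wavg A (\<lambda>i. pmf (p i)) V (\<lambda>g. f (?ext g))"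
    unfolding wavg_def by (intro sum.cong refl) (simp add: pmf_Pi[OF A] mult.commute)
  finally show ?thesis .
qed

section \<open>The vertex and edge choices behind a sample\<close>

lemma finite_pairs [simp]: "finite (pairs k)"
proof -
  have "pairs k \<subseteq> {1..k} \<times> {1..k}" by (auto simp: pairs_def)
  then show ?thesis by (rule finite_subset) simp
qed

definition edge_weight :: "wgraph \<Rightarrow> (nat \<Rightarrow> nat) \<Rightarrow> nat \<times> nat \<Rightarrow> bool \<Rightarrow> real" where
  "edge_weight G \<Phi> e b = (let \<beta> = eweight G (\<Phi> (fst e)) (\<Phi> (snd e)) in if b then \<beta> else 1 - \<beta>)"

text \<open>\<open>F\<close> may depend on the drawn vertices \<Phi>, which the distribution
  \<open>random_sample\<close> forgets. The comparison of a sample with \<open>G\<close> needs them,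
  since they carry the vertex classes of \<open>G\<close> over to the sample.\<close>

definition sample_avg :: "nat \<Rightarrow> wgraph \<Rightarrow> ((nat \<Rightarrow> nat) \<Rightarrow> (nat \<times> nat \<Rightarrow> bool) \<Rightarrow> real) \<Rightarrow> real" where
  "sample_avg k G F = wavg {1..k} (\<lambda>_. nweight G) (verts G)
     (\<lambda>\<Phi>. wavg (pairs k) (edge_weight G \<Phi>) UNIV (F \<Phi>))"

text \<open>The restriction to \<open>pairs k\<close> discards the irrelevant values of
  \<open>X\<close>, so that every \<open>X\<close> gives a simple graph.\<close>

definition sample_graph :: "nat \<Rightarrow> (nat \<times> nat \<Rightarrow> bool) \<Rightarrow> wgraph" where
  "sample_graph k X = simple_graph_of k {e\<in>pairs k. X e}"

lemma edge_weight_nonneg: "G \<in> wgraphs \<Longrightarrow> 0 \<le> edge_weight G \<Phi> e b"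
  using eweight_bounds[of G] by (simp add: edge_weight_def Let_def)

lemma sum_edge_weight: "(\<Sum>b\<in>UNIV. edge_weight G \<Phi> e b) = 1"
  by (simp add: edge_weight_def Let_def UNIV_bool)

lemma expectation_random_sample:
  assumes G: "G \<in> wgraphs"
  shows "measure_pmf.expectation (random_sample k G) f = sample_avg k G (\<lambda>\<Phi> X. f (sample_graph k X))"
proof -
  have b: "eweight G i j \<in> {0..1}" for i j using eweight_bounds[OF G] by simp
  have sv: "set_pmf (vertex_pmf G) \<subseteq> verts G"
    by (auto simp: set_pmf_iff pmf_vertex_pmf[OF G] split: if_splits)
  have pv: "pmf (vertex_pmf G) i = nweight G i" if "i \<in> verts G" for i
    using that by (simp add: pmf_vertex_pmf[OF G] nweight_def)
  define q where "q = (\<lambda>\<Phi>. map_pmf (\<lambda>X. simple_graph_of k {e. X e})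
         (Pi_pmf (pairs k) False (\<lambda>(u, v). bernoulli_pmf (eweight G (\<Phi> u) (\<Phi> v)))))"
  have inner: "measure_pmf.expectation (q (\<lambda>x. if x \<in> {1..k} then \<Phi> x else 0)) f = wavg (pairs k) (edge_weight G \<Phi>) UNIV (\<lambda>X. f (sample_graph k X))" for \<Phi>
  proof -
    let ?\<Phi> = "\<lambda>x. if x \<in> {1..k} then \<Phi> x else 0"
    have set_eq: "{e. if e \<in> pairs k then X e else False} = {e\<in>pairs k. X e}" for X by auto
    have "measure_pmf.expectation (q ?\<Phi>) f
      = wavg (pairs k) (\<lambda>e. pmf ((\<lambda>(u, v). bernoulli_pmf (eweight G (?\<Phi> u) (?\<Phi> v))) e)) UNIV
         (\<lambda>X. f (simple_graph_of k {e. if e \<in> pairs k then X e else False}))"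
      unfolding q_def integral_map_pmf by (rule expectation_Pi_pmf_wavg) auto
    also have "\<dots> = wavg (pairs k) (edge_weight G \<Phi>) UNIV (\<lambda>X. f (sample_graph k X))"
      unfolding wavg_def sample_graph_def set_eq
    proof (intro sum.cong refl arg_cong2[where f="(*)"] prod.cong)
      fix X e assume "e \<in> pairs k"
      then show "pmf ((\<lambda>(u, v). bernoulli_pmf (eweight G (?\<Phi> u) (?\<Phi> v))) e) (X e) = edge_weight G \<Phi> e (X e)"
        using b by (cases "X e") (auto simp: edge_weight_def Let_def pairs_def)
    qed
    finally show ?thesis .
  qed
  have fin: "finite (set_pmf (q \<Phi>))" for \<Phi>
  proof -
    have "set_pmf (q \<Phi>) \<subseteq> simple_graph_of k ` Pow (pairs k)"
    proof
      fix H assume "H \<in> set_pmf (q \<Phi>)"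
      then obtain X where X: "H = simple_graph_of k {e. X e}"
        "X \<in> set_pmf (Pi_pmf (pairs k) False (\<lambda>(u, v). bernoulli_pmf (eweight G (\<Phi> u) (\<Phi> v))))"
        by (auto simp: q_def)
      have "{e. X e} \<subseteq> pairs k" using set_Pi_pmf_subset[OF finite_pairs] X(2) by fastforce
      then show "H \<in> simple_graph_of k ` Pow (pairs k)" using X by blast
    qed
    then show ?thesis by (rule finite_subset) simp
  qed
  have "measure_pmf.expectation (random_sample k G) f
    = measure_pmf.expectation (Pi_pmf {1..k} 0 (\<lambda>_. vertex_pmf G)) (\<lambda>\<Phi>. measure_pmf.expectation (q \<Phi>) f)"
  proof -
    have fs: "finite (set_pmf (Pi_pmf {1..k} (0::nat) (\<lambda>_. vertex_pmf G)))"
    proof (rule finite_subset)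
      show "set_pmf (Pi_pmf {1..k} 0 (\<lambda>_. vertex_pmf G)) \<subseteq> PiE_dflt {1..k} 0 (\<lambda>_. verts G)"
        using set_Pi_pmf_subset'[of "{1..k}" "0::nat" "\<lambda>_. vertex_pmf G"] sv by (fastforce simp: PiE_dflt_def)
    qed (rule finite_PiE_dflt, simp_all)
    show ?thesis
      unfolding random_sample_def q_def[symmetric]
      by (subst pmf_expectation_bind[OF fs fin order_refl])
         (simp, subst integral_measure_pmf[OF fs], simp_all)
  qed
  also have "\<dots> = wavg {1..k} (\<lambda>_. pmf (vertex_pmf G)) (verts G) (\<lambda>\<Phi>. wavg (pairs k) (edge_weight G \<Phi>) UNIV (\<lambda>X. f (sample_graph k X)))"
    unfolding inner[symmetric] by (rule expectation_Pi_pmf_wavg) (use sv in auto)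
  also have "\<dots> = sample_avg k G (\<lambda>\<Phi> X. f (sample_graph k X))"
    unfolding sample_avg_def wavg_def
    by (intro sum.cong refl arg_cong2[where f="(*)"] prod.cong) (auto intro!: pv simp: PiE_iff)
  finally show ?thesis .
qed

lemma prob_random_sample:
  assumes "G \<in> wgraphs"
  shows "measure_pmf.prob (random_sample k G) B = sample_avg k G (\<lambda>\<Phi> X. indicator B (sample_graph k X))"
  using expectation_random_sample[OF assms, of k "indicator B"] by simp

lemma sample_avg_mono:
  assumes G: "G \<in> wgraphs" and "\<And>\<Phi> X. (\<forall>i\<in>{1..k}. \<Phi> i \<in> verts G) \<Longrightarrow> F \<Phi> X \<le> F' \<Phi> X"
  shows "sample_avg k G F \<le> sample_avg k G F'"
  unfolding sample_avg_def
  by (intro wavg_mono nweight_nonneg[OF G] edge_weight_nonneg[OF G] assms) (auto simp: PiE_def)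

lemma sample_avg_add: "sample_avg k G (\<lambda>\<Phi> X. F \<Phi> X + F' \<Phi> X) = sample_avg k G F + sample_avg k G F'"
  unfolding sample_avg_def by (simp add: wavg_add)

lemma sample_avg_cmult: "sample_avg k G (\<lambda>\<Phi> X. c * F \<Phi> X) = c * sample_avg k G F"
  unfolding sample_avg_def by (simp add: wavg_cmult)

lemma sample_avg_sum: "sample_avg k G (\<lambda>\<Phi> X. \<Sum>x\<in>S. F x \<Phi> X) = (\<Sum>x\<in>S. sample_avg k G (F x))"
  unfolding sample_avg_def by (simp add: wavg_sum)

lemma sample_avg_vertices:
  "sample_avg k G (\<lambda>\<Phi> X. F \<Phi>) = wavg {1..k} (\<lambda>_. nweight G) (verts G) F"
  unfolding sample_avg_def by (simp add: wavg_const sum_edge_weight)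

lemma sample_avg_const: "G \<in> wgraphs \<Longrightarrow> sample_avg k G (\<lambda>\<Phi> X. c) = c"
  by (simp add: sample_avg_vertices wavg_const sum_nweight)

text \<open>Pairwise independence kills the cross terms, so the class frequency has variance at most
  \<open>1 / k\<close>. The first moment is reduced to it by |z| \<le> t + z^2 / t.\<close>

lemma class_frequency_deviation:
  assumes G: "G \<in> wgraphs" and k: "1 \<le> k" and t: "0 < t"
  shows "sample_avg k G (\<lambda>\<Phi> X. \<bar>(\<Sum>i\<in>{i\<in>verts G. c i = p}. nweight G i) - (\<Sum>u\<in>{u\<in>{1..k}. c (\<Phi> u) = p}. 1 / real k)\<bar>)
    \<le> t + 1 / (real k * t)"
proof -
  define P where "P = (\<Sum>i\<in>{i\<in>verts G. c i = p}. nweight G i)"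
  define g where "g = (\<lambda>i. P - (of_bool (c i = p) :: real))"
  have P: "P = (\<Sum>i\<in>verts G. nweight G i * of_bool (c i = p))"
  proof -
    have "(\<Sum>i\<in>verts G. of_bool (c i = p) * nweight G i) = P"
      unfolding P_def by (subst sum_of_bool_mult_eq) (auto intro: sum.cong)
    then show ?thesis by (simp add: mult.commute)
  qed
  have P01: "0 \<le> P" "P \<le> 1"
  proof -
    show "0 \<le> P" unfolding P_def by (intro sum_nonneg nweight_nonneg[OF G])
    have "P \<le> (\<Sum>i\<in>verts G. nweight G i)" unfolding P_def
      by (intro sum_mono2) (auto intro: nweight_nonneg[OF G])
    then show "P \<le> 1" using sum_nweight[OF G] by simp
  qed
  have g0: "(\<Sum>i\<in>verts G. nweight G i * g i) = 0"
    unfolding g_def right_diff_distrib sum_subtractf P[symmetric]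
    by (simp add: sum_distrib_right[symmetric] sum_nweight[OF G])
  have dev: "P - (\<Sum>u\<in>{u\<in>{1..k}. c (\<Phi> u) = p}. 1 / real k) = (1 / k) * (\<Sum>u\<in>{1..k}. g (\<Phi> u))" for \<Phi>
  proof -
    have "(\<Sum>u\<in>{u\<in>{1..k}. c (\<Phi> u) = p}. 1 / real k) = (\<Sum>u\<in>{1..k}. of_bool (c (\<Phi> u) = p) * (1 / real k))"
      by (subst sum_of_bool_mult_eq) (simp, rule sum.cong, auto)
    moreover have "(1 / k) * (\<Sum>u\<in>{1..k}. g (\<Phi> u)) = P - (\<Sum>u\<in>{1..k}. of_bool (c (\<Phi> u) = p) * (1 / real k))"
      using k by (simp add: g_def sum_subtractf right_diff_distrib sum_divide_distrib[symmetric])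
    ultimately show ?thesis by simp
  qed
  have sq: "wavg {1..k} (\<lambda>_. nweight G) (verts G) (\<lambda>\<Phi>. (\<Sum>u\<in>{1..k}. g (\<Phi> u))\<^sup>2) \<le> real k"
  proof -
    have "wavg {1..k} (\<lambda>_. nweight G) (verts G) (\<lambda>\<Phi>. (\<Sum>u\<in>{1..k}. g (\<Phi> u))\<^sup>2)
      = (\<Sum>u\<in>{1..k}. \<Sum>v\<in>{1..k}. wavg {1..k} (\<lambda>_. nweight G) (verts G) (\<lambda>\<Phi>. g (\<Phi> u) * g (\<Phi> v)))"
      by (simp add: power2_eq_square sum_product wavg_sum)
    also have "\<dots> \<le> (\<Sum>u\<in>{1..k}. \<Sum>v\<in>{1..k}. of_bool (u = v))"
    proof (intro sum_mono)
      fix u v assume uv: "u \<in> {1..k}" "v \<in> {1..k}"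
      show "wavg {1..k} (\<lambda>_. nweight G) (verts G) (\<lambda>\<Phi>. g (\<Phi> u) * g (\<Phi> v)) \<le> of_bool (u = v)"
      proof (cases "u = v")
        case True
        have "wavg {1..k} (\<lambda>_. nweight G) (verts G) (\<lambda>\<Phi>. g (\<Phi> u) * g (\<Phi> v)) \<le> wavg {1..k} (\<lambda>_. nweight G) (verts G) (\<lambda>\<Phi>. 1)"
        proof (intro wavg_mono nweight_nonneg[OF G])
          fix \<Phi>
          have "g (\<Phi> u) * g (\<Phi> u) \<le> 1"
            using P01 by (simp add: g_def abs_le_square_iff[of _ 1, simplified power2_eq_square, simplified, symmetric])
          then show "g (\<Phi> u) * g (\<Phi> v) \<le> 1" using True by simp
        qed
        then show ?thesis using True sum_nweight[OF G] by (simp add: wavg_const)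
      next
        case False
        have "wavg {1..k} (\<lambda>_. nweight G) (verts G) (\<lambda>\<Phi>. g (\<Phi> u) * g (\<Phi> v)) = (\<Sum>a\<in>verts G. \<Sum>b\<in>verts G. nweight G a * nweight G b * (g a * g b))"
          using uv False sum_nweight[OF G] by (subst wavg_2[where h="\<lambda>a b. g a * g b"]) auto
        also have "\<dots> = (\<Sum>a\<in>verts G. nweight G a * g a) * (\<Sum>b\<in>verts G. nweight G b * g b)"
          unfolding sum_product by (intro sum.cong refl) (simp add: mult_ac)
        finally show ?thesis using g0 False by simp
      qed
    qed
    also have "\<dots> = real k" by (simp add: of_bool_def)
    finally show ?thesis .
  qed
  have kt: "0 < real k" "0 < real k * t" using k t by auto
  have "sample_avg k G (\<lambda>\<Phi> X. \<bar>P - (\<Sum>u\<in>{u\<in>{1..k}. c (\<Phi> u) = p}. 1 / real k)\<bar>)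
     \<le> sample_avg k G (\<lambda>\<Phi> X. t + (1 / ((real k)\<^sup>2 * t)) * (\<Sum>u\<in>{1..k}. g (\<Phi> u))\<^sup>2)"
  proof (rule sample_avg_mono[OF G])
    fix \<Phi> :: "nat \<Rightarrow> nat" and X :: "nat \<times> nat \<Rightarrow> bool"
    define z where "z = (1 / k) * (\<Sum>u\<in>{1..k}. g (\<Phi> u))"
    have "0 \<le> (\<bar>z\<bar> - t)\<^sup>2 + \<bar>z\<bar> * t" using t by simp
    then have "\<bar>z\<bar> * t \<le> t\<^sup>2 + z\<^sup>2" by (simp add: power2_eq_square algebra_simps)
    then have "\<bar>z\<bar> \<le> t + z\<^sup>2 / t" using t by (simp add: field_simps power2_eq_square)
    also have "z\<^sup>2 / t = (1 / ((real k)\<^sup>2 * t)) * (\<Sum>u\<in>{1..k}. g (\<Phi> u))\<^sup>2"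
      by (simp add: z_def power_mult_distrib power_divide)
    finally show "\<bar>P - (\<Sum>u\<in>{u\<in>{1..k}. c (\<Phi> u) = p}. 1 / real k)\<bar> \<le> t + (1 / ((real k)\<^sup>2 * t)) * (\<Sum>u\<in>{1..k}. g (\<Phi> u))\<^sup>2"
      unfolding dev z_def .
  qed
  also have "\<dots> = t + (1 / ((real k)\<^sup>2 * t)) * wavg {1..k} (\<lambda>_. nweight G) (verts G) (\<lambda>\<Phi>. (\<Sum>u\<in>{1..k}. g (\<Phi> u))\<^sup>2)"
    unfolding sample_avg_vertices wavg_add wavg_cmult using sum_nweight[OF G] by (simp add: wavg_const)
  also have "\<dots> \<le> t + (1 / ((real k)\<^sup>2 * t)) * real k"
    using t by (intro add_left_mono mult_left_mono sq) auto
  also have "\<dots> = t + 1 / (real k * t)" using kt by (simp add: power2_eq_square)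
  finally show ?thesis unfolding P_def .
qed

subsection \<open>The sampling lemma for the cut distance\<close>

text \<open>By \<open>c4_bilinear\<close> it dominates a fourth power.\<close>

lemma c4_nonneg:
  assumes "\<And>i. i \<in> I \<Longrightarrow> 0 \<le> x i" "(\<Sum>i\<in>I. x i) \<le> 1"
  shows "0 \<le> c4 I x m"
  using c4_bilinear[of I x x x m] assms by (smt (verit) zero_le_even_power even_numeral abs_of_nonneg)

definition adj :: "nat \<Rightarrow> (nat \<times> nat \<Rightarrow> bool) \<Rightarrow> nat \<Rightarrow> nat \<Rightarrow> real" where
  "adj k X u v = eweight (sample_graph k X) u v"

definition edge_pair :: "nat \<Rightarrow> nat \<Rightarrow> nat \<times> nat" where
  "edge_pair u v = (min u v, max u v)"

lemma adj_eq:
  assumes "u \<in> {1..k}" "v \<in> {1..k}" "u \<noteq> v"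
  shows "adj k X u v = of_bool (X (edge_pair u v))"
  using assms by (auto simp: adj_def sample_graph_def simple_graph_of_def edge_pair_def pairs_def min_def max_def)

lemma adj_01: "adj k X u v = 0 \<or> adj k X u v = 1"
  by (simp add: adj_def sample_graph_def simple_graph_of_def)

text \<open>Distinct vertices span four distinct pairs, so given \<Phi> the four edge variables are
  independent and each averages to an edge weight of \<open>G\<close>. The four drawn vertices are
  independent as well, which leaves the 4-cycle density of \<open>G\<close>.\<close>

lemma sample_avg_4cycle:
  assumes G: "G \<in> wgraphs" and u: "u \<in> {1..k}" "u' \<in> {1..k}" "v \<in> {1..k}" "v' \<in> {1..k}" and d: "distinct [u, u', v, v']"
  shows "sample_avg k G (\<lambda>\<Phi> X. (adj k X u v - h (\<Phi> u) (\<Phi> v)) * (adj k X u' v - h (\<Phi> u') (\<Phi> v))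
       * (adj k X u' v' - h (\<Phi> u') (\<Phi> v')) * (adj k X u v' - h (\<Phi> u) (\<Phi> v')))
    = c4 (verts G) (nweight G) (\<lambda>i j. eweight G i j - h i j)"
proof -
  let ?U = "\<lambda>i j. eweight G i j - h i j"
  have ep: "edge_pair u v \<in> pairs k" "edge_pair u' v \<in> pairs k" "edge_pair u' v' \<in> pairs k" "edge_pair u v' \<in> pairs k"
    using u d by (auto simp: edge_pair_def pairs_def min_def max_def)
  have ed: "distinct [edge_pair u v, edge_pair u' v, edge_pair u' v', edge_pair u v']"
    using d by (auto simp: edge_pair_def min_def max_def)
  have ew: "(\<Sum>b\<in>UNIV. edge_weight G \<Phi> (edge_pair a b') b * (of_bool b - h (\<Phi> a) (\<Phi> b'))) = ?U (\<Phi> a) (\<Phi> b')" for \<Phi> a b'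
    using eweight_sym[OF G, of "\<Phi> a" "\<Phi> b'"]
    by (cases "a \<le> b'") (simp_all add: edge_weight_def Let_def UNIV_bool edge_pair_def min_def max_def algebra_simps)
  have inner: "wavg (pairs k) (edge_weight G \<Phi>) UNIV (\<lambda>X. (adj k X u v - h (\<Phi> u) (\<Phi> v)) * (adj k X u' v - h (\<Phi> u') (\<Phi> v))
       * (adj k X u' v' - h (\<Phi> u') (\<Phi> v')) * (adj k X u v' - h (\<Phi> u) (\<Phi> v')))
     = ?U (\<Phi> u) (\<Phi> v) * ?U (\<Phi> u') (\<Phi> v) * ?U (\<Phi> u') (\<Phi> v') * ?U (\<Phi> u) (\<Phi> v')" for \<Phi>
  proof -
    let ?h = "\<lambda>b1 b2 b3 b4. (of_bool b1 - h (\<Phi> u) (\<Phi> v)) * (of_bool b2 - h (\<Phi> u') (\<Phi> v))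
       * (of_bool b3 - h (\<Phi> u') (\<Phi> v')) * (of_bool b4 - h (\<Phi> u) (\<Phi> v'))"
    have "wavg (pairs k) (edge_weight G \<Phi>) UNIV (\<lambda>X. (adj k X u v - h (\<Phi> u) (\<Phi> v)) * (adj k X u' v - h (\<Phi> u') (\<Phi> v))
       * (adj k X u' v' - h (\<Phi> u') (\<Phi> v')) * (adj k X u v' - h (\<Phi> u) (\<Phi> v')))
      = wavg (pairs k) (edge_weight G \<Phi>) UNIV (\<lambda>X. ?h (X (edge_pair u v)) (X (edge_pair u' v)) (X (edge_pair u' v')) (X (edge_pair u v')))"
      using u d by (simp add: adj_eq)
    also have "\<dots> = (\<Sum>a\<in>UNIV. \<Sum>b\<in>UNIV. \<Sum>c\<in>UNIV. \<Sum>d\<in>UNIV. edge_weight G \<Phi> (edge_pair u v) a * edge_weight G \<Phi> (edge_pair u' v) b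
        * edge_weight G \<Phi> (edge_pair u' v') c * edge_weight G \<Phi> (edge_pair u v') d * ?h a b c d)"
      by (rule wavg_4) (use ep ed sum_edge_weight in auto)
    also have "\<dots> = (\<Sum>a\<in>UNIV. edge_weight G \<Phi> (edge_pair u v) a * (of_bool a - h (\<Phi> u) (\<Phi> v)))
       * (\<Sum>a\<in>UNIV. edge_weight G \<Phi> (edge_pair u' v) a * (of_bool a - h (\<Phi> u') (\<Phi> v)))
       * (\<Sum>a\<in>UNIV. edge_weight G \<Phi> (edge_pair u' v') a * (of_bool a - h (\<Phi> u') (\<Phi> v')))
       * (\<Sum>a\<in>UNIV. edge_weight G \<Phi> (edge_pair u v') a * (of_bool a - h (\<Phi> u) (\<Phi> v')))"
      unfolding UNIV_bool by (simp add: algebra_simps)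
    finally show ?thesis unfolding ew .
  qed
  have "sample_avg k G (\<lambda>\<Phi> X. (adj k X u v - h (\<Phi> u) (\<Phi> v)) * (adj k X u' v - h (\<Phi> u') (\<Phi> v))
       * (adj k X u' v' - h (\<Phi> u') (\<Phi> v')) * (adj k X u v' - h (\<Phi> u) (\<Phi> v')))
    = wavg {1..k} (\<lambda>_. nweight G) (verts G) (\<lambda>\<Phi>. ?U (\<Phi> u) (\<Phi> v) * ?U (\<Phi> u') (\<Phi> v) * ?U (\<Phi> u') (\<Phi> v') * ?U (\<Phi> u) (\<Phi> v'))"
    unfolding sample_avg_def inner ..
  also have "\<dots> = c4 (verts G) (nweight G) ?U"
    unfolding c4_def
    by (rule wavg_4[where h="\<lambda>a b c d. ?U a c * ?U b c * ?U b d * ?U a d"]) (use u d sum_nweight[OF G] in auto)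
  finally show ?thesis .
qed

text \<open>Quadruples of distinct vertices contribute the density of \<open>G\<close> by
  \<open>sample_avg_4cycle\<close>. A quadruple with a repetition contributes at most 1; it has a
  coincidence at one of 6 pairs of positions, so there are at most \<open>6 * k^3\<close> of these
  among \<open>k^4\<close>.\<close>

lemma sample_avg_c4:
  assumes G: "G \<in> wgraphs" and k: "1 \<le> k" and h: "\<And>i j. 0 \<le> h i j \<and> h i j \<le> 1"
  shows "sample_avg k G (\<lambda>\<Phi> X. c4 {1..k} (\<lambda>_. 1 / real k) (\<lambda>u v. adj k X u v - h (\<Phi> u) (\<Phi> v)))
    \<le> c4 (verts G) (nweight G) (\<lambda>i j. eweight G i j - h i j) + 6 / real k"
proof -
  let ?c = "c4 (verts G) (nweight G) (\<lambda>i j. eweight G i j - h i j)"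
  have c0: "0 \<le> ?c" using nweight_nonneg[OF G] sum_nweight[OF G] by (intro c4_nonneg) auto
  define D where "D = (\<lambda>\<Phi> X u v. adj k X u v - h (\<Phi> u) (\<Phi> v))"
  have D1: "\<bar>D \<Phi> X u v\<bar> \<le> 1" for \<Phi> :: "nat \<Rightarrow> nat" and X u v
    using adj_01[of k X u v] h[of "\<Phi> u" "\<Phi> v"] by (auto simp: D_def)
  define K where "K = {1..k}"
  have fK: "finite K" "card K = k" by (auto simp: K_def)
  have "sample_avg k G (\<lambda>\<Phi> X. c4 {1..k} (\<lambda>_. 1 / real k) (D \<Phi> X))
    = (\<Sum>u\<in>K. \<Sum>u'\<in>K. \<Sum>v\<in>K. \<Sum>v'\<in>K. (1 / real k) ^ 4 *
        sample_avg k G (\<lambda>\<Phi> X. D \<Phi> X u v * D \<Phi> X u' v * D \<Phi> X u' v' * D \<Phi> X u v'))"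
    unfolding c4_def sample_avg_sum sample_avg_cmult K_def by (simp add: power4_eq_xxxx)
  also have "\<dots> \<le> (\<Sum>u\<in>K. \<Sum>u'\<in>K. \<Sum>v\<in>K. \<Sum>v'\<in>K. (1 / real k) ^ 4 *
        (?c + (of_bool (u = u') + of_bool (u = v) + of_bool (u = v') + of_bool (u' = v) + of_bool (u' = v') + of_bool (v = v'))))"
  proof (intro sum_mono mult_left_mono)
    fix u u' v v' assume u: "u \<in> K" "u' \<in> K" "v \<in> K" "v' \<in> K"
    show "sample_avg k G (\<lambda>\<Phi> X. D \<Phi> X u v * D \<Phi> X u' v * D \<Phi> X u' v' * D \<Phi> X u v')
      \<le> ?c + (of_bool (u = u') + of_bool (u = v) + of_bool (u = v') + of_bool (u' = v) + of_bool (u' = v') + of_bool (v = v'))"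
    proof (cases "distinct [u, u', v, v']")
      case True
      then show ?thesis using sample_avg_4cycle[OF G, of u k u' v v' h] u unfolding D_def K_def by simp
    next
      case False
      have "sample_avg k G (\<lambda>\<Phi> X. D \<Phi> X u v * D \<Phi> X u' v * D \<Phi> X u' v' * D \<Phi> X u v') \<le> sample_avg k G (\<lambda>\<Phi> X. 1)"
      proof (rule sample_avg_mono[OF G])
        fix \<Phi> :: "nat \<Rightarrow> nat" and X
        have "\<bar>D \<Phi> X u v * D \<Phi> X u' v * D \<Phi> X u' v' * D \<Phi> X u v'\<bar> \<le> 1"
          unfolding abs_mult by (intro mult_le_one D1 mult_nonneg_nonneg abs_ge_zero)
        then show "D \<Phi> X u v * D \<Phi> X u' v * D \<Phi> X u' v' * D \<Phi> X u v' \<le> 1" by linarith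
      qed
      also have "\<dots> = 1" by (rule sample_avg_const[OF G])
      also have "1 \<le> ?c + (of_bool (u = u') + of_bool (u = v) + of_bool (u = v') + of_bool (u' = v) + of_bool (u' = v') + of_bool (v = v'))"
        using False c0 by (auto simp: of_bool_def)
      finally show ?thesis .
    qed
  qed simp
  also have "\<dots> = (1 / real k) ^ 4 * (real k ^ 4 * ?c + 6 * real k ^ 3)"
  proof -
    have ob: "(\<Sum>b\<in>K. (of_bool (a = b) :: real)) = 1" "(\<Sum>b\<in>K. (of_bool (b = a) :: real)) = 1" if "a \<in> K" for a
      using that fK by (auto simp: of_bool_def)
    have "(\<Sum>u\<in>K. \<Sum>u'\<in>K. \<Sum>v\<in>K. \<Sum>v'\<in>K. ((of_bool (u = u') :: real) + of_bool (u = v) + of_bool (u = v') + of_bool (u' = v) + of_bool (u' = v') + of_bool (v = v'))) = 6 * real k ^ 3"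
      by (simp add: sum.distrib ob fK sum_distrib_left[symmetric] power3_eq_cube del: sum_of_bool_eq)
    then show ?thesis
      unfolding sum_distrib_left[symmetric] sum.distrib by (simp add: sum.distrib fK power4_eq_xxxx)
  qed
  also have "\<dots> = ?c + 6 / real k"
    using k by (simp add: field_simps power4_eq_xxxx power3_eq_cube)
  finally show ?thesis unfolding D_def .
qed

lemma sample_graph_wgraphs: "1 \<le> k \<Longrightarrow> sample_graph k X \<in> wgraphs"
  unfolding wgraphs_def sample_graph_def simple_graph_of_def verts_def pairs_def by auto

lemma verts_sample_graph [simp]: "verts (sample_graph k X) = {1..k}"
  by (simp add: sample_graph_def simple_graph_of_def verts_def)

lemma nweight_sample_graph: "u \<in> {1..k} \<Longrightarrow> nweight (sample_graph k X) u = 1 / real k"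
  by (simp add: nweight_def total_weight_def) (simp add: sample_graph_def simple_graph_of_def)

lemma cut_le_cong:
  assumes "\<And>i. i \<in> I \<Longrightarrow> x i = x' i" "\<And>i j. i \<in> I \<Longrightarrow> j \<in> I \<Longrightarrow> m i j = m' i j"
  shows "cut_le I x m c \<longleftrightarrow> cut_le I x' m' c"
proof -
  have "(\<Sum>i\<in>S. \<Sum>j\<in>T. x i * x j * m i j) = (\<Sum>i\<in>S. \<Sum>j\<in>T. x' i * x' j * m' i j)" if "S \<subseteq> I" "T \<subseteq> I" for S T
    using assms that by (intro sum.cong refl) (auto simp: subset_iff)
  then show ?thesis unfolding cut_le_def by auto
qed

text \<open>A rectangle is the case of \<open>c4_bilinear\<close> in which the test weights are
  \<open>x\<close> cut off to a set.\<close>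

lemma cut_le_c4:
  assumes "\<And>i. i \<in> I \<Longrightarrow> 0 \<le> x i" "finite I" "(\<Sum>i\<in>I. x i) \<le> 1" "c4 I x m \<le> e ^ 4" "0 \<le> e"
  shows "cut_le I x m e"
  unfolding cut_le_def
proof (intro allI impI)
  fix S T assume ST: "S \<subseteq> I" "T \<subseteq> I"
  let ?s = "\<lambda>S i. of_bool (i \<in> S) * x i"
  have "(\<Sum>i\<in>S. \<Sum>j\<in>T. x i * x j * m i j) = (\<Sum>i\<in>I. of_bool (i \<in> S) * (\<Sum>j\<in>I. of_bool (j \<in> T) * (x i * x j * m i j)))"
    using ST by (simp add: sum_of_bool_mult_eq[OF assms(2)] Int_absorb1)
  also have "\<dots> = (\<Sum>i\<in>I. \<Sum>j\<in>I. ?s S i * ?s T j * m i j)"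
    unfolding sum_distrib_left by (intro sum.cong refl) (simp add: mult_ac)
  finally have "(\<Sum>i\<in>S. \<Sum>j\<in>T. x i * x j * m i j) ^ 4 = (\<Sum>i\<in>I. \<Sum>j\<in>I. ?s S i * ?s T j * m i j) ^ 4" by simp
  also have "\<dots> \<le> c4 I x m"
    by (rule c4_bilinear) (use assms in auto)
  also have "\<dots> \<le> e ^ 4" by fact
  finally have "\<bar>\<Sum>i\<in>S. \<Sum>j\<in>T. x i * x j * m i j\<bar> ^ 4 \<le> e ^ 4" by simp
  then show "\<bar>\<Sum>i\<in>S. \<Sum>j\<in>T. x i * x j * m i j\<bar> \<le> e"
    using assms(5) by (rule power_le_imp_le_base[of _ 3, simplified])
qed

lemma sampling_overlay:
  assumes e: "0 < \<epsilon>"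
  obtains k0 :: nat where "1 \<le> k0" "\<And>k G. k0 \<le> k \<Longrightarrow> G \<in> wgraphs \<Longrightarrow>
    measure_pmf.prob (random_sample k G) {H. \<not> overlay_le G H \<epsilon>} \<le> \<epsilon>"
proof -
  \<comment> \<open>Error budget: the overlay will cost \<open>2 * e0 + e2 + 4 * e3\<close>, at most
    three quarters of \<epsilon>. The second bound in \<open>e0\<close> serves Markov's inequality,
    where the 4-cycle density \<open>8 * e0\<close> is divided by \<open>e2 ^ 4\<close>.\<close>
  define e2 where "e2 = \<epsilon> / 4"
  define e3 where "e3 = \<epsilon> / 16"
  define e0 where "e0 = min (\<epsilon> / 8) (\<epsilon> * e2 ^ 4 / 32)"
  have pos: "0 < e2" "0 < e3" "0 < e0" using e by (auto simp: e2_def e3_def e0_def)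
  \<comment> \<open>The energy of any \<open>G\<close> is at most 1, so \<open>n\<close> steps of
    \<open>weak_regularity\<close> suffice and the number \<open>N\<close> of classes depends on
    \<epsilon> alone.\<close>
  define n where "n = nat \<lceil>1 / e0\<^sup>2\<rceil>"
  have n: "1 \<le> real n * e0\<^sup>2"
  proof -
    have "1 / e0\<^sup>2 \<le> real n" unfolding n_def by (rule real_nat_ceiling_ge)
    then show ?thesis using pos by (simp add: field_simps)
  qed
  define N where "N = (4::nat) ^ n"
  \<comment> \<open>The entry with 24 makes \<open>6 / k\<close> at most a quarter of
    \<open>\<epsilon> * e2 ^ 4\<close>. The square makes \<open>2 * N / sqrt k\<close>, the total of
    the class deviations, at most a quarter of \<open>\<epsilon> * e3\<close>.\<close>
  define k0 where "k0 = nat \<lceil>max 1 (max (24 / (\<epsilon> * e2 ^ 4)) ((8 * real N / (\<epsilon> * e3))\<^sup>2))\<rceil>"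
  have k0: "1 \<le> real k0" "24 / (\<epsilon> * e2 ^ 4) \<le> real k0" "(8 * real N / (\<epsilon> * e3))\<^sup>2 \<le> real k0"
    using real_nat_ceiling_ge[of "max 1 (max (24 / (\<epsilon> * e2 ^ 4)) ((8 * real N / (\<epsilon> * e3))\<^sup>2))"]
    unfolding k0_def by linarith+
  show ?thesis
  proof (rule that)
    show "1 \<le> k0" using k0(1) by simp
    fix k G assume k: "k0 \<le> k" and G: "G \<in> wgraphs"
    have k1: "1 \<le> k" using k0(1) k by linarith
    have en: "(\<Sum>i\<in>verts G. \<Sum>j\<in>verts G. nweight G i * nweight G j * (eweight G i j)\<^sup>2) \<le> real n * e0\<^sup>2"
    proof -
      have "(\<Sum>i\<in>verts G. \<Sum>j\<in>verts G. nweight G i * nweight G j * (eweight G i j)\<^sup>2)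
        \<le> (\<Sum>i\<in>verts G. \<Sum>j\<in>verts G. nweight G i * nweight G j)"
        using eweight_bounds[OF G] nweight_nonneg[OF G]
        by (intro sum_mono mult_left_le mult_nonneg_nonneg) (auto simp: power_le_one)
      also have "\<dots> = 1" using sum_nweight[OF G] by (simp add: sum_distrib_left[symmetric])
      finally show ?thesis using n by linarith
    qed
    obtain c h where c: "\<And>i. c i < N" and h: "cut_le (verts G) (nweight G) (\<lambda>i j. eweight G i j - h (c i) (c j)) e0"
      using weak_regularity[OF finite_verts nweight_nonneg[OF G] sum_nweight[OF G] pos(3) en] unfolding N_def by blast
    obtain h' where h'01: "\<And>p q. 0 \<le> h' p q \<and> h' p q \<le> 1"
      and h': "cut_le (verts G) (nweight G) (\<lambda>i j. eweight G i j - h' (c i) (c j)) (2 * e0)"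
      using cut_le_class_average[of "verts G" "nweight G" "eweight G" h c e0] h nweight_nonneg[OF G] eweight_bounds[OF G] by auto
    define U where "U = (\<lambda>i j. eweight G i j - h' (c i) (c j))"
    have U1: "\<bar>U i j\<bar> \<le> 1" for i j
      using eweight_bounds[OF G, of i j] h'01[of "c i" "c j"] by (auto simp: U_def)
    have c4U: "c4 (verts G) (nweight G) U \<le> 8 * e0"
      using c4_le_cut[of "verts G" "nweight G" U "2 * e0" 1] h' U1 nweight_nonneg[OF G] sum_nweight[OF G] unfolding U_def by simp
    define P where "P = (\<lambda>p. \<Sum>i\<in>{i\<in>verts G. c i = p}. nweight G i)"
    define Q where "Q = (\<lambda>(\<Phi>::nat \<Rightarrow> nat) p. \<Sum>u\<in>{u\<in>{1..k}. c (\<Phi> u) = p}. 1 / real k)"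
    define dev where "dev = (\<lambda>\<Phi>. \<Sum>p<N. \<bar>P p - Q \<Phi> p\<bar>)"
    define D where "D = (\<lambda>\<Phi> X. c4 {1..k} (\<lambda>_. 1 / real k) (\<lambda>u v. adj k X u v - h' (c (\<Phi> u)) (c (\<Phi> v))))"
    have D0: "0 \<le> D \<Phi> X" for \<Phi> X unfolding D_def using k1 by (intro c4_nonneg) auto
    have good: "overlay_le G (sample_graph k X) \<epsilon>" if dv: "dev \<Phi> \<le> e3" and d: "D \<Phi> X \<le> e2 ^ 4" for \<Phi> X
    proof -
      let ?H = "sample_graph k X"
      have "cut_le {1..k} (\<lambda>_. 1 / real k) (\<lambda>u v. adj k X u v - h' (c (\<Phi> u)) (c (\<Phi> v))) e2"
        using d pos k1 unfolding D_def by (intro cut_le_c4) auto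
      then have 2: "cut_le (verts ?H) (nweight ?H) (\<lambda>u v. eweight ?H u v - h' (c (\<Phi> u)) (c (\<Phi> v))) e2"
        by (subst cut_le_cong[where x'="\<lambda>_. 1 / real k" and m'="\<lambda>u v. adj k X u v - h' (c (\<Phi> u)) (c (\<Phi> v))"])
           (auto simp: nweight_sample_graph adj_def)
      have "(\<Sum>u\<in>{u\<in>verts ?H. c (\<Phi> u) = p}. nweight ?H u) = Q \<Phi> p" for p
        unfolding Q_def by (intro sum.cong) (auto simp: nweight_sample_graph)
      then have 3: "(\<Sum>p<N. \<bar>(\<Sum>i\<in>{i\<in>verts G. c i = p}. nweight G i) - (\<Sum>u\<in>{u\<in>verts ?H. c (\<Phi> u) = p}. nweight ?H u)\<bar>) \<le> e3"
        using dv by (simp add: dev_def P_def)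
      have "\<bar>h' p q\<bar> \<le> 1" for p q using h'01[of p q] by auto
      from overlay_le_from_classes[OF G sample_graph_wgraphs[OF k1] c this h' 2 3]
      show ?thesis
      proof (rule overlay_le_mono)
        have "e0 \<le> \<epsilon> / 8" by (simp add: e0_def)
        then show "2 * e0 + e2 + 4 * 1 * e3 \<le> \<epsilon>" using e unfolding e2_def e3_def by linarith
      qed
    qed
    have "measure_pmf.prob (random_sample k G) {H. \<not> overlay_le G H \<epsilon>}
      = sample_avg k G (\<lambda>\<Phi> X. indicator {H. \<not> overlay_le G H \<epsilon>} (sample_graph k X))"
      by (rule prob_random_sample[OF G])
    \<comment> \<open>Markov's inequality for the two bad events, applied to the indicator before
      averaging.\<close>
    also have "\<dots> \<le> sample_avg k G (\<lambda>\<Phi> X. (1 / e3) * dev \<Phi> + (1 / e2 ^ 4) * D \<Phi> X)"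
    proof (rule sample_avg_mono[OF G])
      fix \<Phi> :: "nat \<Rightarrow> nat" and X
      have dev0: "0 \<le> dev \<Phi>" by (simp add: dev_def sum_nonneg)
      have n1: "0 \<le> dev \<Phi> / e3" "0 \<le> D \<Phi> X / e2 ^ 4" using dev0 D0 pos by auto
      show "indicator {H. \<not> overlay_le G H \<epsilon>} (sample_graph k X) \<le> (1 / e3) * dev \<Phi> + (1 / e2 ^ 4) * D \<Phi> X"
      proof (cases "overlay_le G (sample_graph k X) \<epsilon>")
        case True
        then show ?thesis using n1 by simp
      next
        case False
        then have "e3 < dev \<Phi> \<or> e2 ^ 4 < D \<Phi> X" using good by (meson not_le)
        then have "1 \<le> dev \<Phi> / e3 \<or> 1 \<le> D \<Phi> X / e2 ^ 4" using pos by (auto simp: field_simps)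
        then show ?thesis using n1 False by auto
      qed
    qed
    also have "\<dots> = (1 / e3) * (\<Sum>p<N. sample_avg k G (\<lambda>\<Phi> X. \<bar>P p - Q \<Phi> p\<bar>)) + (1 / e2 ^ 4) * sample_avg k G D"
      unfolding sample_avg_add sample_avg_cmult dev_def sample_avg_sum ..
    also have "\<dots> \<le> (1 / e3) * (\<Sum>p<N. 2 / sqrt (real k)) + (1 / e2 ^ 4) * (8 * e0 + 6 / real k)"
    proof (intro add_mono mult_left_mono sum_mono)
      fix p
      \<comment> \<open>The choice t = 1 / sqrt k balances the two terms of
        \<open>class_frequency_deviation\<close>.\<close>
      have "sample_avg k G (\<lambda>\<Phi> X. \<bar>P p - Q \<Phi> p\<bar>) \<le> 1 / sqrt k + 1 / (real k * (1 / sqrt k))"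
        unfolding P_def Q_def using class_frequency_deviation[OF G k1, of "1 / sqrt k"] k1 by simp
      also have "1 / (real k * (1 / sqrt k)) = 1 / sqrt k"
        using k1 by (simp add: real_div_sqrt)
      finally show "sample_avg k G (\<lambda>\<Phi> X. \<bar>P p - Q \<Phi> p\<bar>) \<le> 2 / sqrt (real k)" by simp
      show "sample_avg k G D \<le> 8 * e0 + 6 / real k"
        using sample_avg_c4[OF G k1, of "\<lambda>i j. h' (c i) (c j)"] h'01 c4U unfolding D_def U_def by fastforce
    qed (use pos in auto)
    also have "\<dots> \<le> \<epsilon> / 4 + (\<epsilon> / 4 + \<epsilon> / 4)"
    proof (intro add_mono)
      have kk: "real k0 \<le> real k" using k by simp
      have s: "8 * real N / (\<epsilon> * e3) \<le> sqrt k"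
        using k0(3) kk by (intro real_le_rsqrt) linarith
      have "(1 / e3) * (\<Sum>p<N. 2 / sqrt (real k)) = (\<epsilon> / 4) * (8 * real N / (\<epsilon> * e3) / sqrt k)"
        using e by simp
      also have "\<dots> \<le> (\<epsilon> / 4) * 1"
      proof (rule mult_left_mono)
        have "0 < sqrt k" using k1 by simp
        then show "8 * real N / (\<epsilon> * e3) / sqrt k \<le> 1" using s by (simp only: divide_le_eq_1_pos)
      qed (use e in simp)
      finally show "(1 / e3) * (\<Sum>p<N. 2 / sqrt (real k)) \<le> \<epsilon> / 4" by simp
      have "8 * e0 \<le> \<epsilon> / 4 * e2 ^ 4" by (simp add: e0_def)
      moreover have "6 / real k \<le> \<epsilon> / 4 * e2 ^ 4"
      proof -
        have "24 / (\<epsilon> * e2 ^ 4) \<le> real k" using k0(2) kk by linarith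
        then have "24 \<le> real k * (\<epsilon> * e2 ^ 4)" using e pos by (simp add: field_simps)
        then show ?thesis using k1 by (simp add: field_simps)
      qed
      ultimately have "8 * e0 + 6 / real k \<le> e2 ^ 4 * (\<epsilon> / 4 + \<epsilon> / 4)" by (simp add: algebra_simps)
      then show "(1 / e2 ^ 4) * (8 * e0 + 6 / real k) \<le> \<epsilon> / 4 + \<epsilon> / 4"
        using pos by (simp add: field_simps)
    qed
    also have "\<dots> \<le> \<epsilon>" using e by simp
    finally show "measure_pmf.prob (random_sample k G) {H. \<not> overlay_le G H \<epsilon>} \<le> \<epsilon>" .
  qed
qed

subsection \<open>The cut norm of kernels on the unit square\<close>

text \<open>Each factor is a Borel set up to a null set, and the product of a null set with a whole
  space is null. Product measures alone do not give this, since Lebesgue measure on the product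
  space is completed.\<close>

lemma Times_lebesgue:
  fixes A :: "'a::euclidean_space set" and B :: "'b::euclidean_space set"
  assumes A: "A \<in> sets lebesgue" and B: "B \<in> sets lebesgue"
  shows "A \<times> B \<in> sets lebesgue" "emeasure lebesgue (A \<times> B) = emeasure lebesgue A * emeasure lebesgue B"
proof -
  obtain S N N' where A': "A = S \<union> N" "N \<subseteq> N'" "N' \<in> null_sets lborel" "S \<in> sets lborel"
    using A by (rule sets_completionE)
  obtain T M M' where B': "B = T \<union> M" "M \<subseteq> M'" "M' \<in> null_sets lborel" "T \<in> sets lborel"
    using B by (rule sets_completionE)
  have em: "emeasure lborel (X \<times> Y) = emeasure lborel X * emeasure lborel Y" if "X \<in> sets borel" "Y \<in> sets borel"
    for X :: "'a set" and Y :: "'b set"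
    using lborel.emeasure_pair_measure_Times[of X lborel Y] that by (simp add: lborel_prod)
  have bt: "X \<times> Y \<in> sets borel" if "X \<in> sets borel" "Y \<in> sets borel" for X :: "'a set" and Y :: "'b set"
    using that by (rule borel_Times)
  have nullA: "N' \<times> UNIV \<in> null_sets (lborel :: ('a \<times> 'b) measure)"
    using A'(3) em[of N' UNIV] bt[of N' UNIV] by (auto simp: null_sets_def)
  have nullB: "UNIV \<times> M' \<in> null_sets (lborel :: ('a \<times> 'b) measure)"
    using B'(3) em[of UNIV M'] bt[of UNIV M'] by (auto simp: null_sets_def)
  have null: "N' \<times> UNIV \<union> UNIV \<times> M' \<in> null_sets (lborel :: ('a \<times> 'b) measure)"
    using nullA nullB by (rule null_sets.Un)
  define R where "R = (A \<times> B) - (S \<times> T)"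
  have R: "A \<times> B = S \<times> T \<union> R" "R \<subseteq> N' \<times> UNIV \<union> UNIV \<times> M'"
    using A'(1,2) B'(1,2) by (auto simp: R_def)
  have ST: "S \<times> T \<in> sets (lborel :: ('a \<times> 'b) measure)" using A' B' bt[of S T] by simp
  show AB: "A \<times> B \<in> sets lebesgue"
    by (rule sets_completionI[OF R null ST])
  have Rn: "R \<in> null_sets lebesgue"
    using null R(2) by (meson null_sets_completionI null_sets_completion_subset)
  have "emeasure lebesgue (A \<times> B) = emeasure lebesgue (S \<times> T)"
    unfolding R(1) using ST Rn by (intro emeasure_Un_null_set) auto
  also have "\<dots> = emeasure lborel S * emeasure lborel T" using ST A' B' em[of S T] by simp
  also have "emeasure lborel S = emeasure lebesgue A"
  proof -
    have "N \<in> null_sets lebesgue" using A' by (meson null_sets_completionI null_sets_completion_subset)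
    then show ?thesis unfolding A'(1) using A'(4) by (simp add: emeasure_Un_null_set)
  qed
  also have "emeasure lborel T = emeasure lebesgue B"
  proof -
    have "M \<in> null_sets lebesgue" using B' by (meson null_sets_completionI null_sets_completion_subset)
    then show ?thesis unfolding B'(1) using B'(4) by (simp add: emeasure_Un_null_set)
  qed
  finally show "emeasure lebesgue (A \<times> B) = emeasure lebesgue A * emeasure lebesgue B" .
qed

section \<open>Lebesgue measure on the unit interval and the unit square\<close>

abbreviation unit_leb :: "real measure" where "unit_leb \<equiv> lebesgue_on {0..1}"
abbreviation sq_leb :: "(real \<times> real) measure" where "sq_leb \<equiv> lebesgue_on ({0..1} \<times> {0..1})"

lemma sets_unit_leb: "A \<in> sets unit_leb \<longleftrightarrow> A \<in> sets lebesgue \<and> A \<subseteq> {0..1}"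
  by (subst sets_restrict_space_iff) auto

lemma square_lebesgue [simp]: "{0..1} \<times> {0..1} \<in> sets (lebesgue :: (real \<times> real) measure)"
  by (intro Times_lebesgue) auto

lemma sets_sq_leb: "A \<in> sets sq_leb \<longleftrightarrow> A \<in> sets lebesgue \<and> A \<subseteq> {0..1} \<times> {0..1}"
  by (subst sets_restrict_space_iff) auto

lemma emeasure_sq_leb: "A \<subseteq> {0..1} \<times> {0..1} \<Longrightarrow> emeasure sq_leb A = emeasure lebesgue A"
  by (rule emeasure_restrict_space) auto

lemma Times_sq_leb:
  assumes "S \<in> sets unit_leb" "T \<in> sets unit_leb"
  shows "S \<times> T \<in> sets sq_leb" "emeasure sq_leb (S \<times> T) = emeasure unit_leb S * emeasure unit_leb T"
proof -
  have ST: "S \<in> sets lebesgue" "T \<in> sets lebesgue" "S \<subseteq> {0..1}" "T \<subseteq> {0..1}"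
    using assms by (auto simp: sets_unit_leb)
  then have sub: "S \<times> T \<subseteq> {0..1} \<times> {0..1}" by auto
  show "S \<times> T \<in> sets sq_leb" using sub Times_lebesgue(1)[OF ST(1,2)] by (simp add: sets_sq_leb)
  have "emeasure unit_leb S = emeasure lebesgue S" "emeasure unit_leb T = emeasure lebesgue T"
    by (rule emeasure_restrict_space; use ST in simp)+
  then show "emeasure sq_leb (S \<times> T) = emeasure unit_leb S * emeasure unit_leb T"
    unfolding emeasure_sq_leb[OF sub] Times_lebesgue(2)[OF ST(1,2)] by simp
qed

lemma emeasure_unit_leb [simp]: "emeasure unit_leb {0..1} = 1"
  by (simp add: emeasure_restrict_space)

interpretation unit_leb: prob_space unit_leb
  by (rule prob_spaceI) simp

interpretation sq_leb: prob_space sq_leb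
proof (rule prob_spaceI)
  have "{0..1} \<in> sets unit_leb" by (simp add: sets_unit_leb)
  then show "emeasure sq_leb (space sq_leb) = 1" using Times_sq_leb(2)[of "{0..1}" "{0..1}"] by simp
qed

lemma measure_Times_sq_leb:
  assumes "S \<in> sets unit_leb" "T \<in> sets unit_leb"
  shows "measure sq_leb (S \<times> T) = measure unit_leb S * measure unit_leb T"
  using Times_sq_leb(2)[OF assms] by (simp add: measure_def enn2real_mult)

text \<open>Every set of the product sigma-algebra is Lebesgue measurable in the square, but not
  conversely, so the identity is measurable in this direction. With \<open>distr_sq_leb_pair\<close>
  it makes Fubini available.\<close>

lemma id_sq_leb_pair: "(\<lambda>z. z) \<in> sq_leb \<rightarrow>\<^sub>M unit_leb \<Otimes>\<^sub>M unit_leb"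
proof (rule measurable_pair)
  have "(fst \<circ> (\<lambda>z. z)) -` A \<inter> space sq_leb \<in> sets sq_leb" if "A \<in> sets unit_leb" for A
  proof -
    have "(fst \<circ> (\<lambda>z. z)) -` A \<inter> space sq_leb = A \<times> {0..1}" using that by (auto simp: sets_unit_leb)
    then show ?thesis using Times_sq_leb(1)[OF that, of "{0..1}"] by (simp add: sets_unit_leb)
  qed
  then show "fst \<circ> (\<lambda>z. z) \<in> sq_leb \<rightarrow>\<^sub>M unit_leb" by (intro measurableI) auto
  have "(snd \<circ> (\<lambda>z. z)) -` A \<inter> space sq_leb \<in> sets sq_leb" if "A \<in> sets unit_leb" for A
  proof -
    have "(snd \<circ> (\<lambda>z. z)) -` A \<inter> space sq_leb = {0..1} \<times> A" using that by (auto simp: sets_unit_leb)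
    then show ?thesis using Times_sq_leb(1)[OF _ that, of "{0..1}"] by (simp add: sets_unit_leb)
  qed
  then show "snd \<circ> (\<lambda>z. z) \<in> sq_leb \<rightarrow>\<^sub>M unit_leb" by (intro measurableI) auto
qed

lemma distr_sq_leb_pair: "distr sq_leb (unit_leb \<Otimes>\<^sub>M unit_leb) (\<lambda>z. z) = unit_leb \<Otimes>\<^sub>M unit_leb"
proof (rule pair_measure_eqI[symmetric])
  fix A B assume AB: "A \<in> sets unit_leb" "B \<in> sets unit_leb"
  have "(\<lambda>z. z) -` (A \<times> B) \<inter> space sq_leb = A \<times> B" using AB by (auto simp: sets_unit_leb)
  then show "emeasure unit_leb A * emeasure unit_leb B = emeasure (distr sq_leb (unit_leb \<Otimes>\<^sub>M unit_leb) (\<lambda>z. z)) (A \<times> B)"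
    using AB id_sq_leb_pair by (subst emeasure_distr) (auto simp: Times_sq_leb)
qed (simp_all add: unit_leb.sigma_finite_measure_axioms)

section \<open>Measure preserving bijections\<close>

lemma mp_bijectionsD:
  assumes "\<nu> \<in> mp_bijections"
  shows "\<nu> \<in> unit_leb \<rightarrow>\<^sub>M unit_leb" "distr unit_leb unit_leb \<nu> = unit_leb" "bij_betw \<nu> {0..1} {0..1}"
    "x \<in> {0..1} \<Longrightarrow> \<nu> x \<in> {0..1}"
  using assms by (auto simp: mp_bijections_def bij_betw_def)

lemma mp_bijections_comp:
  assumes "\<nu> \<in> mp_bijections" "\<mu> \<in> mp_bijections"
  shows "(\<lambda>x. \<nu> (\<mu> x)) \<in> mp_bijections"
proof -
  note n = mp_bijectionsD[OF assms(1)] and m = mp_bijectionsD[OF assms(2)]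
  have "distr unit_leb unit_leb (\<nu> \<circ> \<mu>) = distr (distr unit_leb unit_leb \<mu>) unit_leb \<nu>"
    by (rule distr_distr[symmetric, OF n(1) m(1)])
  then have "distr unit_leb unit_leb (\<lambda>x. \<nu> (\<mu> x)) = unit_leb"
    using n(2) m(2) by (simp add: comp_def)
  moreover have "(\<lambda>x. \<nu> (\<mu> x)) \<in> unit_leb \<rightarrow>\<^sub>M unit_leb" using n(1) m(1) by simp
  moreover have "bij_betw (\<lambda>x. \<nu> (\<mu> x)) {0..1} {0..1}"
    using bij_betw_trans[OF m(3) n(3)] by (simp add: comp_def)
  ultimately show ?thesis by (simp add: mp_bijections_def)
qed

text \<open>The hypotheses concern the product sigma-algebra, the claim its completion. A Lebesgue
  set consists of a Borel set and a part of a Borel null set; the preimage of the null set is null,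
  and completeness takes care of its subsets.\<close>

lemma sq_leb_measure_preserving:
  assumes TP: "T \<in> unit_leb \<Otimes>\<^sub>M unit_leb \<rightarrow>\<^sub>M unit_leb \<Otimes>\<^sub>M unit_leb"
    and distrT: "distr (unit_leb \<Otimes>\<^sub>M unit_leb) (unit_leb \<Otimes>\<^sub>M unit_leb) T = unit_leb \<Otimes>\<^sub>M unit_leb"
  shows "T \<in> sq_leb \<rightarrow>\<^sub>M sq_leb" "distr sq_leb sq_leb T = sq_leb"
proof -
  let ?P = "unit_leb \<Otimes>\<^sub>M unit_leb"
  have sp: "space ?P = {0..1} \<times> {0..1}" by (simp add: space_pair_measure)
  have range: "T z \<in> {0..1} \<times> {0..1}" if "z \<in> {0..1} \<times> {0..1}" for z
    using measurable_space[OF TP] that unfolding sp by blast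
  have TeP: "emeasure ?P (T -` A \<inter> space ?P) = emeasure ?P A" if "A \<in> sets ?P" for A
    using emeasure_distr[OF TP that] unfolding distrT by simp
  have eP: "emeasure sq_leb A = emeasure ?P A" "A \<in> sets sq_leb" if A: "A \<in> sets ?P" for A
  proof -
    have "A \<subseteq> {0..1} \<times> {0..1}" using sets.sets_into_space[OF A] sp by simp
    then have eq: "(\<lambda>z. z) -` A \<inter> space sq_leb = A" by auto
    show "emeasure sq_leb A = emeasure ?P A"
      using emeasure_distr[OF id_sq_leb_pair A] unfolding distr_sq_leb_pair eq by simp
    show "A \<in> sets sq_leb" using measurable_sets[OF id_sq_leb_pair A] unfolding eq .
  qed
  have bP: "A \<inter> {0..1} \<times> {0..1} \<in> sets ?P" if "A \<in> sets borel" for A :: "(real \<times> real) set"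
  proof -
    have "(\<lambda>x. x) \<in> unit_leb \<rightarrow>\<^sub>M borel"
      by (intro measurable_restrict_space1 measurable_completion) simp
    then have "(\<lambda>z. (fst z, snd z)) \<in> ?P \<rightarrow>\<^sub>M borel \<Otimes>\<^sub>M borel"
      by (intro measurable_Pair measurable_compose[OF measurable_fst] measurable_compose[OF measurable_snd])
    then have "(\<lambda>z. z) \<in> ?P \<rightarrow>\<^sub>M borel" by (simp add: borel_prod)
    from measurable_sets[OF this that] show ?thesis unfolding sp by simp
  qed
  have borel_case: "T -` A \<inter> {0..1} \<times> {0..1} \<in> sets sq_leb \<and>
      emeasure sq_leb (T -` A \<inter> {0..1} \<times> {0..1}) = emeasure sq_leb (A \<inter> {0..1} \<times> {0..1})"
    if A: "A \<in> sets borel" for A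
  proof -
    have eq: "T -` A \<inter> {0..1} \<times> {0..1} = T -` (A \<inter> {0..1} \<times> {0..1}) \<inter> space ?P"
      unfolding sp using range by auto
    note 1 = measurable_sets[OF TP bP[OF A]]
    show ?thesis unfolding eq eP(1)[OF 1] eP(1)[OF bP[OF A]] TeP[OF bP[OF A]] using eP(2)[OF 1] by blast
  qed
  have main: "T -` A \<inter> {0..1} \<times> {0..1} \<in> sets sq_leb \<and>
      emeasure sq_leb (T -` A \<inter> {0..1} \<times> {0..1}) = emeasure sq_leb A"
    if A: "A \<in> sets sq_leb" for A
  proof -
    have A': "A \<in> sets lebesgue" "A \<subseteq> {0..1} \<times> {0..1}" using A by (auto simp: sets_sq_leb)
    obtain S N N' where S: "A = S \<union> N" "N \<subseteq> N'" "N' \<in> null_sets lborel" "S \<in> sets lborel"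
      using A'(1) by (rule sets_completionE)
    let ?Q = "{0..1} \<times> {0..1} :: (real \<times> real) set"
    have Sq: "S \<inter> ?Q = S" using A'(2) S(1) by blast
    have N'0: "emeasure sq_leb (N' \<inter> ?Q) = 0"
    proof -
      have "emeasure lebesgue (N' \<inter> ?Q) \<le> emeasure lebesgue N'"
        using S(3) by (intro emeasure_mono) auto
      also have "\<dots> = 0" using null_sets_completionI[OF S(3)] by (rule null_setsD1)
      finally show ?thesis by (simp add: emeasure_sq_leb)
    qed
    have "T -` N' \<inter> ?Q \<in> null_sets sq_leb"
    proof -
      have "N' \<in> sets borel" using S(3) by (auto simp: null_sets_def)
      then show ?thesis using borel_case[of N'] N'0 by (simp add: null_sets_def)
    qed
    then have "T -` N' \<inter> ?Q \<in> null_sets lebesgue" by (simp add: null_sets_restrict_space)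
    then have "T -` N \<inter> ?Q \<in> null_sets lebesgue"
      by (rule null_sets_completion_subset[rotated]) (use S(2) in auto)
    then have TN: "T -` N \<inter> ?Q \<in> null_sets sq_leb" by (simp add: null_sets_restrict_space)
    have "N \<in> null_sets lebesgue" using S by (meson null_sets_completionI null_sets_completion_subset)
    then have N: "N \<in> null_sets sq_leb" using A'(2) S(1) by (simp add: null_sets_restrict_space)
    have Ssq: "S \<in> sets sq_leb" using S A'(2) by (auto simp: sets_sq_leb)
    have TA: "T -` A \<inter> ?Q = (T -` S \<inter> ?Q) \<union> (T -` N \<inter> ?Q)" unfolding S(1) by auto
    have bc: "T -` S \<inter> ?Q \<in> sets sq_leb" "emeasure sq_leb (T -` S \<inter> ?Q) = emeasure sq_leb S"
      using borel_case[of S] S(4) Sq by auto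
    have "emeasure sq_leb (T -` A \<inter> ?Q) = emeasure sq_leb (T -` S \<inter> ?Q)"
      unfolding TA by (rule emeasure_Un_null_set[OF bc(1) TN])
    also have "\<dots> = emeasure sq_leb A"
      unfolding bc(2) S(1) by (rule emeasure_Un_null_set[OF Ssq N, symmetric])
    finally show ?thesis using bc(1) TN unfolding TA by auto
  qed
  show T: "T \<in> sq_leb \<rightarrow>\<^sub>M sq_leb"
    using main range by (intro measurableI) auto
  show "distr sq_leb sq_leb T = sq_leb"
    using main by (intro measure_eqI) (auto simp: emeasure_distr[OF T])
qed

lemma mp_square:
  assumes "\<nu> \<in> mp_bijections"
  shows "(\<lambda>z. (\<nu> (fst z), \<nu> (snd z))) \<in> sq_leb \<rightarrow>\<^sub>M sq_leb" (is "?T \<in> _")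
    and "distr sq_leb sq_leb (\<lambda>z. (\<nu> (fst z), \<nu> (snd z))) = sq_leb"
proof -
  note n = mp_bijectionsD[OF assms(1)]
  let ?P = "unit_leb \<Otimes>\<^sub>M unit_leb"
  have TP: "?T \<in> ?P \<rightarrow>\<^sub>M ?P" using n(1) by measurable
  have "distr unit_leb unit_leb \<nu> \<Otimes>\<^sub>M distr unit_leb unit_leb \<nu> = distr ?P ?P (\<lambda>(x, y). (\<nu> x, \<nu> y))"
    by (rule pair_measure_distr[OF n(1) n(1)]) (simp add: n(2) unit_leb.sigma_finite_measure_axioms)
  then have "distr ?P ?P ?T = ?P" by (simp add: n(2) case_prod_beta')
  from sq_leb_measure_preserving[OF TP this]
  show "?T \<in> sq_leb \<rightarrow>\<^sub>M sq_leb" "distr sq_leb sq_leb ?T = sq_leb" .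
qed

interpretation unit_pair: pair_sigma_finite unit_leb unit_leb ..

lemma swap_sq_leb:
  "(\<lambda>z. (snd z, fst z)) \<in> sq_leb \<rightarrow>\<^sub>M sq_leb"
  "distr sq_leb sq_leb (\<lambda>z. (snd z, fst z)) = sq_leb"
proof -
  let ?P = "unit_leb \<Otimes>\<^sub>M unit_leb"
  have TP: "(\<lambda>z. (snd z, fst z)) \<in> ?P \<rightarrow>\<^sub>M ?P" by measurable
  have "distr ?P ?P (\<lambda>z. (snd z, fst z)) = ?P"
    using unit_pair.distr_pair_swap by (simp add: case_prod_beta')
  from sq_leb_measure_preserving[OF TP this]
  show "(\<lambda>z. (snd z, fst z)) \<in> sq_leb \<rightarrow>\<^sub>M sq_leb" "distr sq_leb sq_leb (\<lambda>z. (snd z, fst z)) = sq_leb" .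
qed

abbreviation (input) pull :: "(real \<Rightarrow> real) \<Rightarrow> (real \<Rightarrow> real \<Rightarrow> real) \<Rightarrow> real \<Rightarrow> real \<Rightarrow> real" where
  "pull \<nu> W \<equiv> \<lambda>x y. W (\<nu> x) (\<nu> y)"

lemma graphons_pull:
  assumes "W \<in> graphons" "\<nu> \<in> mp_bijections"
  shows "pull \<nu> W \<in> graphons"
proof -
  have "(\<lambda>z. W (fst z) (snd z)) \<in> borel_measurable sq_leb" using assms by (simp add: graphons_def)
  from measurable_compose[OF mp_square(1)[OF assms(2)] this]
  have "(\<lambda>z. W (\<nu> (fst z)) (\<nu> (snd z))) \<in> borel_measurable sq_leb" by simp
  then show ?thesis using assms mp_bijectionsD(4)[OF assms(2)] by (auto simp: graphons_def)
qed

section \<open>Kernels, rectangle integrals and the cut norm\<close>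

definition kernel :: "(real \<Rightarrow> real \<Rightarrow> real) \<Rightarrow> bool" where
  "kernel W \<longleftrightarrow> integrable sq_leb (\<lambda>z. W (fst z) (snd z))"

lemma kernel_graphon: "W \<in> graphons \<Longrightarrow> kernel W"
  unfolding kernel_def
  by (rule sq_leb.integrable_const_bound[of _ 1]) (auto simp: graphons_def intro!: AE_I2)

lemma kernel_diff: "kernel W \<Longrightarrow> kernel U \<Longrightarrow> kernel (\<lambda>x y. W x y - U x y)"
  unfolding kernel_def by simp

definition l1_norm :: "(real \<Rightarrow> real \<Rightarrow> real) \<Rightarrow> real" where
  "l1_norm W = (LINT z|sq_leb. \<bar>W (fst z) (snd z)\<bar>)"

lemma l1_norm_pull:
  assumes "\<nu> \<in> mp_bijections" "kernel W"
  shows "l1_norm (pull \<nu> W) = l1_norm W" "kernel (pull \<nu> W)"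
proof -
  note T = mp_square[OF assms(1)]
  have "(LINT z|distr sq_leb sq_leb (\<lambda>z. (\<nu> (fst z), \<nu> (snd z))). \<bar>W (fst z) (snd z)\<bar>)
     = (LINT z|sq_leb. \<bar>W (\<nu> (fst z)) (\<nu> (snd z))\<bar>)"
    using assms(2) unfolding kernel_def by (subst integral_distr[OF T(1)]) auto
  then show "l1_norm (pull \<nu> W) = l1_norm W" unfolding l1_norm_def T(2) by simp
  show "kernel (pull \<nu> W)"
    using integrable_distr[OF T(1), of "\<lambda>z. W (fst z) (snd z)"] assms(2) unfolding kernel_def T(2) by simp
qed

text \<open>The integral runs over the probability space on the square, so that bounded kernels are
  integrable; \<open>set_integral_rect\<close> identifies it with the set integral in
  \<open>cut_norm\<close>.\<close>

definition rect_int :: "(real \<Rightarrow> real \<Rightarrow> real) \<Rightarrow> real set \<Rightarrow> real set \<Rightarrow> real" where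
  "rect_int W S T = (LINT z|sq_leb. indicator (S \<times> T) z * W (fst z) (snd z))"

lemma set_integral_rect:
  assumes "S \<in> sets unit_leb" "T \<in> sets unit_leb"
  shows "(LINT z : S \<times> T | lebesgue. W (fst z) (snd z)) = rect_int W S T"
proof -
  have "S \<times> T \<subseteq> {0..1} \<times> {0..1}" using assms by (auto simp: sets_unit_leb)
  then have *: "indicator (S \<times> T) z *\<^sub>R W (fst z) (snd z) = indicator ({0..1} \<times> {0..1}) z *\<^sub>R (indicator (S \<times> T) z * W (fst z) (snd z))" for z
    by (auto simp: indicator_def)
  have "rect_int W S T = (LINT z|lebesgue. indicator ({0..1} \<times> {0..1}) z *\<^sub>R (indicator (S \<times> T) z * W (fst z) (snd z)))"
    unfolding rect_int_def by (rule integral_restrict_space) simp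
  then show ?thesis unfolding set_lebesgue_integral_def * ..
qed

lemma cut_norm_alt: "cut_norm W = (SUP (S, T) \<in> sets unit_leb \<times> sets unit_leb. \<bar>rect_int W S T\<bar>)"
  unfolding cut_norm_def by (intro SUP_cong) (auto simp: set_integral_rect)

lemma cut_norm_le:
  assumes "\<And>S T. S \<in> sets unit_leb \<Longrightarrow> T \<in> sets unit_leb \<Longrightarrow> \<bar>rect_int W S T\<bar> \<le> c"
  shows "cut_norm W \<le> c"
  unfolding cut_norm_alt
proof (rule cSUP_least)
  show "sets unit_leb \<times> sets unit_leb \<noteq> {}" using sets.empty_sets[of unit_leb] by blast
qed (use assms in auto)

lemma kernel_rect: "kernel W \<Longrightarrow> S \<in> sets unit_leb \<Longrightarrow> T \<in> sets unit_leb \<Longrightarrow>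
    integrable sq_leb (\<lambda>z. indicator (S \<times> T) z * W (fst z) (snd z))"
  using integrable_mult_indicator[OF Times_sq_leb(1)[of S T], of "\<lambda>z. W (fst z) (snd z)"]
  by (simp add: kernel_def)

lemma rect_int_le_l1:
  assumes "kernel W" "S \<in> sets unit_leb" "T \<in> sets unit_leb"
  shows "\<bar>rect_int W S T\<bar> \<le> l1_norm W"
proof -
  have "\<bar>rect_int W S T\<bar> \<le> (LINT z|sq_leb. \<bar>indicator (S \<times> T) z * W (fst z) (snd z)\<bar>)"
    unfolding rect_int_def by (rule integral_abs_bound)
  also have "\<dots> \<le> l1_norm W"
    unfolding l1_norm_def using kernel_rect[OF assms] assms(1)
    by (intro integral_mono) (auto simp: kernel_def indicator_def)
  finally show ?thesis .
qed

lemma rect_int_le_cut_norm: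
  assumes "kernel W" "S \<in> sets unit_leb" "T \<in> sets unit_leb"
  shows "\<bar>rect_int W S T\<bar> \<le> cut_norm W"
proof -
  have "bdd_above ((\<lambda>(S, T). \<bar>rect_int W S T\<bar>) ` (sets unit_leb \<times> sets unit_leb))"
    using rect_int_le_l1[OF assms(1)] by (intro bdd_aboveI[of _ "l1_norm W"]) auto
  from cSUP_upper[OF _ this, of "(S, T)"] show ?thesis
    unfolding cut_norm_alt using assms by auto
qed

lemma cut_norm_nonneg: "kernel W \<Longrightarrow> 0 \<le> cut_norm W"
  using rect_int_le_cut_norm[of W "{}" "{}"] by simp

lemma cut_norm_le_l1: "kernel W \<Longrightarrow> cut_norm W \<le> l1_norm W"
  by (intro cut_norm_le rect_int_le_l1)

lemma rect_int_diff:
  assumes "kernel W" "kernel U" "S \<in> sets unit_leb" "T \<in> sets unit_leb"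
  shows "rect_int (\<lambda>x y. W x y - U x y) S T = rect_int W S T - rect_int U S T"
  unfolding rect_int_def right_diff_distrib
  by (rule Bochner_Integration.integral_diff) (use kernel_rect assms in auto)

lemma cut_norm_triangle:
  assumes "kernel W" "kernel U" "kernel V"
  shows "cut_norm (\<lambda>x y. W x y - V x y) \<le> cut_norm (\<lambda>x y. W x y - U x y) + cut_norm (\<lambda>x y. U x y - V x y)"
proof (rule cut_norm_le)
  fix S T assume ST: "S \<in> sets unit_leb" "T \<in> sets unit_leb"
  note le = rect_int_le_cut_norm[OF kernel_diff ST]
  show "\<bar>rect_int (\<lambda>x y. W x y - V x y) S T\<bar> \<le> cut_norm (\<lambda>x y. W x y - U x y) + cut_norm (\<lambda>x y. U x y - V x y)"
    using le[OF assms(1,2)] le[OF assms(2,3)] assms ST by (simp add: rect_int_diff)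
qed

lemma cut_norm_commute:
  "cut_norm (\<lambda>x y. W x y - U x y) = cut_norm (\<lambda>x y. U x y - W x y)"
proof -
  have "\<bar>rect_int (\<lambda>x y. W x y - U x y) S T\<bar> = \<bar>rect_int (\<lambda>x y. U x y - W x y) S T\<bar>" for S T
  proof -
    have "rect_int (\<lambda>x y. W x y - U x y) S T = - rect_int (\<lambda>x y. U x y - W x y) S T"
      unfolding rect_int_def Bochner_Integration.integral_minus[symmetric] by (intro Bochner_Integration.integral_cong) (auto simp: algebra_simps)
    then show ?thesis by simp
  qed
  then show ?thesis unfolding cut_norm_alt by simp
qed

text \<open>The kernel is constant on products of classes of \<open>p\<close>, so a rectangle is
  seen only through the measures of its sides within the classes.\<close>

lemma rect_int_step:
  fixes p :: "real \<Rightarrow> 'k"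
  assumes K: "finite K" and p: "\<And>x. x \<in> {0..1} \<Longrightarrow> p x \<in> K"
    and meas: "\<And>i. i \<in> K \<Longrightarrow> {x\<in>{0..1}. p x = i} \<in> sets unit_leb"
    and W: "\<And>x y. x \<in> {0..1} \<Longrightarrow> y \<in> {0..1} \<Longrightarrow> W x y = m (p x) (p y)"
    and ST: "S \<in> sets unit_leb" "T \<in> sets unit_leb"
  shows "rect_int W S T = (\<Sum>i\<in>K. \<Sum>j\<in>K. measure unit_leb {x\<in>S. p x = i} * measure unit_leb {x\<in>T. p x = j} * m i j)"
    and "kernel W"
proof -
  have sub: "S \<subseteq> {0..1}" "T \<subseteq> {0..1}" using ST by (auto simp: sets_unit_leb)
  have eqi: "{x\<in>S. p x = i} = S \<inter> {x\<in>{0..1}. p x = i}" if "S \<subseteq> {0..1}" for S i using that by auto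
  have ms: "{x\<in>S. p x = i} \<in> sets unit_leb" if "S \<in> sets unit_leb" "i \<in> K" for S i
  proof -
    have "S \<subseteq> {0..1}" using that by (auto simp: sets_unit_leb)
    then show ?thesis unfolding eqi[OF \<open>S \<subseteq> _\<close>] by (intro sets.Int that meas)
  qed
  have mr: "{x\<in>S. p x = i} \<times> {x\<in>T. p x = j} \<in> sets sq_leb" if "S \<in> sets unit_leb" "T \<in> sets unit_leb" "i \<in> K" "j \<in> K" for S T i j
    using that by (intro Times_sq_leb ms)
  have pt: "indicator (S \<times> T) z * W (fst z) (snd z)
     = (\<Sum>i\<in>K. \<Sum>j\<in>K. m i j * indicator ({x\<in>S. p x = i} \<times> {x\<in>T. p x = j}) z)"
    if z: "z \<in> {0..1} \<times> {0..1}" and "S \<subseteq> {0..1}" "T \<subseteq> {0..1}" for z S T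
  proof -
    have pz: "p (fst z) \<in> K" "p (snd z) \<in> K" using p z by auto
    have "(\<Sum>i\<in>K. \<Sum>j\<in>K. m i j * indicator ({x\<in>S. p x = i} \<times> {x\<in>T. p x = j}) z)
      = (\<Sum>i\<in>K. if i = p (fst z) then (\<Sum>j\<in>K. if j = p (snd z) then indicator (S \<times> T) z * m i j else 0) else 0)"
    proof (intro sum.cong refl)
      fix i
      show "(\<Sum>j\<in>K. m i j * indicator ({x\<in>S. p x = i} \<times> {x\<in>T. p x = j}) z)
        = (if i = p (fst z) then (\<Sum>j\<in>K. if j = p (snd z) then indicator (S \<times> T) z * m i j else 0) else 0)"
      proof (cases "i = p (fst z)")
        case True
        have "(\<Sum>j\<in>K. m i j * indicator ({x\<in>S. p x = i} \<times> {x\<in>T. p x = j}) z)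
          = (\<Sum>j\<in>K. if j = p (snd z) then indicator (S \<times> T) z * m i j else 0)"
        proof (rule sum.cong[OF refl])
          fix j
          show "m i j * indicator ({x\<in>S. p x = i} \<times> {x\<in>T. p x = j}) z = (if j = p (snd z) then indicator (S \<times> T) z * m i j else 0)"
            using True by (cases z; cases "fst z \<in> S"; cases "snd z \<in> T") (simp_all add: indicator_def)
        qed
        then show ?thesis using True by simp
      next
        case False
        then have "(\<Sum>j\<in>K. m i j * indicator ({x\<in>S. p x = i} \<times> {x\<in>T. p x = j}) z) = 0"
          by (intro sum.neutral ballI, cases z) (simp add: indicator_def)
        then show ?thesis using False by simp
      qed
    qed
    also have "\<dots> = indicator (S \<times> T) z * m (p (fst z)) (p (snd z))"
      using K pz by simp
    also have "\<dots> = indicator (S \<times> T) z * W (fst z) (snd z)" using z W by auto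
    finally show ?thesis by simp
  qed
  have int: "integrable sq_leb (\<lambda>z. m i j * indicator ({x\<in>S. p x = i} \<times> {x\<in>T. p x = j}) z)"
    if "S \<in> sets unit_leb" "T \<in> sets unit_leb" "i \<in> K" "j \<in> K" for S T i j
    using mr[OF that] by (intro integrable_mult_right) (auto simp: less_top[symmetric])
  have "rect_int W S T = (LINT z|sq_leb. (\<Sum>i\<in>K. \<Sum>j\<in>K. m i j * indicator ({x\<in>S. p x = i} \<times> {x\<in>T. p x = j}) z))"
    unfolding rect_int_def by (rule Bochner_Integration.integral_cong) (use pt sub in auto)
  also have "\<dots> = (\<Sum>i\<in>K. \<Sum>j\<in>K. LINT z|sq_leb. m i j * indicator ({x\<in>S. p x = i} \<times> {x\<in>T. p x = j}) z)"
    using int ST by (subst Bochner_Integration.integral_sum, simp, intro sum.cong refl Bochner_Integration.integral_sum) auto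
  also have "\<dots> = (\<Sum>i\<in>K. \<Sum>j\<in>K. measure unit_leb {x\<in>S. p x = i} * measure unit_leb {x\<in>T. p x = j} * m i j)"
  proof (intro sum.cong refl)
    fix i j assume ij: "i \<in> K" "j \<in> K"
    have "(LINT z|sq_leb. m i j * indicator ({x\<in>S. p x = i} \<times> {x\<in>T. p x = j}) z) = m i j * measure sq_leb ({x\<in>S. p x = i} \<times> {x\<in>T. p x = j})"
      using mr[OF ST ij] sets.sets_into_space[OF mr[OF ST ij]] by (simp add: Int_absorb2)
    then show "(LINT z|sq_leb. m i j * indicator ({x\<in>S. p x = i} \<times> {x\<in>T. p x = j}) z)
       = measure unit_leb {x\<in>S. p x = i} * measure unit_leb {x\<in>T. p x = j} * m i j"
      using ms[OF ST(1) ij(1)] ms[OF ST(2) ij(2)] by (simp add: measure_Times_sq_leb mult_ac)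
  qed
  finally show "rect_int W S T = (\<Sum>i\<in>K. \<Sum>j\<in>K. measure unit_leb {x\<in>S. p x = i} * measure unit_leb {x\<in>T. p x = j} * m i j)" .
  have U: "{0..1} \<in> sets unit_leb" by simp
  have "integrable sq_leb (\<lambda>z. \<Sum>i\<in>K. \<Sum>j\<in>K. m i j * indicator ({x\<in>{0..1}. p x = i} \<times> {x\<in>{0..1}. p x = j}) z)"
    using int[OF U U] by auto
  then show "kernel W" unfolding kernel_def
    by (rule Bochner_Integration.integrable_cong[THEN iffD1, rotated -1]) (use pt[of _ "{0..1}" "{0..1}"] in auto)
qed

text \<open>Unions of classes are measurable test sets, which gives one direction. An arbitrary set
  takes from each class a mass between 0 and its measure, so \<open>cut_le_fractional\<close> gives
  the other. This is the passage from graphons of graphs to finite matrices.\<close>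

lemma cut_norm_step_le_iff:
  fixes p :: "real \<Rightarrow> 'k"
  assumes K: "finite K" and p: "\<And>x. x \<in> {0..1} \<Longrightarrow> p x \<in> K"
    and meas: "\<And>i. i \<in> K \<Longrightarrow> {x\<in>{0..1}. p x = i} \<in> sets unit_leb"
    and W: "\<And>x y. x \<in> {0..1} \<Longrightarrow> y \<in> {0..1} \<Longrightarrow> W x y = m (p x) (p y)"
  shows "cut_norm W \<le> c \<longleftrightarrow> cut_le K (\<lambda>i. measure unit_leb {x\<in>{0..1}. p x = i}) m c"
proof
  have st: "rect_int W S T = (\<Sum>i\<in>K. \<Sum>j\<in>K. measure unit_leb {x\<in>S. p x = i} * measure unit_leb {x\<in>T. p x = j} * m i j)"
    "kernel W" if "S \<in> sets unit_leb" "T \<in> sets unit_leb" for S T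
    using that by (auto intro: rect_int_step[where K=K and p=p and W=W and m=m, OF K p meas W])
  assume c: "cut_norm W \<le> c"
  show "cut_le K (\<lambda>i. measure unit_leb {x\<in>{0..1}. p x = i}) m c"
    unfolding cut_le_def
  proof (intro allI impI)
    fix S T assume ST: "S \<subseteq> K" "T \<subseteq> K"
    let ?U = "\<lambda>S. \<Union>i\<in>S. {x\<in>{0..1}. p x = i}"
    have U: "?U S \<in> sets unit_leb" if "S \<subseteq> K" for S
      using that K by (intro sets.finite_UN meas) (auto intro: finite_subset)
    have mU: "measure unit_leb {x\<in>?U S. p x = i} = of_bool (i \<in> S) * measure unit_leb {x\<in>{0..1}. p x = i}" for S i
    proof (cases "i \<in> S")
      case True
      then have "{x\<in>?U S. p x = i} = {x\<in>{0..1}. p x = i}" by auto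
      then show ?thesis using True by simp
    next
      case False
      then have "{x\<in>?U S. p x = i} = {}" by auto
      then show ?thesis using False by (simp only: measure_empty) simp
    qed
    have "rect_int W (?U S) (?U T) = (\<Sum>i\<in>K. of_bool (i \<in> S) * (\<Sum>j\<in>K. of_bool (j \<in> T) *
       (measure unit_leb {x\<in>{0..1}. p x = i} * measure unit_leb {x\<in>{0..1}. p x = j} * m i j)))"
      unfolding st(1)[OF U[OF ST(1)] U[OF ST(2)]] mU sum_distrib_left by (intro sum.cong refl) (simp add: mult_ac)
    also have "\<dots> = (\<Sum>i\<in>S. \<Sum>j\<in>T. measure unit_leb {x\<in>{0..1}. p x = i} * measure unit_leb {x\<in>{0..1}. p x = j} * m i j)"
      using ST by (simp add: sum_of_bool_mult_eq[OF K] Int_absorb1)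
    finally show "\<bar>\<Sum>i\<in>S. \<Sum>j\<in>T. measure unit_leb {x\<in>{0..1}. p x = i} * measure unit_leb {x\<in>{0..1}. p x = j} * m i j\<bar> \<le> c"
      using rect_int_le_cut_norm[OF st(2)[OF U[OF ST(1)] U[OF ST(2)]] U[OF ST(1)] U[OF ST(2)]] c U[OF ST(1)] by simp
  qed
next
  assume c: "cut_le K (\<lambda>i. measure unit_leb {x\<in>{0..1}. p x = i}) m c"
  have le: "measure unit_leb {x\<in>S. p x = i} \<le> measure unit_leb {x\<in>{0..1}. p x = i}" if "i \<in> K" "S \<in> sets unit_leb" for S i
    using meas[OF that(1)] that(2) by (intro unit_leb.finite_measure_mono) (auto simp: sets_unit_leb)
  have rle: "\<bar>rect_int W S T\<bar> \<le> c" if "S \<in> sets unit_leb" "T \<in> sets unit_leb" for S T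
  proof -
    have "rect_int W S T = (\<Sum>i\<in>K. \<Sum>j\<in>K. measure unit_leb {x\<in>S. p x = i} * measure unit_leb {x\<in>T. p x = j} * m i j)"
      using K p meas W that by (rule rect_int_step(1))
    also have "\<bar>\<dots>\<bar> \<le> c"
      by (rule cut_le_fractional[OF K c]; intro conjI measure_nonneg le that; assumption)
    finally show ?thesis .
  qed
  show "cut_norm W \<le> c" by (rule cut_norm_le[OF rle])
qed

subsection \<open>Overlays induced by measure preserving bijections\<close>

lemma mp_bijections_range:
  "\<nu> \<in> mp_bijections \<Longrightarrow> 0 \<le> x \<Longrightarrow> x \<le> 1 \<Longrightarrow> 0 \<le> \<nu> x \<and> \<nu> x \<le> 1"
  using mp_bijectionsD(4)[of \<nu> x] by simp

definition vlab :: "wgraph \<Rightarrow> real \<Rightarrow> nat" where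
  "vlab G x = (THE i. i \<in> verts G \<and> x \<in> vertex_interval G i)"

lemma vlab:
  assumes "G \<in> wgraphs" "x \<in> {0..1}"
  shows "vlab G x \<in> verts G" "x \<in> vertex_interval G (vlab G x)"
proof -
  have "\<exists>!i. i \<in> verts G \<and> x \<in> vertex_interval G i"
    using vertex_interval_cover[OF assms] vertex_interval_disjoint[OF assms(1)] by blast
  from theI'[OF this] show "vlab G x \<in> verts G" "x \<in> vertex_interval G (vlab G x)"
    unfolding vlab_def by auto
qed

lemma vlab_eqI:
  assumes "G \<in> wgraphs" "i \<in> verts G" "x \<in> vertex_interval G i"
  shows "vlab G x = i"
  unfolding vlab_def using assms vertex_interval_disjoint[OF assms(1)] by (intro the_equality) blast+

lemma graphon_of_vlab:
  assumes "G \<in> wgraphs" "x \<in> {0..1}" "y \<in> {0..1}"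
  shows "graphon_of G x y = eweight G (vlab G x) (vlab G y)"
  using assms by (intro graphon_of_eq vlab)

definition cumw :: "wgraph \<Rightarrow> nat \<Rightarrow> real" where
  "cumw G m = (\<Sum>j=1..m. nweight G j)"

lemma vertex_interval_cumw:
  "vertex_interval G i = {cumw G (i - 1)<..cumw G i} \<union> (if i = 1 then {0} else {})"
  by (simp add: vertex_interval_def cumw_def nweight_def sum_divide_distrib)

lemma cumw_mono: "G \<in> wgraphs \<Longrightarrow> m \<le> n \<Longrightarrow> cumw G m \<le> cumw G n"
  unfolding cumw_def by (intro sum_mono2) (auto intro: nweight_nonneg)

lemma cumw_bounds:
  assumes G: "G \<in> wgraphs"
  shows "cumw G 0 = 0" "cumw G (nverts G) = 1" "0 \<le> cumw G m" "m \<le> nverts G \<Longrightarrow> cumw G m \<le> 1"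
proof -
  show 0: "cumw G 0 = 0" by (simp add: cumw_def)
  show 1: "cumw G (nverts G) = 1" using sum_nweight[OF G] by (simp add: cumw_def verts_def)
  show "0 \<le> cumw G m" using cumw_mono[OF G, of 0 m] 0 by simp
  show "m \<le> nverts G \<Longrightarrow> cumw G m \<le> 1" using cumw_mono[OF G, of m "nverts G"] 1 by simp
qed

lemma cumw_step: "i \<in> verts G \<Longrightarrow> cumw G i = cumw G (i - 1) + nweight G i"
  by (cases i) (auto simp: cumw_def verts_def)

lemma vlab_level:
  assumes "G \<in> wgraphs" "i \<in> verts G"
  shows "{x\<in>{0..1}. vlab G x = i} = vertex_interval G i"
proof -
  have "vertex_interval G i \<subseteq> {0..1}"
    using cumw_bounds(3)[OF assms(1), of "i - 1"] cumw_bounds(4)[OF assms(1), of i] assms(2)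
    unfolding vertex_interval_cumw verts_def by auto
  then show ?thesis using vlab[OF assms(1)] vlab_eqI[OF assms] by blast
qed

lemma vertex_interval_measure:
  assumes "G \<in> wgraphs" "i \<in> verts G"
  shows "vertex_interval G i \<in> sets unit_leb" "measure unit_leb (vertex_interval G i) = nweight G i"
proof -
  have sub: "vertex_interval G i \<subseteq> {0..1}" using vlab_level[OF assms] by blast
  have b: "vertex_interval G i \<in> sets borel" by (simp add: vertex_interval_cumw)
  then show s: "vertex_interval G i \<in> sets unit_leb" using sub by (simp add: sets_unit_leb)
  have "measure unit_leb (vertex_interval G i) = measure lebesgue (vertex_interval G i)"
    using sub by (intro measure_restrict_space) auto
  also have "\<dots> = measure lborel (vertex_interval G i)" using b by simp
  also have "\<dots> = measure lborel {cumw G (i - 1)<..cumw G i}"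
  proof -
    have "(if i = 1 then {0::real} else {}) \<in> null_sets lborel" by auto
    then show ?thesis unfolding vertex_interval_cumw by (intro measure_Un_null_set) auto
  qed
  also have "\<dots> = nweight G i"
    using cumw_step[OF assms(2)] nweight_nonneg[OF assms(1), of i] by simp
  finally show "measure unit_leb (vertex_interval G i) = nweight G i" .
qed

text \<open>The level sets form the common refinement of the partition for \<open>G\<close> and the
  preimage under \<nu> of the partition for \<open>H\<close>. Their measures are the coupling
  induced by \<nu>.\<close>

definition overlay_label :: "wgraph \<Rightarrow> wgraph \<Rightarrow> (real \<Rightarrow> real) \<Rightarrow> real \<Rightarrow> nat \<times> nat" where
  "overlay_label G H \<nu> x = (vlab G x, vlab H (\<nu> x))"

abbreviation overlay_kernel :: "wgraph \<Rightarrow> wgraph \<Rightarrow> nat \<times> nat \<Rightarrow> nat \<times> nat \<Rightarrow> real" where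
  "overlay_kernel G H \<equiv> \<lambda>p q. eweight G (fst p) (fst q) - eweight H (snd p) (snd q)"

lemma overlay_label_in:
  assumes "G \<in> wgraphs" "H \<in> wgraphs" "\<nu> \<in> mp_bijections" "x \<in> {0..1}"
  shows "overlay_label G H \<nu> x \<in> verts G \<times> verts H"
  using assms mp_bijectionsD(4)[OF assms(3)] vlab(1) by (simp add: overlay_label_def)

lemma overlay_label_level:
  assumes G: "G \<in> wgraphs" and H: "H \<in> wgraphs" and n: "\<nu> \<in> mp_bijections" and p: "p \<in> verts G \<times> verts H"
  shows "{x\<in>{0..1}. overlay_label G H \<nu> x = p} = vertex_interval G (fst p) \<inter> (\<nu> -` vertex_interval H (snd p) \<inter> {0..1})"
    and "{x\<in>{0..1}. overlay_label G H \<nu> x = p} \<in> sets unit_leb"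
proof -
  have "{x\<in>{0..1}. overlay_label G H \<nu> x = p} = {x\<in>{0..1}. vlab G x = fst p} \<inter> (\<nu> -` {x\<in>{0..1}. vlab H x = snd p} \<inter> {0..1})"
    by (auto simp: overlay_label_def mp_bijections_range[OF n])
  then show eq: "{x\<in>{0..1}. overlay_label G H \<nu> x = p} = vertex_interval G (fst p) \<inter> (\<nu> -` vertex_interval H (snd p) \<inter> {0..1})"
    using p unfolding mem_Times_iff by (simp only: vlab_level[OF G] vlab_level[OF H])
  show "{x\<in>{0..1}. overlay_label G H \<nu> x = p} \<in> sets unit_leb"
  proof -
    have "fst p \<in> verts G" "snd p \<in> verts H" using p by (auto simp: mem_Times_iff)
    then show ?thesis
      unfolding eq using vertex_interval_measure(1)[OF G] vertex_interval_measure(1)[OF H]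
        measurable_sets[OF mp_bijectionsD(1)[OF n], of "vertex_interval H (snd p)"]
      by (simp only: space_lebesgue_on sets.Int)
  qed
qed

lemma graphon_difference_step:
  assumes G: "G \<in> wgraphs" and H: "H \<in> wgraphs" and n: "\<nu> \<in> mp_bijections" and "x \<in> {0..1}" "y \<in> {0..1}"
  shows "graphon_of G x y - graphon_of H (\<nu> x) (\<nu> y)
    = overlay_kernel G H (overlay_label G H \<nu> x) (overlay_label G H \<nu> y)"
  using assms mp_bijectionsD(4)[OF n] by (simp add: graphon_of_vlab overlay_label_def)

lemma cut_norm_overlay_iff:
  assumes G: "G \<in> wgraphs" and H: "H \<in> wgraphs" and n: "\<nu> \<in> mp_bijections"
  shows "cut_norm (\<lambda>x y. graphon_of G x y - graphon_of H (\<nu> x) (\<nu> y)) \<le> c \<longleftrightarrow>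
    cut_le (verts G \<times> verts H) (\<lambda>p. measure unit_leb {x\<in>{0..1}. overlay_label G H \<nu> x = p}) (overlay_kernel G H) c"
  by (rule cut_norm_step_le_iff)
     (use overlay_label_in[OF G H n] overlay_label_level[OF G H n] graphon_difference_step[OF G H n] in auto)

lemma cut_norm_overlay_pull:
  assumes G: "G \<in> wgraphs" and H: "H \<in> wgraphs" and n: "\<nu> \<in> mp_bijections" and m: "\<mu> \<in> mp_bijections"
  shows "cut_norm (\<lambda>x y. graphon_of G (\<mu> x) (\<mu> y) - graphon_of H (\<nu> (\<mu> x)) (\<nu> (\<mu> y)))
    \<le> cut_norm (\<lambda>x y. graphon_of G x y - graphon_of H (\<nu> x) (\<nu> y))"
proof -
  let ?K = "verts G \<times> verts H"
  let ?p = "\<lambda>x. overlay_label G H \<nu> (\<mu> x)"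
  note M = mp_bijectionsD[OF m]
  have eq: "{x\<in>{0..1}. ?p x = i} = \<mu> -` {x\<in>{0..1}. overlay_label G H \<nu> x = i} \<inter> space unit_leb" for i
    by (auto simp: mp_bijections_range[OF m])
  have meas: "{x\<in>{0..1}. ?p x = i} \<in> sets unit_leb" if "i \<in> ?K" for i
    unfolding eq by (rule measurable_sets[OF M(1) overlay_label_level(2)[OF G H n that]])
  have same: "measure unit_leb {x\<in>{0..1}. ?p x = i} = measure unit_leb {x\<in>{0..1}. overlay_label G H \<nu> x = i}" if "i \<in> ?K" for i
    unfolding eq using measure_distr[OF M(1) overlay_label_level(2)[OF G H n that]] unfolding M(2) by simp
  have "cut_norm (\<lambda>x y. graphon_of G (\<mu> x) (\<mu> y) - graphon_of H (\<nu> (\<mu> x)) (\<nu> (\<mu> y))) \<le> c \<longleftrightarrow>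
    cut_le ?K (\<lambda>i. measure unit_leb {x\<in>{0..1}. ?p x = i}) (overlay_kernel G H) c" for c
    by (rule cut_norm_step_le_iff)
       (use overlay_label_in[OF G H n] meas graphon_difference_step[OF G H n] in \<open>auto simp: mp_bijections_range[OF m]\<close>)
  also have "\<dots> c \<longleftrightarrow> cut_le ?K (\<lambda>p. measure unit_leb {x\<in>{0..1}. overlay_label G H \<nu> x = p}) (overlay_kernel G H) c" for c
    by (rule cut_le_cong) (use same in auto)
  finally show ?thesis using cut_norm_overlay_iff[OF G H n] by blast
qed

lemma overlay_coupling:
  assumes G: "G \<in> wgraphs" and H: "H \<in> wgraphs" and n: "\<nu> \<in> mp_bijections"
  shows "coupling (verts G) (verts H) (nweight G) (nweight H) (\<lambda>p. measure unit_leb {x\<in>{0..1}. overlay_label G H \<nu> x = p})"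
proof -
  let ?A = "\<lambda>p. {x\<in>{0..1}. overlay_label G H \<nu> x = p}"
  note N = mp_bijectionsD[OF n]
  have disj: "disjoint_family_on (\<lambda>u. ?A (i, u)) B" "disjoint_family_on (\<lambda>u. ?A (u, i)) B" for i B
    by (auto simp: disjoint_family_on_def)
  have "(\<Sum>u\<in>verts H. measure unit_leb (?A (i, u))) = nweight G i" if i: "i \<in> verts G" for i
  proof -
    have "(\<Sum>u\<in>verts H. measure unit_leb (?A (i, u))) = measure unit_leb (\<Union>u\<in>verts H. ?A (i, u))"
      using overlay_label_level(2)[OF G H n] i
      by (intro unit_leb.finite_measure_finite_Union[symmetric] disj) auto
    also have "(\<Union>u\<in>verts H. ?A (i, u)) = {x\<in>{0..1}. vlab G x = i}"
      by (auto simp: overlay_label_def vlab(1)[OF H] mp_bijections_range[OF n])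
    finally show ?thesis unfolding vlab_level[OF G i] vertex_interval_measure(2)[OF G i] .
  qed
  moreover have "(\<Sum>i\<in>verts G. measure unit_leb (?A (i, u))) = nweight H u" if u: "u \<in> verts H" for u
  proof -
    have "(\<Sum>i\<in>verts G. measure unit_leb (?A (i, u))) = measure unit_leb (\<Union>i\<in>verts G. ?A (i, u))"
      using overlay_label_level(2)[OF G H n] u
      by (intro unit_leb.finite_measure_finite_Union[symmetric] disj) auto
    also have "(\<Union>i\<in>verts G. ?A (i, u)) = \<nu> -` {x\<in>{0..1}. vlab H x = u} \<inter> space unit_leb"
      unfolding space_lebesgue_on by (auto simp: overlay_label_def vlab(1)[OF G] mp_bijections_range[OF n])
    also have "\<dots> = \<nu> -` vertex_interval H u \<inter> space unit_leb" unfolding vlab_level[OF H u] ..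
    also have "measure unit_leb \<dots> = nweight H u"
      using measure_distr[OF N(1) vertex_interval_measure(1)[OF H u]] vertex_interval_measure(2)[OF H u] unfolding N(2) by simp
    finally show ?thesis .
  qed
  ultimately show ?thesis by (auto simp: coupling_def)
qed

lemma overlay_le_cut_norm:
  assumes "G \<in> wgraphs" "H \<in> wgraphs" "\<nu> \<in> mp_bijections"
    "cut_norm (\<lambda>x y. graphon_of G x y - graphon_of H (\<nu> x) (\<nu> y)) \<le> c"
  shows "overlay_le G H c"
  unfolding overlay_le_def using overlay_coupling[OF assms(1-3)] assms(4)[unfolded cut_norm_overlay_iff[OF assms(1-3)]] by blast

section \<open>The cut distance and its triangle inequality for graphs\<close>

lemma kernel_graphon_diff:
  assumes "W \<in> graphons" "U \<in> graphons" "\<nu> \<in> mp_bijections"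
  shows "kernel (\<lambda>x y. W x y - U (\<nu> x) (\<nu> y))"
  using kernel_diff[OF kernel_graphon[OF assms(1)] kernel_graphon[OF graphons_pull[OF assms(2,3)]]] .

lemma cut_dist_lessE:
  assumes "W \<in> graphons" "U \<in> graphons" "cut_dist W U < c"
  obtains \<nu> where "\<nu> \<in> mp_bijections" "cut_norm (\<lambda>x y. W x y - U (\<nu> x) (\<nu> y)) < c"
proof -
  have "bdd_below ((\<lambda>\<nu>. cut_norm (\<lambda>x y. W x y - U (\<nu> x) (\<nu> y))) ` mp_bijections)"
    using cut_norm_nonneg[OF kernel_graphon_diff[OF assms(1,2)]] by (intro bdd_belowI[of _ 0]) auto
  then show thesis using that assms(3) id_mp_bijections
    unfolding cut_dist_def by (subst (asm) cINF_less_iff) auto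
qed

lemma cut_dist_le:
  assumes "W \<in> graphons" "U \<in> graphons" "\<nu> \<in> mp_bijections"
  shows "cut_dist W U \<le> cut_norm (\<lambda>x y. W x y - U (\<nu> x) (\<nu> y))"
  unfolding cut_dist_def
  using cut_norm_nonneg[OF kernel_graphon_diff[OF assms(1,2)]] assms(3)
  by (intro cINF_lower bdd_belowI[of _ 0]) auto

lemma cut_dist_nonneg:
  assumes "W \<in> graphons" "U \<in> graphons"
  shows "0 \<le> cut_dist W U"
  unfolding cut_dist_def using cut_norm_nonneg[OF kernel_graphon_diff[OF assms]] id_mp_bijections
  by (intro cINF_greatest) auto

lemma overlay_le_cut_dist:
  assumes "G \<in> wgraphs" "H \<in> wgraphs" "wgraph_cut_dist G H < c"
  shows "overlay_le G H c"
proof -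
  obtain \<nu> where "\<nu> \<in> mp_bijections" "cut_norm (\<lambda>x y. graphon_of G x y - graphon_of H (\<nu> x) (\<nu> y)) < c"
    using graphon_of_in_graphons[OF assms(1)] graphon_of_in_graphons[OF assms(2)] assms(3)[unfolded wgraph_cut_dist_def]
    by (rule cut_dist_lessE)
  then show ?thesis using overlay_le_cut_norm[OF assms(1,2)] by simp
qed

text \<open>The difference of \<open>H\<close> and \<open>K\<close> must be pulled back along \<nu>
  to fit the first one; \<open>overlay_cut_norm_pull\<close> then removes \<nu> again.\<close>

lemma overlay_cut_norm_triangle:
  assumes G: "G \<in> wgraphs" and H: "H \<in> wgraphs" and K: "K \<in> wgraphs" and n: "\<nu> \<in> mp_bijections" and m: "\<mu> \<in> mp_bijections"
  shows "cut_norm (\<lambda>x y. graphon_of G x y - graphon_of K (\<mu> (\<nu> x)) (\<mu> (\<nu> y)))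
    \<le> cut_norm (\<lambda>x y. graphon_of G x y - graphon_of H (\<nu> x) (\<nu> y)) + cut_norm (\<lambda>x y. graphon_of H x y - graphon_of K (\<mu> x) (\<mu> y))"
proof -
  note ker = kernel_graphon[OF graphons_pull[OF graphon_of_in_graphons]]
  have "cut_norm (\<lambda>x y. graphon_of G x y - graphon_of K (\<mu> (\<nu> x)) (\<mu> (\<nu> y)))
    \<le> cut_norm (\<lambda>x y. graphon_of G x y - graphon_of H (\<nu> x) (\<nu> y))
      + cut_norm (\<lambda>x y. graphon_of H (\<nu> x) (\<nu> y) - graphon_of K (\<mu> (\<nu> x)) (\<mu> (\<nu> y)))"
    by (rule cut_norm_triangle[OF kernel_graphon[OF graphon_of_in_graphons[OF G]] ker[OF H n] ker[OF K mp_bijections_comp[OF m n]]])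
  then show ?thesis using cut_norm_overlay_pull[OF H K m n] by linarith
qed

lemma wgraph_cut_dist_triangle:
  assumes G: "G \<in> wgraphs" and H: "H \<in> wgraphs" and K: "K \<in> wgraphs"
  shows "wgraph_cut_dist G K \<le> wgraph_cut_dist G H + wgraph_cut_dist H K"
proof (rule field_le_epsilon)
  fix e :: real assume e: "0 < e"
  note g = graphon_of_in_graphons
  obtain \<nu> where n: "\<nu> \<in> mp_bijections" "cut_norm (\<lambda>x y. graphon_of G x y - graphon_of H (\<nu> x) (\<nu> y)) < wgraph_cut_dist G H + e/2"
    using cut_dist_lessE[OF g[OF G] g[OF H], of "wgraph_cut_dist G H + e/2"] e unfolding wgraph_cut_dist_def by auto
  obtain \<mu> where m: "\<mu> \<in> mp_bijections" "cut_norm (\<lambda>x y. graphon_of H x y - graphon_of K (\<mu> x) (\<mu> y)) < wgraph_cut_dist H K + e/2"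
    using cut_dist_lessE[OF g[OF H] g[OF K], of "wgraph_cut_dist H K + e/2"] e unfolding wgraph_cut_dist_def by auto
  have "wgraph_cut_dist G K \<le> cut_norm (\<lambda>x y. graphon_of G x y - graphon_of K (\<mu> (\<nu> x)) (\<mu> (\<nu> y)))"
    unfolding wgraph_cut_dist_def by (rule cut_dist_le[OF g[OF G] g[OF K] mp_bijections_comp[OF m(1) n(1)]])
  also have "\<dots> < wgraph_cut_dist G H + e/2 + (wgraph_cut_dist H K + e/2)"
    using overlay_cut_norm_triangle[OF G H K n(1) m(1)] n(2) m(2) by linarith
  finally show "wgraph_cut_dist G K \<le> wgraph_cut_dist G H + wgraph_cut_dist H K + e" by simp
qed

subsection \<open>Realising couplings by interval exchanges\<close>

lemma measure_unit_leb: "A \<subseteq> {0..1} \<Longrightarrow> measure unit_leb A = measure lebesgue A"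
  by (rule measure_restrict_space) auto

text \<open>Each piece of the first tiling of \<open>{0<..1}\<close> is translated onto the piece of
  the second tiling with the same index and length. Pieces of length 0 are empty, and the point 0,
  which lies in no piece, is fixed.\<close>

lemma interval_exchange:
  fixes a b X :: "'k \<Rightarrow> real"
  assumes K: "finite K"
    and A: "\<And>x. 0 < x \<Longrightarrow> x \<le> 1 \<Longrightarrow> \<exists>!p. p \<in> K \<and> x \<in> {a p<..a p + X p}"
    and B: "\<And>x. 0 < x \<Longrightarrow> x \<le> 1 \<Longrightarrow> \<exists>!p. p \<in> K \<and> x \<in> {b p<..b p + X p}"
    and A01: "\<And>p. p \<in> K \<Longrightarrow> {a p<..a p + X p} \<subseteq> {0<..1}"
    and B01: "\<And>p. p \<in> K \<Longrightarrow> {b p<..b p + X p} \<subseteq> {0<..1}"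
  shows "\<exists>\<nu>\<in>mp_bijections. \<forall>p\<in>K. \<forall>x\<in>{a p<..a p + X p}. \<nu> x = x - a p + b p"
proof -
  define la where "la = (\<lambda>x. THE p. p \<in> K \<and> x \<in> {a p<..a p + X p})"
  define lb where "lb = (\<lambda>x. THE p. p \<in> K \<and> x \<in> {b p<..b p + X p})"
  define \<nu> where "\<nu> = (\<lambda>x. if x = 0 then 0 else x - a (la x) + b (la x))"
  define \<nu>' where "\<nu>' = (\<lambda>x. if x = 0 then 0 else x - b (lb x) + a (lb x))"
  have la: "la x = p" if "p \<in> K" "x \<in> {a p<..a p + X p}" for x p
  proof -
    have "0 < x" "x \<le> 1" using A01[OF that(1)] that(2) by auto
    from A[OF this] show ?thesis unfolding la_def by (rule the1_equality) (use that in blast)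
  qed
  have lb: "lb x = p" if "p \<in> K" "x \<in> {b p<..b p + X p}" for x p
  proof -
    have "0 < x" "x \<le> 1" using B01[OF that(1)] that(2) by auto
    from B[OF this] show ?thesis unfolding lb_def by (rule the1_equality) (use that in blast)
  qed
  have nu: "\<nu> x = x - a p + b p" if "p \<in> K" "x \<in> {a p<..a p + X p}" for x p
    using la[OF that] A01[OF that(1)] that by (auto simp: \<nu>_def)
  have nu': "\<nu>' x = x - b p + a p" if "p \<in> K" "x \<in> {b p<..b p + X p}" for x p
    using lb[OF that] B01[OF that(1)] that by (auto simp: \<nu>'_def)
  have nu01: "\<nu> x \<in> {0..1} \<and> \<nu>' (\<nu> x) = x" if x01: "x \<in> {0..1}" for x
  proof (cases "x = 0")
    case True
    then show ?thesis by (simp add: \<nu>_def \<nu>'_def)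
  next
    case False
    then obtain p where p: "p \<in> K" "x \<in> {a p<..a p + X p}" using A[of x] x01 by auto
    have v: "\<nu> x \<in> {b p<..b p + X p}" using nu[OF p] p by auto
    then have "\<nu> x \<in> {0<..1}" using B01[OF p(1)] by blast
    then show ?thesis using nu[OF p] nu'[OF p(1) v] by auto
  qed
  have nu'01: "\<nu>' x \<in> {0..1} \<and> \<nu> (\<nu>' x) = x" if x01: "x \<in> {0..1}" for x
  proof (cases "x = 0")
    case True
    then show ?thesis by (simp add: \<nu>_def \<nu>'_def)
  next
    case False
    then obtain p where p: "p \<in> K" "x \<in> {b p<..b p + X p}" using B[of x] x01 by auto
    have v: "\<nu>' x \<in> {a p<..a p + X p}" using nu'[OF p] p by auto
    then have "\<nu>' x \<in> {0<..1}" using A01[OF p(1)] by blast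
    then show ?thesis using nu'[OF p] nu[OF p(1) v] by auto
  qed
  have bij: "bij_betw \<nu> {0..1} {0..1}"
  proof (rule bij_betw_byWitness[where f'=\<nu>'])
    show "\<forall>x\<in>{0..1}. \<nu>' (\<nu> x) = x" "\<forall>x\<in>{0..1}. \<nu> (\<nu>' x) = x" using nu01 nu'01 by blast+
    show "\<nu> ` {0..1} \<subseteq> {0..1}" "\<nu>' ` {0..1} \<subseteq> {0..1}" using nu01 nu'01 by blast+
  qed
  \<comment> \<open>Up to the point 0 a preimage is a finite union of translates, so translation
    invariance will give its measurability and its measure.\<close>
  have pre: "\<nu> -` S \<inter> {0..1} = (S \<inter> {0}) \<union> (\<Union>p\<in>K. (+) (a p - b p) ` (S \<inter> {b p<..b p + X p}))" if "S \<subseteq> {0..1}" for S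
  proof (intro set_eqI iffI)
    fix x assume x: "x \<in> \<nu> -` S \<inter> {0..1}"
    show "x \<in> (S \<inter> {0}) \<union> (\<Union>p\<in>K. (+) (a p - b p) ` (S \<inter> {b p<..b p + X p}))"
    proof (cases "x = 0")
      case True
      then show ?thesis using x by (simp add: \<nu>_def)
    next
      case False
      then obtain p where p: "p \<in> K" "x \<in> {a p<..a p + X p}" using A[of x] x by auto
      have "x = (a p - b p) + \<nu> x" "\<nu> x \<in> S \<inter> {b p<..b p + X p}" using nu[OF p] p x by auto
      then show ?thesis using p(1) by blast
    qed
  next
    fix x assume "x \<in> (S \<inter> {0}) \<union> (\<Union>p\<in>K. (+) (a p - b p) ` (S \<inter> {b p<..b p + X p}))"
    then consider "x = 0" "0 \<in> S" | p y where "p \<in> K" "y \<in> S" "y \<in> {b p<..b p + X p}" "x = a p - b p + y" by blast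
    then show "x \<in> \<nu> -` S \<inter> {0..1}"
    proof cases
      case 1
      then show ?thesis by (simp add: \<nu>_def)
    next
      case (2 p y)
      then have x: "x \<in> {a p<..a p + X p}" by auto
      have "\<nu> x = y" using nu[OF 2(1) x] 2 by simp
      moreover have "x \<in> {0<..1}" using A01[OF 2(1)] x by (rule subsetD)
      ultimately show ?thesis using 2(2) by simp
    qed
  qed
  have main: "\<nu> -` S \<inter> {0..1} \<in> sets unit_leb \<and> measure unit_leb (\<nu> -` S \<inter> {0..1}) = measure unit_leb S"
    if S: "S \<in> sets unit_leb" for S
  proof -
    have S': "S \<in> sets lebesgue" "S \<subseteq> {0..1}" using S by (auto simp: sets_unit_leb)
    define P where "P = (\<lambda>p. S \<inter> {b p<..b p + X p})"
    define Q where "Q = (\<lambda>p. (+) (a p - b p) ` P p)"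
    have P: "P p \<in> sets unit_leb" if "p \<in> K" for p
      using S' by (auto simp: P_def sets_unit_leb)
    have Qsub: "Q p \<subseteq> {a p<..a p + X p}" for p by (auto simp: Q_def P_def)
    have Q: "Q p \<in> sets unit_leb" if "p \<in> K" for p
    proof -
      have "Q p \<in> sets lebesgue" unfolding Q_def using P[OF that] by (intro lebesgue_sets_translation) (simp add: sets_unit_leb)
      moreover have "Q p \<subseteq> {0..1}" using Qsub[of p] A01[OF that] by auto
      ultimately show ?thesis by (simp add: sets_unit_leb)
    qed
    have QP: "measure unit_leb (Q p) = measure unit_leb (P p)" if "p \<in> K" for p
    proof -
      have "Q p \<subseteq> {0..1}" "P p \<subseteq> {0..1}" using Q[OF that] P[OF that] by (auto simp: sets_unit_leb)
      then show ?thesis by (simp add: measure_unit_leb Q_def measure_translation)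
    qed
    have dQ: "disjoint_family_on Q K"
      unfolding disjoint_family_on_def
    proof (intro ballI impI)
      fix p q assume "p \<in> K" "q \<in> K" "p \<noteq> q"
      then show "Q p \<inter> Q q = {}" using Qsub[of p] Qsub[of q] la by blast
    qed
    have dP: "disjoint_family_on P K"
      unfolding disjoint_family_on_def
    proof (intro ballI impI)
      fix p q assume "p \<in> K" "q \<in> K" "p \<noteq> q"
      then show "P p \<inter> P q = {}" using lb unfolding P_def by blast
    qed
    have z: "S \<inter> {0} \<in> null_sets unit_leb"
    proof -
      have "{0::real} \<in> null_sets lebesgue" by (intro null_sets_completionI) auto
      then have "S \<inter> {0} \<in> null_sets lebesgue" by (rule null_sets_completion_subset[rotated]) auto
      then show ?thesis using S'(2) by (subst null_sets_restrict_space) auto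
    qed
    have UQ: "(\<Union>p\<in>K. Q p) \<in> sets unit_leb" using Q K by (intro sets.finite_UN) auto
    have UP: "(\<Union>p\<in>K. P p) \<in> sets unit_leb" using P K by (intro sets.finite_UN) auto
    have eqS: "S = (\<Union>p\<in>K. P p) \<union> (S \<inter> {0})"
    proof -
      have "x \<in> (\<Union>p\<in>K. P p)" if "x \<in> S" "x \<noteq> 0" for x
        using B[of x] S'(2) that unfolding P_def by force
      then show ?thesis unfolding P_def by auto
    qed
    have eqQ: "\<nu> -` S \<inter> {0..1} = (\<Union>p\<in>K. Q p) \<union> (S \<inter> {0})"
      using pre[OF S'(2)] unfolding Q_def P_def by (simp add: Un_commute)
    have "measure unit_leb (\<nu> -` S \<inter> {0..1}) = measure unit_leb (\<Union>p\<in>K. Q p)"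
      unfolding eqQ by (rule measure_Un_null_set[OF UQ z])
    also have "\<dots> = (\<Sum>p\<in>K. measure unit_leb (Q p))"
      using Q K by (intro unit_leb.finite_measure_finite_Union dQ) auto
    also have "\<dots> = (\<Sum>p\<in>K. measure unit_leb (P p))" using QP by simp
    also have "\<dots> = measure unit_leb (\<Union>p\<in>K. P p)"
      using P K by (intro unit_leb.finite_measure_finite_Union[symmetric] dP) auto
    also have "\<dots> = measure unit_leb ((\<Union>p\<in>K. P p) \<union> (S \<inter> {0}))"
      by (rule measure_Un_null_set[OF UP z, symmetric])
    finally have "measure unit_leb (\<nu> -` S \<inter> {0..1}) = measure unit_leb S" using eqS by simp
    moreover have "\<nu> -` S \<inter> {0..1} \<in> sets unit_leb" unfolding eqQ using UQ z by auto
    ultimately show ?thesis by blast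
  qed
  have mn: "\<nu> \<in> unit_leb \<rightarrow>\<^sub>M unit_leb"
    by (rule measurableI) (use nu01 main in auto)
  have "distr unit_leb unit_leb \<nu> = unit_leb"
  proof (rule measure_eqI)
    fix S assume "S \<in> sets (distr unit_leb unit_leb \<nu>)"
    then have S: "S \<in> sets unit_leb" by simp
    show "emeasure (distr unit_leb unit_leb \<nu>) S = emeasure unit_leb S"
      using main[OF S] by (simp add: emeasure_distr[OF mn S] unit_leb.emeasure_eq_measure)
  qed simp
  then have "\<nu> \<in> mp_bijections" using bij mn by (simp add: mp_bijections_def)
  then show ?thesis using nu by blast
qed

lemma cumulative_interval_ex1:
  fixes w :: "nat \<Rightarrow> real"
  assumes w: "\<And>j. 0 \<le> w j" and x: "c < x" "x \<le> c + (\<Sum>j=1..n. w j)"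
  shows "\<exists>j\<in>{1..n}. x \<in> {c + (\<Sum>i=1..j-1. w i)<..c + (\<Sum>i=1..j-1. w i) + w j}"
  using x
proof (induction n)
  case 0
  then show ?case by simp
next
  case (Suc n)
  show ?case
  proof (cases "x \<le> c + (\<Sum>j=1..n. w j)")
    case True
    then obtain j where "j \<in> {1..n}" "x \<in> {c + (\<Sum>i=1..j-1. w i)<..c + (\<Sum>i=1..j-1. w i) + w j}" using Suc by blast
    then show ?thesis by (intro bexI[of _ j]) auto
  next
    case False
    then show ?thesis using Suc.prems by (intro bexI[of _ "Suc n"]) auto
  qed
qed

lemma cumulative_interval_unique:
  fixes w :: "nat \<Rightarrow> real"
  assumes w: "\<And>j. 0 \<le> w j" and j: "1 \<le> j" "1 \<le> k"
    and x: "x \<in> {c + (\<Sum>i=1..j-1. w i)<..c + (\<Sum>i=1..j-1. w i) + w j}" "x \<in> {c + (\<Sum>i=1..k-1. w i)<..c + (\<Sum>i=1..k-1. w i) + w k}"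
  shows "j = k"
proof -
  have False if "1 \<le> j" "j < k" "x \<le> c + (\<Sum>i=1..j-1. w i) + w j" "c + (\<Sum>i=1..k-1. w i) < x" for j k
  proof -
    have "(\<Sum>i=1..j-1. w i) + w j = (\<Sum>i=1..j. w i)" using that(1) by (cases j) auto
    also have "\<dots> \<le> (\<Sum>i=1..k-1. w i)" using w that by (intro sum_mono2) auto
    finally show False using that by linarith
  qed
  then show ?thesis using j x by (metis greaterThanAtMost_iff linorder_neqE_nat)
qed

lemma cumulative_interval_subset:
  fixes w :: "nat \<Rightarrow> real"
  assumes w: "\<And>j. 0 \<le> w j" and j: "j \<in> {1..n}"
  shows "{c + (\<Sum>i=1..j-1. w i)<..c + (\<Sum>i=1..j-1. w i) + w j} \<subseteq> {c<..c + (\<Sum>i=1..n. w i)}"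
proof -
  have "(\<Sum>i=1..j-1. w i) + w j = (\<Sum>i=1..j. w i)" using j by (cases j) auto
  also have "\<dots> \<le> (\<Sum>i=1..n. w i)" using w j by (intro sum_mono2) auto
  finally have "(\<Sum>i=1..j-1. w i) + w j \<le> (\<Sum>i=1..n. w i)" .
  moreover have "0 \<le> (\<Sum>i=1..j-1. w i)" using w by (intro sum_nonneg) auto
  ultimately show ?thesis by auto
qed

text \<open>The interval of vertex \<open>i\<close> is cut into consecutive pieces of lengths
  \<open>X i u\<close>. They fill it because the row sums of \<open>X\<close> are the vertex
  weights, so the pieces for all pairs tile \<open>{0<..1}\<close>.\<close>

lemma nested_intervals:
  assumes G: "G \<in> wgraphs" and n: "verts H = {1..n}" and X: "\<And>i u. 0 \<le> X i u"
    and row: "\<And>i. i \<in> verts G \<Longrightarrow> (\<Sum>u\<in>verts H. X i u) = nweight G i"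
  defines "J \<equiv> \<lambda>i u. {cumw G (i - 1) + (\<Sum>u'=1..u-1. X i u')<..cumw G (i - 1) + (\<Sum>u'=1..u-1. X i u') + X i u}"
  shows "\<And>i u. i \<in> verts G \<Longrightarrow> u \<in> verts H \<Longrightarrow> J i u \<subseteq> vertex_interval G i \<inter> {0<..1}"
    and "\<And>x. 0 < x \<Longrightarrow> x \<le> 1 \<Longrightarrow> \<exists>!p. p \<in> verts G \<times> verts H \<and> x \<in> J (fst p) (snd p)"
proof -
  have VI: "vertex_interval G i \<inter> {0<..} = {cumw G (i - 1)<..cumw G (i - 1) + nweight G i}" if "i \<in> verts G" for i
    using cumw_step[OF that] cumw_bounds(3)[OF G, of "i - 1"] by (auto simp: vertex_interval_cumw)
  have VI1: "vertex_interval G i \<subseteq> {0..1}" if "i \<in> verts G" for i using vlab_level[OF G that] by blast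
  show sub: "J i u \<subseteq> vertex_interval G i \<inter> {0<..1}" if "i \<in> verts G" "u \<in> verts H" for i u
  proof -
    have "J i u \<subseteq> {cumw G (i - 1)<..cumw G (i - 1) + nweight G i}"
      unfolding J_def row[OF that(1), symmetric] n using that(2) n cumulative_interval_subset[of "X i" u n "cumw G (i - 1)"] X by simp
    then show ?thesis using VI[OF that(1)] VI1[OF that(1)] by fastforce
  qed
  fix x :: real assume x: "0 < x" "x \<le> 1"
  then have x01: "x \<in> {0..1}" by simp
  let ?i = "vlab G x"
  note v = vlab[OF G x01]
  have "x \<in> {cumw G (?i - 1)<..cumw G (?i - 1) + nweight G ?i}" using v x VI[OF v(1)] by blast
  then obtain u where u: "u \<in> verts H" "x \<in> J ?i u"
    unfolding row[OF v(1), symmetric] n J_def using cumulative_interval_ex1[of "X ?i" "cumw G (?i - 1)" x n] X by auto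
  show "\<exists>!p. p \<in> verts G \<times> verts H \<and> x \<in> J (fst p) (snd p)"
  proof (rule ex1I[of _ "(?i, u)"])
    show "(?i, u) \<in> verts G \<times> verts H \<and> x \<in> J (fst (?i, u)) (snd (?i, u))" using u v by simp
    fix p assume p: "p \<in> verts G \<times> verts H \<and> x \<in> J (fst p) (snd p)"
    then have p': "fst p \<in> verts G" "snd p \<in> verts H" "x \<in> J (fst p) (snd p)" by auto
    have "x \<in> vertex_interval G (fst p)" using subsetD[OF sub[OF p'(1,2)] p'(3)] by simp
    then have "fst p = ?i" using vlab_eqI[OF G p'(1)] by simp
    moreover have "snd p = u"
      by (rule cumulative_interval_unique[of "X ?i" _ _ x "cumw G (?i - 1)"])
         (use X p' u n \<open>fst p = ?i\<close> in \<open>auto simp: J_def\<close>)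
    ultimately show "p = (?i, u)" by (cases p) simp
  qed
qed

text \<open>The unit interval is tiled twice by pieces of the lengths \<open>X0 (i, u)\<close>: once
  grouped by \<open>i\<close> and subdivided by \<open>u\<close>, once grouped by \<open>u\<close>
  and subdivided by \<open>i\<close>. Exchanging the first tiling for the second moves the mass
  \<open>X0 (i, u)\<close> from the interval of \<open>i\<close> to that of \<open>u\<close>, so the
  exchange induces the given coupling.\<close>

lemma overlay_le_realised:
  assumes G: "G \<in> wgraphs" and H: "H \<in> wgraphs" and "overlay_le G H c"
  shows "\<exists>\<nu>\<in>mp_bijections. cut_norm (\<lambda>x y. graphon_of G x y - graphon_of H (\<nu> x) (\<nu> y)) \<le> c"
proof -
  obtain X0 where X0: "coupling (verts G) (verts H) (nweight G) (nweight H) X0"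
    and c: "cut_le (verts G \<times> verts H) X0 (overlay_kernel G H) c"
    using assms(3) unfolding overlay_le_def by blast
  let ?K = "verts G \<times> verts H"
  \<comment> \<open>Extended by 0, because \<open>nested_intervals\<close> asks for nonnegative
    lengths at all indices.\<close>
  define X where "X = (\<lambda>i u. if (i, u) \<in> ?K then X0 (i, u) else 0)"
  have X: "0 \<le> X i u" for i u using X0 by (auto simp: X_def coupling_def)
  have row: "(\<Sum>u\<in>verts H. X i u) = nweight G i" if "i \<in> verts G" for i
    using X0 that by (simp add: X_def coupling_def)
  have col: "(\<Sum>i\<in>verts G. X i u) = nweight H u" if "u \<in> verts H" for u
    using X0 that by (simp add: X_def coupling_def)
  define a where "a = (\<lambda>p. cumw G (fst p - 1) + (\<Sum>u'=1..snd p-1. X (fst p) u'))"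
  define b where "b = (\<lambda>p. cumw H (snd p - 1) + (\<Sum>i'=1..fst p-1. X i' (snd p)))"
  define Y where "Y = (\<lambda>p. X (fst p) (snd p))"
  note nA = nested_intervals[where G=G and H=H and n="nverts H" and X=X, OF G verts_def X row]
  note nB = nested_intervals[where G=H and H=G and n="nverts G" and X="\<lambda>u i. X i u", OF H verts_def X col]
  have Asub: "{a p<..a p + Y p} \<subseteq> vertex_interval G (fst p) \<inter> {0<..1}" if "p \<in> ?K" for p
    unfolding a_def Y_def using that by (intro nA(1)) auto
  have Bsub: "{b p<..b p + Y p} \<subseteq> vertex_interval H (snd p) \<inter> {0<..1}" if "p \<in> ?K" for p
    unfolding b_def Y_def using that by (intro nB(1)) auto
  have Aex: "\<exists>!p. p \<in> ?K \<and> x \<in> {a p<..a p + Y p}" if "0 < x" "x \<le> 1" for x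
    unfolding a_def Y_def using that by (intro nA(2)) auto
  have Bex: "\<exists>!p. p \<in> ?K \<and> x \<in> {b p<..b p + Y p}" if "0 < x" "x \<le> 1" for x
  proof -
    \<comment> \<open>For the second tiling \<open>nested_intervals\<close> counts pairs as
      \<open>(u, i)\<close>; existence and uniqueness are carried over along
      \<open>prod.swap\<close>.\<close>
    define P where "P = (\<lambda>p. p \<in> ?K \<and> x \<in> {b p<..b p + Y p})"
    have "\<exists>!q. P (prod.swap q)"
      unfolding P_def b_def Y_def using nB(2)[OF _ that] by (simp add: mem_Times_iff conj_ac)
    then have "\<exists>!p. P p" by (metis swap_swap)
    then show ?thesis unfolding P_def .
  qed
  have "\<exists>\<nu>\<in>mp_bijections. \<forall>p\<in>?K. \<forall>x\<in>{a p<..a p + Y p}. \<nu> x = x - a p + b p"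
    by (rule interval_exchange) (use Asub Bsub Aex Bex in auto)
  then obtain \<nu> where n: "\<nu> \<in> mp_bijections" and nu: "\<And>p x. p \<in> ?K \<Longrightarrow> x \<in> {a p<..a p + Y p} \<Longrightarrow> \<nu> x = x - a p + b p"
    by blast
  have lab: "overlay_label G H \<nu> x = p" if p: "p \<in> ?K" and x: "x \<in> {a p<..a p + Y p}" for p x
  proof -
    have "\<nu> x \<in> {b p<..b p + Y p}" using nu[OF p x] x by auto
    then have "\<nu> x \<in> vertex_interval H (snd p)" using Bsub[OF p] by blast
    moreover have "x \<in> vertex_interval G (fst p)" using Asub[OF p] x by blast
    ultimately show ?thesis using p vlab_eqI[OF G] vlab_eqI[OF H] by (simp add: overlay_label_def mem_Times_iff prod_eq_iff)
  qed
  have "measure unit_leb {x\<in>{0..1}. overlay_label G H \<nu> x = p} = X0 p" if p: "p \<in> ?K" for p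
  proof -
    let ?L = "{x\<in>{0..1}. overlay_label G H \<nu> x = p}"
    have "{a p<..a p + Y p} \<subseteq> {0..1}" using Asub[OF p] by auto
    \<comment> \<open>Only the point 0 lies outside all pieces. It has some label, but measure
      0.\<close>
    have eq: "?L = {a p<..a p + Y p} \<union> (?L \<inter> {0})"
    proof (intro set_eqI iffI)
      fix x assume x: "x \<in> ?L"
      show "x \<in> {a p<..a p + Y p} \<union> (?L \<inter> {0})"
      proof (cases "x = 0")
        case False
        then obtain q where "q \<in> ?K" "x \<in> {a q<..a q + Y q}" using Aex[of x] x by auto
        then show ?thesis using lab[of q x] x by auto
      qed (use x in auto)
    next
      fix x assume "x \<in> {a p<..a p + Y p} \<union> (?L \<inter> {0})"
      then show "x \<in> ?L" using lab[OF p, of x] \<open>{a p<..a p + Y p} \<subseteq> {0..1}\<close> by blast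
    qed
    have z: "?L \<inter> {0} \<in> null_sets lebesgue"
    proof -
      have "{0::real} \<in> null_sets lebesgue" by (intro null_sets_completionI) auto
      then show ?thesis by (rule null_sets_completion_subset[rotated]) auto
    qed
    have "measure unit_leb ?L = measure lebesgue ?L" by (rule measure_unit_leb) auto
    also have "\<dots> = measure lebesgue {a p<..a p + Y p}"
      by (subst eq, rule measure_Un_null_set[OF _ z]) auto
    also have "\<dots> = Y p" using X by (simp add: Y_def)
    also have "\<dots> = X0 p" using p by (simp add: Y_def X_def mem_Times_iff)
    finally show ?thesis .
  qed
  then have "cut_le ?K (\<lambda>p. measure unit_leb {x\<in>{0..1}. overlay_label G H \<nu> x = p}) (overlay_kernel G H) c"
    using c by (subst cut_le_cong[where x'=X0 and m'="overlay_kernel G H"]) auto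
  then show ?thesis using n cut_norm_overlay_iff[OF G H n] by blast
qed

lemma overlay_le_wgraph_cut_dist:
  assumes "G \<in> wgraphs" "H \<in> wgraphs" "overlay_le G H c"
  shows "wgraph_cut_dist G H \<le> c"
  using overlay_le_realised[OF assms] cut_dist_le[OF graphon_of_in_graphons[OF assms(1)] graphon_of_in_graphons[OF assms(2)]]
  unfolding wgraph_cut_dist_def by fastforce

lemma overlay_le_commute:
  assumes "overlay_le G H c"
  shows "overlay_le H G c"
proof -
  obtain X where X: "coupling (verts G) (verts H) (nweight G) (nweight H) X"
    and c: "cut_le (verts G \<times> verts H) X (overlay_kernel G H) c"
    using assms unfolding overlay_le_def by blast
  have "cut_le (verts H \<times> verts G) (X \<circ> prod.swap) (overlay_kernel H G) c"
    unfolding cut_le_def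
  proof (intro allI impI)
    fix S T assume ST: "S \<subseteq> verts H \<times> verts G" "T \<subseteq> verts H \<times> verts G"
    have "prod.swap ` S \<subseteq> verts G \<times> verts H" "prod.swap ` T \<subseteq> verts G \<times> verts H" using ST by auto
    from cut_leD[OF c this]
    have "\<bar>\<Sum>i\<in>S. \<Sum>j\<in>T. X (prod.swap i) * X (prod.swap j) * (eweight G (snd i) (snd j) - eweight H (fst i) (fst j))\<bar> \<le> c"
      by (simp add: sum.reindex)
    moreover have "(\<Sum>i\<in>S. \<Sum>j\<in>T. X (prod.swap i) * X (prod.swap j) * (eweight G (snd i) (snd j) - eweight H (fst i) (fst j)))
      = - (\<Sum>i\<in>S. \<Sum>j\<in>T. (X \<circ> prod.swap) i * (X \<circ> prod.swap) j * overlay_kernel H G i j)"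
      unfolding sum_negf[symmetric] by (intro sum.cong refl) (simp add: algebra_simps)
    ultimately show "\<bar>\<Sum>i\<in>S. \<Sum>j\<in>T. (X \<circ> prod.swap) i * (X \<circ> prod.swap) j * overlay_kernel H G i j\<bar> \<le> c" by simp
  qed
  moreover have "coupling (verts H) (verts G) (nweight H) (nweight G) (X \<circ> prod.swap)"
    using X by (auto simp: coupling_def)
  ultimately show ?thesis unfolding overlay_le_def by blast
qed

subsection \<open>Approximation of graphons by weighted graphs\<close>

lemma max_rel_weight_uniform:
  assumes "1 \<le> k" "verts G = {1..k}" "\<And>i. i \<in> {1..k} \<Longrightarrow> vweight G i = 1"
  shows "max_rel_weight G = 1 / real k"
proof -
  have "vweight G ` verts G = {1}" using assms by force
  moreover have "total_weight G = real k" unfolding total_weight_def using assms by simp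
  ultimately show ?thesis by (simp add: max_rel_weight_def)
qed

lemma max_rel_weight_sample_graph: "1 \<le> k \<Longrightarrow> max_rel_weight (sample_graph k X) = 1 / real k"
  by (rule max_rel_weight_uniform) (auto simp: sample_graph_def simple_graph_of_def verts_def)

text \<open>A measurable function is almost everywhere a limit of continuous ones. Truncating these
  to values in the unit interval permits dominated convergence, and averaging over both orders of
  the arguments restores symmetry without increasing the distance to the symmetric
  \<open>W\<close>.\<close>

lemma graphon_L1_continuous_approx:
  assumes W: "W \<in> graphons" and e: "0 < e"
  shows "\<exists>h. continuous_on UNIV h \<and> (\<forall>z. 0 \<le> h z \<and> h z \<le> 1) \<and> (\<forall>x y. h (x, y) = h (y, x))
    \<and> (LINT z|sq_leb. \<bar>W (fst z) (snd z) - h z\<bar>) < e"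
proof -
  let ?Q = "{0..1} \<times> {0..1} :: (real \<times> real) set"
  let ?F = "\<lambda>z. W (fst z) (snd z)"
  have Fm: "?F \<in> borel_measurable sq_leb" and F01: "\<And>z. z \<in> ?Q \<Longrightarrow> 0 \<le> ?F z \<and> ?F z \<le> 1"
    and Fs: "\<And>x y. x \<in> {0..1} \<Longrightarrow> y \<in> {0..1} \<Longrightarrow> W x y = W y x"
    using W by (auto simp: graphons_def)
  have "(\<lambda>z. if z \<in> ?Q then ?F z else 0) \<in> borel_measurable lebesgue"
    using Fm by (subst borel_measurable_if) auto
  from lebesgue_measurable_imp_measurable_on_real[OF this, of UNIV]
  have "(\<lambda>z. if z \<in> ?Q then ?F z else 0) measurable_on UNIV" by simp
  then obtain N f where Nf: "negligible N" "\<forall>n. continuous_on UNIV (f n :: real \<times> real \<Rightarrow> real)"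
    "\<forall>z. z \<notin> N \<longrightarrow> (\<lambda>n. f n z) \<longlonglongrightarrow> (if z \<in> UNIV then if z \<in> ?Q then ?F z else 0 else 0)"
    unfolding measurable_on_def by blast
  have N: "negligible N" and f: "continuous_on UNIV (f n)" for n using Nf by blast+
  have lim: "(\<lambda>n. f n z) \<longlonglongrightarrow> (if z \<in> ?Q then ?F z else 0)" if "z \<notin> N" for z
    using Nf(3)[rule_format, OF that] by (simp only: UNIV_I if_True)
  define g where "g = (\<lambda>n z. max 0 (min 1 (f n z)))"
  have gc: "continuous_on UNIV (g n)" for n unfolding g_def by (intro continuous_intros f)
  have g01: "0 \<le> g n z" "g n z \<le> 1" for n z by (auto simp: g_def)
  have gm: "g n \<in> borel_measurable sq_leb" for n
    using gc[of n] by (intro measurable_restrict_space1 measurable_completion) (simp add: borel_measurable_continuous_onI)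
  have AEN: "AE z in sq_leb. z \<notin> N"
  proof -
    have "N \<in> null_sets lebesgue" using N by (simp add: negligible_iff_null_sets)
    then have "N \<inter> ?Q \<in> null_sets lebesgue" by (rule null_sets_completion_subset[rotated]) auto
    then have "N \<inter> ?Q \<in> null_sets sq_leb" by (subst null_sets_restrict_space) auto
    from AE_not_in[OF this] show ?thesis using AE_space by eventually_elim auto
  qed
  have "(\<lambda>n. LINT z|sq_leb. \<bar>?F z - g n z\<bar>) \<longlonglongrightarrow> (LINT z|sq_leb. 0)"
  proof (rule integral_dominated_convergence[where w="\<lambda>_. 1"])
    show "AE z in sq_leb. (\<lambda>n. \<bar>?F z - g n z\<bar>) \<longlonglongrightarrow> 0"
      using AEN AE_space
    proof eventually_elim
      case (elim z)
      then have z: "z \<in> ?Q" by simp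
      have "(\<lambda>n. \<bar>?F z - g n z\<bar>) \<longlonglongrightarrow> \<bar>?F z - max 0 (min 1 (?F z))\<bar>"
        unfolding g_def using lim[OF elim(1)] z by (intro tendsto_intros) auto
      then show ?case using F01[OF z] by simp
    qed
    show "AE z in sq_leb. norm \<bar>?F z - g n z\<bar> \<le> 1" for n
      using AE_space
    proof eventually_elim
      case (elim z)
      then show ?case using F01[of z] g01[of n z] by auto
    qed
  qed (use Fm gm in auto)
  then have "eventually (\<lambda>n. (LINT z|sq_leb. \<bar>?F z - g n z\<bar>) < e) sequentially"
    using e by (intro order_tendstoD(2)) auto
  then obtain n where n: "(LINT z|sq_leb. \<bar>?F z - g n z\<bar>) < e" by (auto simp: eventually_sequentially)
  define sw where "sw = (\<lambda>z::real \<times> real. (snd z, fst z))"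
  define h where "h = (\<lambda>z. (g n z + g n (sw z)) / 2)"
  have hc: "continuous_on UNIV h"
    unfolding h_def sw_def
    by (intro continuous_intros gc continuous_on_compose2[OF gc[of n], of UNIV "\<lambda>z. (snd z, fst z)"]) auto
  have integ: "integrable sq_leb (\<lambda>z. \<bar>?F z - g n z\<bar>)"
  proof (rule sq_leb.integrable_const_bound[of _ 1])
    show "AE z in sq_leb. norm \<bar>?F z - g n z\<bar> \<le> 1"
    proof (rule AE_I2)
      fix z assume "z \<in> space sq_leb"
      then show "norm \<bar>?F z - g n z\<bar> \<le> 1" using F01[of z] g01[of n z] by auto
    qed
  qed (use Fm gm in simp)
  have swi: "(LINT z|sq_leb. \<bar>?F (sw z) - g n (sw z)\<bar>) = (LINT z|sq_leb. \<bar>?F z - g n z\<bar>)"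
    and swint: "integrable sq_leb (\<lambda>z. \<bar>?F (sw z) - g n (sw z)\<bar>)"
  proof -
    have "(LINT z|distr sq_leb sq_leb sw. \<bar>?F z - g n z\<bar>) = (LINT z|sq_leb. \<bar>?F (sw z) - g n (sw z)\<bar>)"
      unfolding sw_def by (rule integral_distr[OF swap_sq_leb(1)]) (use Fm gm in auto)
    then show "(LINT z|sq_leb. \<bar>?F (sw z) - g n (sw z)\<bar>) = (LINT z|sq_leb. \<bar>?F z - g n z\<bar>)"
      unfolding sw_def swap_sq_leb(2) by simp
    show "integrable sq_leb (\<lambda>z. \<bar>?F (sw z) - g n (sw z)\<bar>)"
      unfolding sw_def by (rule integrable_distr[OF swap_sq_leb(1)]) (use integ swap_sq_leb(2) in simp)
  qed
  have "(LINT z|sq_leb. \<bar>?F z - h z\<bar>) \<le> (LINT z|sq_leb. (\<bar>?F z - g n z\<bar> + \<bar>?F (sw z) - g n (sw z)\<bar>) / 2)"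
  proof (rule integral_mono_AE)
    have hm: "h \<in> borel_measurable sq_leb"
      using hc by (intro measurable_restrict_space1 measurable_completion) (simp add: borel_measurable_continuous_onI)
    have le: "\<bar>?F z - h z\<bar> \<le> (\<bar>?F z - g n z\<bar> + \<bar>?F (sw z) - g n (sw z)\<bar>) / 2" if "z \<in> ?Q" for z
    proof -
      have "?F (sw z) = ?F z" using Fs that by (auto simp: sw_def)
      then show ?thesis unfolding h_def by (simp add: field_simps)
    qed
    show i2: "integrable sq_leb (\<lambda>z. (\<bar>?F z - g n z\<bar> + \<bar>?F (sw z) - g n (sw z)\<bar>) / 2)"
      using integ swint by auto
    show "AE z in sq_leb. \<bar>?F z - h z\<bar> \<le> (\<bar>?F z - g n z\<bar> + \<bar>?F (sw z) - g n (sw z)\<bar>) / 2"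
      using le by (intro AE_I2) simp
    show "integrable sq_leb (\<lambda>z. \<bar>?F z - h z\<bar>)"
      by (rule Bochner_Integration.integrable_bound[OF i2]) (use Fm hm le in \<open>auto intro!: AE_I2\<close>)
  qed
  also have "\<dots> = ((LINT z|sq_leb. \<bar>?F z - g n z\<bar>) + (LINT z|sq_leb. \<bar>?F (sw z) - g n (sw z)\<bar>)) / 2"
    using integ swint by simp
  also have "\<dots> < e" using swi n by simp
  finally have "(LINT z|sq_leb. \<bar>?F z - h z\<bar>) < e" .
  moreover have "0 \<le> h z" "h z \<le> 1" for z
    using g01[of n z] g01[of n "sw z"] by (simp_all add: h_def)
  moreover have "h (x, y) = h (y, x)" for x y by (simp add: h_def sw_def)
  ultimately show ?thesis using hc by blast
qed

text \<open>A continuous approximation is evaluated on an \<open>M\<close> by \<open>M\<close> grid,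
  and uniform continuity makes the step function close to it. All vertices have equal weight, so
  refining the grid also makes the weights as small as required.\<close>

lemma graphon_L1_approx:
  assumes W: "W \<in> graphons" and e: "0 < e" and N: "1 \<le> (N::nat)"
  shows "\<exists>G\<in>wgraphs. max_rel_weight G \<le> 1 / real N \<and> l1_norm (\<lambda>x y. W x y - graphon_of G x y) < e"
proof -
  let ?Q = "{0..1} \<times> {0..1} :: (real \<times> real) set"
  obtain h where hc: "continuous_on UNIV h" and h01: "\<And>z. 0 \<le> h z \<and> h z \<le> 1" and hs: "\<And>x y. h (x, y) = h (y, x)"
    and h: "(LINT z|sq_leb. \<bar>W (fst z) (snd z) - h z\<bar>) < e / 2"
    using graphon_L1_continuous_approx[OF W, of "e / 2"] e by auto
  have "compact ?Q" by (intro compact_Times) auto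
  then have "uniformly_continuous_on ?Q h"
    by (intro compact_uniformly_continuous continuous_on_subset[OF hc]) auto
  then obtain d where d: "0 < d" "\<And>z z'. z \<in> ?Q \<Longrightarrow> z' \<in> ?Q \<Longrightarrow> dist z' z < d \<Longrightarrow> dist (h z') (h z) < e / 2"
    unfolding uniformly_continuous_on_def using e by (metis half_gt_zero)
  \<comment> \<open>Each coordinate is within \<open>1 / M\<close> of its grid value, so a point is
    within \<open>2 / M\<close> of its grid point.\<close>
  obtain M where M: "N \<le> M" "2 / d < real M"
  proof -
    obtain m where "2 / d < real m" using reals_Archimedean2 by blast
    then have "N \<le> max N m" "2 / d < real (max N m)" by auto
    then show thesis using that by blast
  qed
  have M1: "1 \<le> M" using M N by simp
  define G where "G = WGraph M (\<lambda>i. if i \<in> {1..M} then 1 else 0)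
     (\<lambda>i j. if i \<in> {1..M} \<and> j \<in> {1..M} then h (real i / M, real j / M) else 0)"
  have vG: "verts G = {1..M}" by (simp add: G_def verts_def)
  have G: "G \<in> wgraphs"
    using M1 h01 hs by (auto simp: wgraphs_def verts_def G_def)
  have "max_rel_weight G = 1 / real M" by (rule max_rel_weight_uniform[OF M1 vG]) (simp add: G_def)
  also have "\<dots> \<le> 1 / real N" using M N by (simp add: frac_le)
  finally have mx: "max_rel_weight G \<le> 1 / real N" .
  have nw: "nweight G i = 1 / real M" if "i \<in> {1..M}" for i
    using that by (simp add: nweight_def total_weight_def vG) (simp add: G_def)
  have cw: "cumw G m = real m / real M" if "m \<le> M" for m
    unfolding cumw_def using that nw by (subst sum.cong[OF refl, of _ _ "\<lambda>_. 1 / real M"]) auto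
  have near: "\<bar>x - real (vlab G x) / real M\<bar> \<le> 1 / real M" "vlab G x \<in> {1..M}" if x: "x \<in> {0..1}" for x
  proof -
    note v = vlab[OF G x]
    show vl: "vlab G x \<in> {1..M}" using v vG by simp
    have c: "cumw G (vlab G x) = real (vlab G x) / M" "cumw G (vlab G x - 1) = (real (vlab G x) - 1) / M"
      using vl cw by (auto simp: of_nat_diff)
    have "x = 0 \<and> vlab G x = 1 \<or> (real (vlab G x) - 1) / M < x \<and> x \<le> real (vlab G x) / M"
      using v(2) unfolding vertex_interval_cumw c by (auto split: if_splits)
    then show "\<bar>x - real (vlab G x) / real M\<bar> \<le> 1 / real M"
      using M1 by (auto simp: diff_divide_distrib)
  qed
  have close: "\<bar>h (x, y) - graphon_of G x y\<bar> \<le> e / 2" if xy: "x \<in> {0..1}" "y \<in> {0..1}" for x y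
  proof -
    let ?i = "vlab G x" and ?j = "vlab G y"
    note nx = near[OF xy(1)] and ny = near[OF xy(2)]
    have "dist (x, y) (real ?i / M, real ?j / M) \<le> dist x (real ?i / M) + dist y (real ?j / M)"
      by (simp add: dist_Pair_Pair sqrt_sum_squares_le_sum)
    also have "\<dots> \<le> 2 / M" using nx(1) ny(1) by (simp add: dist_real_def)
    also have "\<dots> < d" using M(2) d(1) M1 by (simp add: field_simps)
    finally have "dist (x, y) (real ?i / M, real ?j / M) < d" .
    moreover have "(real ?i / M, real ?j / M) \<in> ?Q" using nx(2) ny(2) by auto
    ultimately have "dist (h (x, y)) (h (real ?i / M, real ?j / M)) < e / 2" using d(2) xy by blast
    moreover have "graphon_of G x y = h (real ?i / M, real ?j / M)"
      using graphon_of_vlab[OF G xy] nx(2) ny(2) by (simp add: G_def)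
    ultimately show ?thesis by (simp add: dist_real_def)
  qed
  have hm: "h \<in> borel_measurable sq_leb"
    using hc by (intro measurable_restrict_space1 measurable_completion) (simp add: borel_measurable_continuous_onI)
  have kW: "integrable sq_leb (\<lambda>z. W (fst z) (snd z))" "integrable sq_leb (\<lambda>z. graphon_of G (fst z) (snd z))"
    using kernel_graphon[OF W] kernel_graphon[OF graphon_of_in_graphons[OF G]] by (auto simp: kernel_def)
  have ih: "integrable sq_leb h"
    by (rule sq_leb.integrable_const_bound[of _ 1]) (use hm h01 in \<open>auto intro!: AE_I2\<close>)
  have "l1_norm (\<lambda>x y. W x y - graphon_of G x y) \<le> (LINT z|sq_leb. \<bar>W (fst z) (snd z) - h z\<bar> + e / 2)"
    unfolding l1_norm_def
  proof (rule integral_mono)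
    fix z assume "z \<in> space sq_leb"
    then have "\<bar>h z - graphon_of G (fst z) (snd z)\<bar> \<le> e / 2" using close[of "fst z" "snd z"] by (auto simp: mem_Times_iff)
    then show "\<bar>W (fst z) (snd z) - graphon_of G (fst z) (snd z)\<bar> \<le> \<bar>W (fst z) (snd z) - h z\<bar> + e / 2" by linarith
  qed (use kW ih in auto)
  also have "\<dots> = (LINT z|sq_leb. \<bar>W (fst z) (snd z) - h z\<bar>) + e / 2"
    using kW ih sq_leb.prob_space by (subst Bochner_Integration.integral_add) auto
  also have "\<dots> < e" using h by simp
  finally show ?thesis using G mx by blast
qed

subsection \<open>Completeness in the cut norm\<close>

text \<open>The limit is built on the sigma-algebra generated by rectangles, as the cut norm
  controls rectangles only; a Lebesgue set of the square need not belong to it.\<close>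

abbreviation unit_prod :: "(real \<times> real) measure" where "unit_prod \<equiv> unit_leb \<Otimes>\<^sub>M unit_leb"

lemma unit_prod_sq_leb:
  assumes "A \<in> sets unit_prod"
  shows "A \<in> sets sq_leb" "emeasure sq_leb A = emeasure unit_prod A" "measure sq_leb A = measure unit_prod A"
proof -
  have "A \<subseteq> {0..1} \<times> {0..1}" using sets.sets_into_space[OF assms] by (simp add: space_pair_measure)
  then have eq: "(\<lambda>z. z) -` A \<inter> space sq_leb = A" by auto
  show "A \<in> sets sq_leb" using measurable_sets[OF id_sq_leb_pair assms] unfolding eq .
  show "emeasure sq_leb A = emeasure unit_prod A"
    using emeasure_distr[OF id_sq_leb_pair assms] unfolding distr_sq_leb_pair eq by simp
  then show "measure sq_leb A = measure unit_prod A" by (simp add: measure_def)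
qed

interpretation unit_prod: prob_space unit_prod
proof (rule prob_spaceI)
  have "emeasure sq_leb (space unit_prod) = emeasure unit_prod (space unit_prod)"
    by (rule unit_prod_sq_leb) simp
  then show "emeasure unit_prod (space unit_prod) = 1" using sq_leb.emeasure_space_1 by (simp add: space_pair_measure)
qed

definition set_int :: "(real \<Rightarrow> real \<Rightarrow> real) \<Rightarrow> (real \<times> real) set \<Rightarrow> real" where
  "set_int W A = (LINT z|sq_leb. indicator A z * W (fst z) (snd z))"

lemma set_int_rect: "set_int W (S \<times> T) = rect_int W S T"
  by (simp add: set_int_def rect_int_def)

context
  fixes W :: "real \<Rightarrow> real \<Rightarrow> real"
  assumes W: "W \<in> graphons"
begin

lemma integrable_set_int: "A \<in> sets sq_leb \<Longrightarrow> integrable sq_leb (\<lambda>z. indicator A z * W (fst z) (snd z))"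
  using integrable_mult_indicator[of A sq_leb "\<lambda>z. W (fst z) (snd z)"] kernel_graphon[OF W]
  by (simp add: kernel_def)

lemma set_int_bounds:
  assumes "A \<in> sets unit_prod"
  shows "0 \<le> set_int W A" "set_int W A \<le> measure unit_prod A"
proof -
  note A = unit_prod_sq_leb[OF assms]
  have W01: "0 \<le> W (fst z) (snd z) \<and> W (fst z) (snd z) \<le> 1" if "z \<in> {0..1} \<times> {0..1}" for z
    using W that by (auto simp: graphons_def)
  show "0 \<le> set_int W A"
    unfolding set_int_def using W01 by (intro Bochner_Integration.integral_nonneg_AE AE_I2) auto
  have "set_int W A \<le> (LINT z|sq_leb. indicator A z)"
    unfolding set_int_def
  proof (rule integral_mono[OF integrable_set_int[OF A(1)]])
    show "integrable sq_leb (indicator A :: _ \<Rightarrow> real)" using A(1) by (auto simp: less_top[symmetric])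
    show "indicator A z * W (fst z) (snd z) \<le> indicator A z" if "z \<in> space sq_leb" for z
      using W01[of z] that by (auto simp: indicator_def)
  qed
  also have "\<dots> = measure sq_leb A" using sets.sets_into_space[OF A(1)] by (simp add: Int_absorb2)
  finally show "set_int W A \<le> measure unit_prod A" using A(3) by simp
qed

lemma set_int_compl:
  assumes "A \<in> sets unit_prod"
  shows "set_int W (space unit_prod - A) = set_int W (space unit_prod) - set_int W A"
proof -
  have sp: "space unit_prod \<in> sets unit_prod" by simp
  have "set_int W (space unit_prod) - set_int W A = (LINT z|sq_leb. indicator (space unit_prod) z * W (fst z) (snd z) - indicator A z * W (fst z) (snd z))"
    unfolding set_int_def
    by (rule Bochner_Integration.integral_diff[symmetric]) (intro integrable_set_int unit_prod_sq_leb assms sp)+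
  also have "\<dots> = set_int W (space unit_prod - A)"
    unfolding set_int_def using sets.sets_into_space[OF assms] by (intro Bochner_Integration.integral_cong) (auto simp: indicator_def)
  finally show ?thesis by simp
qed

lemma set_int_sums:
  assumes A: "range A \<subseteq> sets unit_prod" and d: "disjoint_family A"
  shows "(\<lambda>i. set_int W (A i)) sums set_int W (\<Union>i. A i)"
proof -
  have A': "A i \<in> sets unit_prod" for i using A by auto
  have set_eq: "set_int W A = (LINT z:A|sq_leb. W (fst z) (snd z))" for A
    by (simp add: set_int_def set_lebesgue_integral_def)
  have U: "(\<Union>i. A i) \<in> sets sq_leb" using A' by (intro unit_prod_sq_leb sets.countable_UN) auto
  have "set_int W (\<Union>i. A i) = (\<Sum>i. set_int W (A i))"
    unfolding set_eq
  proof (rule lebesgue_integral_countable_add)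
    show "A i \<in> sets sq_leb" for i by (intro unit_prod_sq_leb A')
    show "A i \<inter> A j = {}" if "i \<noteq> j" for i j using d that by (auto simp: disjoint_family_on_def)
    show "set_integrable sq_leb (\<Union>i. A i) (\<lambda>z. W (fst z) (snd z))"
      using integrable_set_int[OF U] by (simp add: set_integrable_def)
  qed
  moreover have "summable (\<lambda>i. set_int W (A i))"
  proof (rule summable_comparison_test')
    show "summable (\<lambda>i. measure unit_prod (A i))"
      using unit_prod.finite_measure_UNION[OF A d] by (rule sums_summable)
    show "norm (set_int W (A n)) \<le> measure unit_prod (A n)" if "0 \<le> n" for n
      using set_int_bounds[OF A'[of n]] by simp
  qed
  ultimately show ?thesis by (simp add: sums_iff)
qed

end

text \<open>A sequence of graphons that is Cauchy in the cut norm converges on every measurable set, since the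
  sets with this property form a Dynkin system that contains the rectangles. The limits form a measure,
  and the limit graphon is its density.\<close>
context
  fixes U :: "nat \<Rightarrow> real \<Rightarrow> real \<Rightarrow> real"
  assumes U: "\<And>n. U n \<in> graphons"
    and Cauchy: "\<And>e. 0 < e \<Longrightarrow> \<exists>N. \<forall>m\<ge>N. \<forall>n\<ge>N. cut_norm (\<lambda>x y. U m x y - U n x y) < e"
begin

text \<open>Tannery's theorem: graphons are at most 1, so the measures of the sets
  \<open>A i\<close> form a summable majorant for all \<open>n\<close> at once.\<close>

lemma limit_set_int_sums:
  assumes A: "range A \<subseteq> sets unit_prod" and d: "disjoint_family A" and c: "\<And>i. convergent (\<lambda>n. set_int (U n) (A i))"
  shows "(\<lambda>n. set_int (U n) (\<Union>i. A i)) \<longlonglongrightarrow> (\<Sum>i. lim (\<lambda>n. set_int (U n) (A i)))"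
    and "summable (\<lambda>i. lim (\<lambda>n. set_int (U n) (A i)))"
proof -
  have A': "A i \<in> sets unit_prod" for i using A by auto
  have *: "eventually (\<lambda>n. summable (\<lambda>k. norm (set_int (U n) (A k)))) sequentially \<and>
     summable (\<lambda>k. norm (lim (\<lambda>n. set_int (U n) (A k)))) \<and>
     ((\<lambda>n. \<Sum>k. set_int (U n) (A k)) \<longlongrightarrow> (\<Sum>k. lim (\<lambda>n. set_int (U n) (A k)))) sequentially"
  proof (rule tannerys_theorem)
    show "(\<lambda>n. set_int (U n) (A k)) \<longlonglongrightarrow> lim (\<lambda>n. set_int (U n) (A k))" for k
      using c[of k] by (simp add: convergent_LIMSEQ_iff)
    show "eventually (\<lambda>(k, n). norm (set_int (U n) (A k)) \<le> measure unit_prod (A k)) (at_top \<times>\<^sub>F sequentially)"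
      using set_int_bounds[OF U A'] by (intro always_eventually) auto
    show "summable (\<lambda>i. measure unit_prod (A i))"
      using unit_prod.finite_measure_UNION[OF A d] by (rule sums_summable)
  qed simp
  have "(\<Sum>k. set_int (U n) (A k)) = set_int (U n) (\<Union>i. A i)" for n
    using set_int_sums[OF U A d] by (simp add: sums_iff)
  then show "(\<lambda>n. set_int (U n) (\<Union>i. A i)) \<longlonglongrightarrow> (\<Sum>i. lim (\<lambda>n. set_int (U n) (A i)))" using * by simp
  show "summable (\<lambda>i. lim (\<lambda>n. set_int (U n) (A i)))" using * by (auto intro: summable_norm_cancel)
qed

lemma convergent_rect_int:
  assumes "S \<in> sets unit_leb" "T \<in> sets unit_leb"
  shows "convergent (\<lambda>n. rect_int (U n) S T)"
proof (rule Cauchy_convergent, rule CauchyI)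
  fix e :: real assume "0 < e"
  then obtain N where N: "\<And>m n. N \<le> m \<Longrightarrow> N \<le> n \<Longrightarrow> cut_norm (\<lambda>x y. U m x y - U n x y) < e"
    using Cauchy by blast
  have "norm (rect_int (U m) S T - rect_int (U n) S T) < e" if "N \<le> m" "N \<le> n" for m n
  proof -
    note k = kernel_graphon[OF U[of m]] kernel_graphon[OF U[of n]]
    have "\<bar>rect_int (\<lambda>x y. U m x y - U n x y) S T\<bar> \<le> cut_norm (\<lambda>x y. U m x y - U n x y)"
      by (rule rect_int_le_cut_norm[OF kernel_diff[OF k] assms])
    then show ?thesis using N[OF that] by (simp add: rect_int_diff[OF k assms])
  qed
  then show "\<exists>N. \<forall>m\<ge>N. \<forall>n\<ge>N. norm (rect_int (U m) S T - rect_int (U n) S T) < e" by blast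
qed

lemma convergent_set_int:
  assumes "A \<in> sets unit_prod"
  shows "convergent (\<lambda>n. set_int (U n) A)"
proof -
  let ?E = "{a \<times> b |a b. a \<in> sets unit_leb \<and> b \<in> sets unit_leb}"
  let ?\<Omega> = "space unit_leb \<times> space unit_leb"
  have sp: "space unit_prod = ?\<Omega>" by (simp add: space_pair_measure)
  have ss: "sets unit_prod = sigma_sets ?\<Omega> ?E" by (simp add: sets_pair_measure)
  have cl: "?E \<subseteq> Pow ?\<Omega>" using sets.sets_into_space[of _ unit_leb] by blast
  show ?thesis
  proof (rule sigma_sets_induct_disjoint[OF Int_stable_pair_measure_generator cl assms[unfolded ss], of "\<lambda>A. convergent (\<lambda>n. set_int (U n) A)"])
    show "convergent (\<lambda>n. set_int (U n) A)" if "A \<in> ?E" for A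
      using that convergent_rect_int by (auto simp: set_int_rect)
    show "convergent (\<lambda>n. set_int (U n) {})" by (simp add: set_int_def convergent_const)
    have full: "convergent (\<lambda>n. set_int (U n) (space unit_prod))"
      unfolding sp set_int_rect by (intro convergent_rect_int) auto
    show "convergent (\<lambda>n. set_int (U n) (?\<Omega> - A))"
      if A: "A \<in> sigma_sets ?\<Omega> ?E" and c: "convergent (\<lambda>n. set_int (U n) A)" for A
    proof -
      have "A \<in> sets unit_prod" using A ss by simp
      from set_int_compl[OF U this] show ?thesis
        unfolding sp[symmetric] using convergent_diff[OF full c] by simp
    qed
    show "convergent (\<lambda>n. set_int (U n) (\<Union>i. A i))"
      if "disjoint_family A" "range A \<subseteq> sigma_sets ?\<Omega> ?E" "\<And>i. convergent (\<lambda>n. set_int (U n) (A i))" for A :: "nat \<Rightarrow> _"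
      using limit_set_int_sums(1)[of A] that unfolding ss by (auto simp: convergent_def)
  qed
qed

lemma cut_norm_complete:
  assumes sym: "\<And>n S T. S \<in> sets unit_leb \<Longrightarrow> T \<in> sets unit_leb \<Longrightarrow> rect_int (U n) S T = rect_int (U n) T S"
  shows "\<exists>W\<in>graphons. (\<lambda>n. cut_norm (\<lambda>x y. U n x y - W x y)) \<longlonglongrightarrow> 0"
proof -
  define L where "L = (\<lambda>A. lim (\<lambda>n. set_int (U n) A))"
  have L: "(\<lambda>n. set_int (U n) A) \<longlonglongrightarrow> L A" if "A \<in> sets unit_prod" for A
    unfolding L_def using convergent_set_int[OF that] by (simp add: convergent_LIMSEQ_iff)
  have L0: "0 \<le> L A" and L1: "L A \<le> measure unit_prod A" if "A \<in> sets unit_prod" for A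
    using set_int_bounds[OF U that] by (auto intro: LIMSEQ_le_const[OF L[OF that]] LIMSEQ_le_const2[OF L[OF that]])
  define \<mu> where "\<mu> = measure_of (space unit_prod) (sets unit_prod) (\<lambda>A. ennreal (L A))"
  have Lempty: "L {} = 0" by (simp add: L_def set_int_def)
  have ca: "countably_additive (sets unit_prod) (\<lambda>A. ennreal (L A))"
  proof (rule countably_additiveI)
    fix A :: "nat \<Rightarrow> _" assume A: "range A \<subseteq> sets unit_prod" "disjoint_family A" "(\<Union>i. A i) \<in> sets unit_prod"
    have c: "convergent (\<lambda>n. set_int (U n) (A i))" for i using A(1) by (intro convergent_set_int) auto
    note ls = limit_set_int_sums[OF A(1,2) c]
    have "L (\<Union>i. A i) = (\<Sum>i. L (A i))" unfolding L_def using ls(1) by (rule limI)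
    moreover have "(\<Sum>i. ennreal (L (A i))) = ennreal (\<Sum>i. L (A i))"
    proof (rule suminf_ennreal2)
      show "0 \<le> L (A i)" for i using L0 A(1) by auto
      show "summable (\<lambda>i. L (A i))" using ls(2) unfolding L_def .
    qed
    ultimately show "(\<Sum>i. ennreal (L (A i))) = ennreal (L (\<Union>i. A i))" by simp
  qed
  have em: "emeasure \<mu> A = ennreal (L A)" if "A \<in> sets unit_prod" for A
    unfolding \<mu>_def by (rule emeasure_measure_of_sigma[OF sets.sigma_algebra_axioms _ ca that]) (simp add: positive_def Lempty)
  have sm: "sets \<mu> = sets unit_prod" by (simp add: \<mu>_def)
  have ac: "absolutely_continuous unit_prod \<mu>"
    unfolding absolutely_continuous_def
  proof
    fix A assume A: "A \<in> null_sets unit_prod"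
    then have As: "A \<in> sets unit_prod" and "measure unit_prod A = 0" by (auto simp: measure_def null_sets_def)
    then have "L A = 0" using L0[OF As] L1[OF As] by simp
    then show "A \<in> null_sets \<mu>" using em[OF As] As sm by (auto simp: null_sets_def)
  qed
  obtain f where f: "f \<in> borel_measurable unit_prod" and dens: "density unit_prod f = \<mu>"
    using sigma_finite_measure.Radon_Nikodym[OF prob_space_imp_sigma_finite[OF unit_prod.prob_space_axioms] ac sm] by blast
  have int_f: "(\<integral>\<^sup>+z. f z * indicator A z \<partial>unit_prod) = ennreal (L A)" if "A \<in> sets unit_prod" for A
    using emeasure_density[OF f that] em[OF that] unfolding dens by simp
  \<comment> \<open>The limit values are bounded by the measure. On the set where \<open>f\<close>
    exceeds 1 the excess therefore integrates to 0, after cancelling a finite measure.\<close>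
  have f1: "AE z in unit_prod. f z \<le> 1"
  proof -
    define A where "A = {z\<in>space unit_prod. 1 < f z}"
    have A: "A \<in> sets unit_prod" unfolding A_def using f by measurable
    have "emeasure unit_prod A + (\<integral>\<^sup>+z. (f z - 1) * indicator A z \<partial>unit_prod)
       = (\<integral>\<^sup>+z. indicator A z + (f z - 1) * indicator A z \<partial>unit_prod)"
      using A f by (subst nn_integral_add) auto
    also have "\<dots> = (\<integral>\<^sup>+z. f z * indicator A z \<partial>unit_prod)"
      by (intro nn_integral_cong) (auto simp: A_def indicator_def add_diff_inverse_ennreal)
    also have "\<dots> \<le> emeasure unit_prod A"
      using int_f[OF A] L1[OF A] by (simp add: unit_prod.emeasure_eq_measure ennreal_leI)
    finally have "emeasure unit_prod A + (\<integral>\<^sup>+z. (f z - 1) * indicator A z \<partial>unit_prod) \<le> emeasure unit_prod A + 0" by simp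
    then have "(\<integral>\<^sup>+z. (f z - 1) * indicator A z \<partial>unit_prod) = 0"
      by (subst (asm) ennreal_add_left_cancel_le) (simp add: unit_prod.emeasure_eq_measure)
    then have "AE z in unit_prod. (f z - 1) * indicator A z = 0"
      using A f by (subst (asm) nn_integral_0_iff_AE) auto
    then show ?thesis using AE_space
    proof eventually_elim
      case (elim z)
      show ?case
      proof (rule ccontr)
        assume "\<not> f z \<le> 1"
        then have "1 < f z" by simp
        then have "f z - 1 = 0" using elim by (simp add: A_def)
        then show False using \<open>1 < f z\<close> by (auto dest: ennreal_minus_eq_0)
      qed
    qed
  qed
  define F where "F = (\<lambda>z. enn2real (min 1 (f z)))"
  have Fm: "F \<in> borel_measurable unit_prod" unfolding F_def using f by measurable
  have F01: "0 \<le> F z" "F z \<le> 1" for z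
    unfolding F_def by (auto intro!: enn2real_leI)
  have Fi: "integrable unit_prod (\<lambda>z. indicator A z * F z)" if "A \<in> sets unit_prod" for A
    by (rule unit_prod.integrable_const_bound[of _ 1]) (use Fm F01 that in \<open>auto intro!: AE_I2 simp: indicator_def\<close>)
  have LF: "(LINT z|unit_prod. indicator A z * F z) = L A" if A: "A \<in> sets unit_prod" for A
  proof -
    have "ennreal (LINT z|unit_prod. indicator A z * F z) = (\<integral>\<^sup>+z. ennreal (indicator A z * F z) \<partial>unit_prod)"
      using Fi[OF A] F01 by (intro nn_integral_eq_integral[symmetric]) auto
    also have "\<dots> = (\<integral>\<^sup>+z. f z * indicator A z \<partial>unit_prod)"
    proof (rule nn_integral_cong_AE)
      show "AE z in unit_prod. ennreal (indicator A z * F z) = f z * indicator A z"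
        using f1
      proof eventually_elim
        case (elim z)
        have "ennreal (F z) = min 1 (f z)" unfolding F_def by (rule ennreal_enn2real) (simp add: min_less_iff_disj)
        then show ?case using elim by (auto simp: indicator_def min_absorb2)
      qed
    qed
    also have "\<dots> = ennreal (L A)" by (rule int_f[OF A])
    finally show ?thesis using L0[OF A] F01 by (subst (asm) ennreal_inj) (auto intro!: Bochner_Integration.integral_nonneg)
  qed
  \<comment> \<open>Graphons are symmetric at every point, which a density does not guarantee.
    Averaging leaves rectangle integrals unchanged, because the limit values on
    \<open>S \<times> T\<close> and \<open>T \<times> S\<close> agree.\<close>
  define W where "W = (\<lambda>x y. (F (x, y) + F (y, x)) / 2)"
  have swm: "(\<lambda>z. (snd z, fst z)) \<in> unit_prod \<rightarrow>\<^sub>M unit_prod" by measurable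
  have Wm: "(\<lambda>z. W (fst z) (snd z)) \<in> borel_measurable unit_prod"
    unfolding W_def using Fm measurable_compose[OF swm Fm] by simp
  have Wg: "W \<in> graphons"
  proof -
    have "(\<lambda>z. W (fst z) (snd z)) \<in> borel_measurable sq_leb"
      using measurable_compose[OF id_sq_leb_pair Wm] by simp
    moreover have "0 \<le> W x y \<and> W x y \<le> 1 \<and> W x y = W y x" for x y
      using F01[of "(x, y)"] F01[of "(y, x)"] by (auto simp: W_def)
    ultimately show ?thesis by (simp add: graphons_def)
  qed
  have Lsym: "L (S \<times> T) = L (T \<times> S)" if "S \<in> sets unit_leb" "T \<in> sets unit_leb" for S T
    unfolding L_def set_int_rect using sym[OF that] by simp
  have rW: "rect_int W S T = L (S \<times> T)" if S: "S \<in> sets unit_leb" and T: "T \<in> sets unit_leb" for S T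
  proof -
    have ST: "S \<times> T \<in> sets unit_prod" "T \<times> S \<in> sets unit_prod" using S T by auto
    have "rect_int W S T = (LINT z|distr sq_leb unit_prod (\<lambda>z. z). indicator (S \<times> T) z * W (fst z) (snd z))"
      unfolding rect_int_def using ST Wm by (subst integral_distr[OF id_sq_leb_pair]) auto
    also have "\<dots> = (LINT z|unit_prod. indicator (S \<times> T) z * W (fst z) (snd z))"
      unfolding distr_sq_leb_pair ..
    also have "\<dots> = (LINT z|unit_prod. (indicator (S \<times> T) z * F z + (case z of (x, y) \<Rightarrow> indicator (T \<times> S) (y, x) * F (y, x))) / 2)"
      by (intro Bochner_Integration.integral_cong) (auto simp: W_def indicator_def)
    also have "\<dots> = ((LINT z|unit_prod. indicator (S \<times> T) z * F z) + (LINT (x, y)|unit_prod. indicator (T \<times> S) (y, x) * F (y, x))) / 2"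
    proof -
      have "integrable unit_prod (\<lambda>(x, y). indicator (T \<times> S) (y, x) * F (y, x))"
        using unit_pair.integrable_product_swap[OF Fi[OF ST(2)]] by simp
      then show ?thesis using Fi[OF ST(1)] by simp
    qed
    also have "(LINT (x, y)|unit_prod. indicator (T \<times> S) (y, x) * F (y, x)) = (LINT z|unit_prod. indicator (T \<times> S) z * F z)"
      using Fm ST by (intro unit_pair.integral_product_swap) auto
    also have "((LINT z|unit_prod. indicator (S \<times> T) z * F z) + (LINT z|unit_prod. indicator (T \<times> S) z * F z)) / 2 = L (S \<times> T)"
      using LF[OF ST(1)] LF[OF ST(2)] Lsym[OF S T] by simp
    finally show ?thesis .
  qed
  have "(\<lambda>n. cut_norm (\<lambda>x y. U n x y - W x y)) \<longlonglongrightarrow> 0"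
  proof (rule LIMSEQ_I)
    fix r :: real assume r: "0 < r"
    then obtain N where N: "\<And>m n. N \<le> m \<Longrightarrow> N \<le> n \<Longrightarrow> cut_norm (\<lambda>x y. U m x y - U n x y) < r / 2"
      using Cauchy[of "r / 2"] by auto
    \<comment> \<open>The index \<open>N\<close> serves all rectangles at once. Letting
      \<open>m\<close> tend to infinity in the estimate for each single rectangle therefore bounds
      the supremum.\<close>
    have "cut_norm (\<lambda>x y. U n x y - W x y) \<le> r / 2" if n: "N \<le> n" for n
    proof (rule cut_norm_le)
      fix S T assume ST: "S \<in> sets unit_leb" "T \<in> sets unit_leb"
      have "(\<lambda>m. \<bar>rect_int (U n) S T - rect_int (U m) S T\<bar>) \<longlonglongrightarrow> \<bar>rect_int (U n) S T - L (S \<times> T)\<bar>"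
        unfolding set_int_rect[symmetric] using ST by (intro tendsto_intros L) auto
      moreover have "\<forall>m\<ge>N. \<bar>rect_int (U n) S T - rect_int (U m) S T\<bar> \<le> r / 2"
      proof (intro allI impI)
        fix m assume m: "N \<le> m"
        note k = kernel_graphon[OF U[of n]] kernel_graphon[OF U[of m]]
        show "\<bar>rect_int (U n) S T - rect_int (U m) S T\<bar> \<le> r / 2"
          using rect_int_le_cut_norm[OF kernel_diff[OF k] ST] N[OF n m] by (simp add: rect_int_diff[OF k ST])
      qed
      ultimately have "\<bar>rect_int (U n) S T - L (S \<times> T)\<bar> \<le> r / 2" by (blast intro: LIMSEQ_le_const2)
      then show "\<bar>rect_int (\<lambda>x y. U n x y - W x y) S T\<bar> \<le> r / 2"
        using rW[OF ST] by (simp add: rect_int_diff[OF kernel_graphon[OF U] kernel_graphon[OF Wg] ST])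
    qed
    moreover have "0 \<le> cut_norm (\<lambda>x y. U n x y - W x y)" for n
      by (intro cut_norm_nonneg kernel_diff kernel_graphon U Wg)
    ultimately show "\<exists>N. \<forall>n\<ge>N. norm (cut_norm (\<lambda>x y. U n x y - W x y) - 0) < r"
      using r by (intro exI[of _ N]) fastforce
  qed
  then show ?thesis using Wg by blast
qed

end

lemma rect_int_sym:
  assumes W: "W \<in> graphons" and S: "S \<in> sets unit_leb" and T: "T \<in> sets unit_leb"
  shows "rect_int W S T = rect_int W T S"
proof -
  have m: "(\<lambda>z. indicator (T \<times> S) z * W (fst z) (snd z)) \<in> borel_measurable sq_leb"
    using borel_measurable_integrable[OF kernel_rect[OF kernel_graphon[OF W] T S]] .
  have "(LINT z|distr sq_leb sq_leb (\<lambda>z. (snd z, fst z)). indicator (T \<times> S) z * W (fst z) (snd z))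
    = (LINT z|sq_leb. indicator (T \<times> S) (snd z, fst z) * W (snd z) (fst z))"
    by (subst integral_distr[OF swap_sq_leb(1) m]) simp
  also have "\<dots> = rect_int W S T"
    unfolding rect_int_def using W by (intro Bochner_Integration.integral_cong) (auto simp: indicator_def graphons_def)
  finally show ?thesis unfolding swap_sq_leb(2) rect_int_def by simp
qed

subsection \<open>Homomorphism densities\<close>

text \<open>Grouped by their projections, the maps into \<open>K\<close> fall into products of
  fibres of \<pi>, so the weight of each group factors into fibre sums. In other words, projected
  independent draws are independent draws from the image distribution.\<close>

lemma wavg_pullback:
  assumes fin: "finite A" "finite K" "finite I" and pi: "\<pi> ` K \<subseteq> I"
    and x: "\<And>i. i \<in> I \<Longrightarrow> (\<Sum>p\<in>{p\<in>K. \<pi> p = i}. X p) = x i"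
    and F: "\<And>\<Phi> \<Phi>'. (\<And>a. a \<in> A \<Longrightarrow> \<Phi> a = \<Phi>' a) \<Longrightarrow> F \<Phi> = F \<Phi>'"
  shows "wavg A (\<lambda>_. X) K (\<lambda>\<Psi>. F (\<lambda>a. \<pi> (\<Psi> a))) = wavg A (\<lambda>_. x) I F"
proof -
  let ?r = "\<lambda>\<Psi>. restrict (\<lambda>a. \<pi> (\<Psi> a)) A"
  have "wavg A (\<lambda>_. X) K (\<lambda>\<Psi>. F (\<lambda>a. \<pi> (\<Psi> a)))
    = (\<Sum>\<Phi>\<in>A \<rightarrow>\<^sub>E I. \<Sum>\<Psi>\<in>{\<Psi>\<in>A \<rightarrow>\<^sub>E K. ?r \<Psi> = \<Phi>}. (\<Prod>i\<in>A. X (\<Psi> i)) * F (\<lambda>a. \<pi> (\<Psi> a)))"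
    unfolding wavg_def using fin pi
    by (intro sum.group[symmetric]) (auto intro!: finite_PiE simp: image_subset_iff)
  also have "\<dots> = (\<Sum>\<Phi>\<in>A \<rightarrow>\<^sub>E I. (\<Sum>\<Psi>\<in>A \<rightarrow>\<^sub>E K. of_bool (?r \<Psi> = \<Phi>) * (\<Prod>i\<in>A. X (\<Psi> i))) * F \<Phi>)"
  proof (rule sum.cong[OF refl])
    fix \<Phi> assume "\<Phi> \<in> A \<rightarrow>\<^sub>E I"
    have "(\<Sum>\<Psi>\<in>{\<Psi>\<in>A \<rightarrow>\<^sub>E K. ?r \<Psi> = \<Phi>}. (\<Prod>i\<in>A. X (\<Psi> i)) * F (\<lambda>a. \<pi> (\<Psi> a)))
      = (\<Sum>\<Psi>\<in>{\<Psi>\<in>A \<rightarrow>\<^sub>E K. ?r \<Psi> = \<Phi>}. (\<Prod>i\<in>A. X (\<Psi> i)) * F \<Phi>)"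
      by (intro sum.cong refl arg_cong2[where f="(*)"] F) auto
    also have "\<dots> = (\<Sum>\<Psi>\<in>{\<Psi>\<in>A \<rightarrow>\<^sub>E K. ?r \<Psi> = \<Phi>}. (\<Prod>i\<in>A. X (\<Psi> i))) * F \<Phi>"
      by (simp add: sum_distrib_right)
    also have "(\<Sum>\<Psi>\<in>{\<Psi>\<in>A \<rightarrow>\<^sub>E K. ?r \<Psi> = \<Phi>}. (\<Prod>i\<in>A. X (\<Psi> i))) = (\<Sum>\<Psi>\<in>A \<rightarrow>\<^sub>E K. of_bool (?r \<Psi> = \<Phi>) * (\<Prod>i\<in>A. X (\<Psi> i)))"
      using fin by (subst sum_of_bool_mult_eq) (auto intro!: finite_PiE sum.cong)
    finally show "(\<Sum>\<Psi>\<in>{\<Psi>\<in>A \<rightarrow>\<^sub>E K. ?r \<Psi> = \<Phi>}. (\<Prod>i\<in>A. X (\<Psi> i)) * F (\<lambda>a. \<pi> (\<Psi> a)))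
      = (\<Sum>\<Psi>\<in>A \<rightarrow>\<^sub>E K. of_bool (?r \<Psi> = \<Phi>) * (\<Prod>i\<in>A. X (\<Psi> i))) * F \<Phi>" .
  qed
  also have "\<dots> = (\<Sum>\<Phi>\<in>A \<rightarrow>\<^sub>E I. (\<Prod>i\<in>A. x (\<Phi> i)) * F \<Phi>)"
  proof (rule sum.cong[OF refl])
    fix \<Phi> assume P: "\<Phi> \<in> A \<rightarrow>\<^sub>E I"
    have "(\<Prod>i\<in>A. x (\<Phi> i)) = (\<Prod>i\<in>A. \<Sum>p\<in>{p\<in>K. \<pi> p = \<Phi> i}. X p)"
      using P by (intro prod.cong refl x[symmetric]) auto
    also have "\<dots> = (\<Sum>\<Psi>\<in>(\<Pi>\<^sub>E i\<in>A. {p\<in>K. \<pi> p = \<Phi> i}). \<Prod>i\<in>A. X (\<Psi> i))"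
      using fin by (intro prod_sum_PiE) auto
    also have "(\<Pi>\<^sub>E i\<in>A. {p\<in>K. \<pi> p = \<Phi> i}) = (A \<rightarrow>\<^sub>E K) \<inter> {\<Psi>. ?r \<Psi> = \<Phi>}"
    proof (intro set_eqI iffI)
      fix \<Psi> assume a: "\<Psi> \<in> (\<Pi>\<^sub>E i\<in>A. {p\<in>K. \<pi> p = \<Phi> i})"
      have "?r \<Psi> = \<Phi>"
        using a P by (intro extensionalityI[of _ A]) (auto simp: PiE_iff)
      then show "\<Psi> \<in> (A \<rightarrow>\<^sub>E K) \<inter> {\<Psi>. ?r \<Psi> = \<Phi>}" using a by (auto simp: PiE_iff)
    next
      fix \<Psi> assume "\<Psi> \<in> (A \<rightarrow>\<^sub>E K) \<inter> {\<Psi>. ?r \<Psi> = \<Phi>}"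
      then show "\<Psi> \<in> (\<Pi>\<^sub>E i\<in>A. {p\<in>K. \<pi> p = \<Phi> i})" by (auto simp: PiE_iff)
    qed
    also have "(\<Sum>\<Psi>\<in>(A \<rightarrow>\<^sub>E K) \<inter> {\<Psi>. ?r \<Psi> = \<Phi>}. \<Prod>i\<in>A. X (\<Psi> i)) = (\<Sum>\<Psi>\<in>A \<rightarrow>\<^sub>E K. of_bool (?r \<Psi> = \<Phi>) * (\<Prod>i\<in>A. X (\<Psi> i)))"
      using fin by (subst sum_of_bool_mult_eq) (auto intro!: finite_PiE)
    finally show "(\<Sum>\<Psi>\<in>A \<rightarrow>\<^sub>E K. of_bool (?r \<Psi> = \<Phi>) * (\<Prod>i\<in>A. X (\<Psi> i))) * F \<Phi> = (\<Prod>i\<in>A. x (\<Phi> i)) * F \<Phi>" by simp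
  qed
  finally show ?thesis unfolding wavg_def .
qed

text \<open>With the images of all vertices but \<open>u\<close> and \<open>v\<close> fixed, every
  other edge meets at most one of these two. The product therefore splits into a factor depending on
  the image of \<open>u\<close> and one depending on the image of \<open>v\<close>, both in the unit
  interval, and what remains is a fractional test of \<open>m\<close>.\<close>

lemma wavg_edge_bound:
  assumes A: "finite A" "u \<in> A" "v \<in> A" "u \<noteq> v" and K: "finite K"
    and X: "\<And>p. p \<in> K \<Longrightarrow> 0 \<le> X p" "(\<Sum>p\<in>K. X p) = 1"
    and c: "cut_le K X m c" and E: "finite E"
    and uv: "\<And>e. e \<in> E \<Longrightarrow> \<not> (u \<in> {fst e, snd e} \<and> v \<in> {fst e, snd e})"
    and w: "\<And>e a b. 0 \<le> w e a b \<and> w e a b \<le> 1"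
  shows "\<bar>wavg A (\<lambda>_. X) K (\<lambda>\<Psi>. m (\<Psi> u) (\<Psi> v) * (\<Prod>e\<in>E. w e (\<Psi> (fst e)) (\<Psi> (snd e))))\<bar> \<le> c"
proof -
  let ?B = "A - {u} - {v}"
  let ?R = "\<lambda>\<Psi>. \<Prod>e\<in>E. w e (\<Psi> (fst e)) (\<Psi> (snd e))"
  define Eu where "Eu = {e\<in>E. u \<in> {fst e, snd e}}"
  define p where "p = (\<lambda>\<Psi> a. \<Prod>e\<in>Eu. w e ((\<Psi>(u := a)) (fst e)) ((\<Psi>(u := a)) (snd e)))"
  define q where "q = (\<lambda>\<Psi> b. \<Prod>e\<in>E - Eu. w e ((\<Psi>(v := b)) (fst e)) ((\<Psi>(v := b)) (snd e)))"
  have R: "?R (\<Psi>(v := b, u := a)) = p \<Psi> a * q \<Psi> b" for \<Psi> a b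
  proof -
    have "?R (\<Psi>(v := b, u := a)) = (\<Prod>e\<in>E - Eu. w e ((\<Psi>(v := b, u := a)) (fst e)) ((\<Psi>(v := b, u := a)) (snd e)))
        * (\<Prod>e\<in>Eu. w e ((\<Psi>(v := b, u := a)) (fst e)) ((\<Psi>(v := b, u := a)) (snd e)))"
      by (rule prod.subset_diff) (use E in \<open>auto simp: Eu_def\<close>)
    also have "(\<Prod>e\<in>E - Eu. w e ((\<Psi>(v := b, u := a)) (fst e)) ((\<Psi>(v := b, u := a)) (snd e))) = q \<Psi> b"
      unfolding q_def by (intro prod.cong refl) (auto simp: Eu_def)
    also have "(\<Prod>e\<in>Eu. w e ((\<Psi>(v := b, u := a)) (fst e)) ((\<Psi>(v := b, u := a)) (snd e))) = p \<Psi> a"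
      unfolding p_def
    proof (intro prod.cong refl)
      fix e assume "e \<in> Eu"
      then have "fst e \<noteq> v" "snd e \<noteq> v" using uv[of e] by (auto simp: Eu_def)
      then show "w e ((\<Psi>(v := b, u := a)) (fst e)) ((\<Psi>(v := b, u := a)) (snd e)) = w e ((\<Psi>(u := a)) (fst e)) ((\<Psi>(u := a)) (snd e))"
        by simp
    qed
    finally show ?thesis by (simp only: mult.commute)
  qed
  have p01: "0 \<le> p \<Psi> a" "p \<Psi> a \<le> 1" and q01: "0 \<le> q \<Psi> a" "q \<Psi> a \<le> 1" for \<Psi> a
    unfolding p_def q_def using w by (auto intro!: prod_nonneg prod_le_1)
  have "wavg A (\<lambda>_. X) K (\<lambda>\<Psi>. m (\<Psi> u) (\<Psi> v) * ?R \<Psi>)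
     = (\<Sum>a\<in>K. X a * (\<Sum>b\<in>K. X b * wavg ?B (\<lambda>_. X) K (\<lambda>\<Psi>. m a b * (p \<Psi> a * q \<Psi> b))))"
  proof -
    have "wavg A (\<lambda>_. X) K (\<lambda>\<Psi>. m (\<Psi> u) (\<Psi> v) * ?R \<Psi>)
      = (\<Sum>a\<in>K. X a * wavg (A - {u}) (\<lambda>_. X) K (\<lambda>\<Psi>. m ((\<Psi>(u := a)) u) ((\<Psi>(u := a)) v) * ?R (\<Psi>(u := a))))"
      by (rule wavg_split[OF A(1,2)])
    also have "\<dots> = (\<Sum>a\<in>K. X a * (\<Sum>b\<in>K. X b * wavg ?B (\<lambda>_. X) K (\<lambda>\<Psi>. m ((\<Psi>(v := b, u := a)) u) ((\<Psi>(v := b, u := a)) v) * ?R (\<Psi>(v := b, u := a)))))"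
      using A by (intro sum.cong refl arg_cong2[where f="(*)"] wavg_split[of "A - {u}" v "\<lambda>_. X" K]) auto
    finally show ?thesis unfolding R using A(4) by simp
  qed
  also have "\<dots> = (\<Sum>a\<in>K. \<Sum>b\<in>K. wavg ?B (\<lambda>_. X) K (\<lambda>\<Psi>. (X a * p \<Psi> a) * (X b * q \<Psi> b) * m a b))"
    unfolding sum_distrib_left wavg_cmult[symmetric] by (simp add: mult_ac)
  also have "\<dots> = wavg ?B (\<lambda>_. X) K (\<lambda>\<Psi>. \<Sum>a\<in>K. \<Sum>b\<in>K. (X a * p \<Psi> a) * (X b * q \<Psi> b) * m a b)"
    unfolding wavg_sum ..
  finally have eq: "wavg A (\<lambda>_. X) K (\<lambda>\<Psi>. m (\<Psi> u) (\<Psi> v) * ?R \<Psi>)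
     = wavg ?B (\<lambda>_. X) K (\<lambda>\<Psi>. \<Sum>a\<in>K. \<Sum>b\<in>K. (X a * p \<Psi> a) * (X b * q \<Psi> b) * m a b)" .
  have b: "\<bar>\<Sum>a\<in>K. \<Sum>b\<in>K. (X a * p \<Psi> a) * (X b * q \<Psi> b) * m a b\<bar> \<le> c" for \<Psi>
    by (rule cut_le_fractional[OF K c]) (use X p01 q01 in \<open>auto intro!: mult_left_le mult_nonneg_nonneg\<close>)
  have cst: "wavg ?B (\<lambda>_. X) K (\<lambda>_. r) = r" for r
    using A K X by (intro wavg_const) auto
  have "wavg ?B (\<lambda>_. X) K (\<lambda>\<Psi>. \<Sum>a\<in>K. \<Sum>b\<in>K. (X a * p \<Psi> a) * (X b * q \<Psi> b) * m a b) \<le> wavg ?B (\<lambda>_. X) K (\<lambda>_. c)"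
    using X b by (intro wavg_mono) (auto simp: abs_le_iff)
  moreover have "wavg ?B (\<lambda>_. X) K (\<lambda>_. - c) \<le> wavg ?B (\<lambda>_. X) K (\<lambda>\<Psi>. \<Sum>a\<in>K. \<Sum>b\<in>K. (X a * p \<Psi> a) * (X b * q \<Psi> b) * m a b)"
  proof (intro wavg_mono X)
    fix \<Psi> show "- c \<le> (\<Sum>a\<in>K. \<Sum>b\<in>K. (X a * p \<Psi> a) * (X b * q \<Psi> b) * m a b)" using b[of \<Psi>] by linarith
  qed
  ultimately show ?thesis unfolding eq cst by linarith
qed

lemma hom_density_wavg:
  "hom_density F G = wavg {1..nverts F} (\<lambda>_. nweight G) (verts G)
     (\<lambda>\<Phi>. \<Prod>e\<in>simple_edges F. eweight G (\<Phi> (fst e)) (\<Phi> (snd e)))"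
proof -
  have nw: "(\<Prod>i\<in>{1..nverts F}. nweight G (\<Phi> i)) = (\<Prod>i\<in>{1..nverts F}. vweight G (\<Phi> i)) / total_weight G ^ nverts F" for \<Phi>
    by (simp add: nweight_def prod_dividef)
  show ?thesis
    unfolding hom_density_def wavg_def verts_def[of F] sum_distrib_left nw
    by (intro sum.cong refl) (simp add: case_prod_beta)
qed

lemma simple_edges_pairs: "simple_edges F \<subseteq> pairs (nverts F)"
  by (auto simp: simple_edges_def pairs_def verts_def)

text \<open>Both densities are averages over the same coupling, and the weights of \<open>H\<close>
  are replaced by those of \<open>G\<close> one edge at a time. A replacement changes the average by
  the overlay kernel at one edge, multiplied by a product over the other edges;
  \<open>wavg_edge_bound\<close> limits this to \<open>c\<close>.\<close>

lemma counting_lemma: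
  assumes G: "G \<in> wgraphs" and H: "H \<in> wgraphs" and ov: "overlay_le G H c"
  shows "\<bar>hom_density F G - hom_density F H\<bar> \<le> real (card (simple_edges F)) * c"
proof -
  let ?K = "verts G \<times> verts H" and ?A = "{1..nverts F}" and ?E = "simple_edges F"
  obtain X where X: "coupling (verts G) (verts H) (nweight G) (nweight H) X"
    and c: "cut_le ?K X (overlay_kernel G H) c"
    using ov unfolding overlay_le_def by blast
  have X0: "0 \<le> X p" if "p \<in> ?K" for p using X that by (auto simp: coupling_def)
  have X1: "(\<Sum>p\<in>?K. X p) = 1" by (rule coupling_sum[OF X]) (simp_all add: sum_nweight[OF G])
  have E: "finite ?E" using simple_edges_pairs finite_pairs by (rule finite_subset)
  have Ein: "fst e \<in> ?A" "snd e \<in> ?A" "fst e < snd e" if "e \<in> ?E" for e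
    using that simple_edges_pairs[of F] by (auto simp: pairs_def)
  \<comment> \<open>\<open>D\<close> is the set of edges that already carry the weights of
    \<open>G\<close>.\<close>
  define w where "w = (\<lambda>(D::(nat \<times> nat) set) e p q. if e \<in> D then eweight G (fst p) (fst q) else eweight H (snd p) (snd q))"
  define T where "T = (\<lambda>D. wavg ?A (\<lambda>_. X) ?K (\<lambda>\<Psi>. \<Prod>e\<in>?E. w D e (\<Psi> (fst e)) (\<Psi> (snd e))))"
  have w01: "0 \<le> w D e p q \<and> w D e p q \<le> 1" for D e p q
    using eweight_bounds[OF G] eweight_bounds[OF H] by (auto simp: w_def)
  have TE: "T ?E = hom_density F G"
  proof -
    have "T ?E = wavg ?A (\<lambda>_. X) ?K (\<lambda>\<Psi>. (\<lambda>\<Phi>. \<Prod>e\<in>?E. eweight G (\<Phi> (fst e)) (\<Phi> (snd e))) (\<lambda>a. fst (\<Psi> a)))"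
      unfolding T_def by (intro wavg_cong prod.cong) (auto simp: w_def)
    also have "\<dots> = wavg ?A (\<lambda>_. nweight G) (verts G) (\<lambda>\<Phi>. \<Prod>e\<in>?E. eweight G (\<Phi> (fst e)) (\<Phi> (snd e)))"
      by (rule wavg_pullback) (use coupling_fst[OF X] Ein in \<open>auto intro!: prod.cong\<close>)
    finally show ?thesis by (simp add: hom_density_wavg)
  qed
  have T0: "T {} = hom_density F H"
  proof -
    have "T {} = wavg ?A (\<lambda>_. X) ?K (\<lambda>\<Psi>. (\<lambda>\<Phi>. \<Prod>e\<in>?E. eweight H (\<Phi> (fst e)) (\<Phi> (snd e))) (\<lambda>a. snd (\<Psi> a)))"
      unfolding T_def by (intro wavg_cong prod.cong) (auto simp: w_def)
    also have "\<dots> = wavg ?A (\<lambda>_. nweight H) (verts H) (\<lambda>\<Phi>. \<Prod>e\<in>?E. eweight H (\<Phi> (fst e)) (\<Phi> (snd e)))"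
      by (rule wavg_pullback) (use coupling_snd[OF X] Ein in \<open>auto intro!: prod.cong\<close>)
    finally show ?thesis by (simp add: hom_density_wavg)
  qed
  have step: "\<bar>T (insert e D) - T D\<bar> \<le> c" if e: "e \<in> ?E" "e \<notin> D" for e D
  proof -
    let ?R = "\<lambda>D \<Psi>. \<Prod>d\<in>?E - {e}. w D d (\<Psi> (fst d)) (\<Psi> (snd d))"
    have "T (insert e D) - T D = wavg ?A (\<lambda>_. X) ?K (\<lambda>\<Psi>. (\<Prod>d\<in>?E. w (insert e D) d (\<Psi> (fst d)) (\<Psi> (snd d))) - (\<Prod>d\<in>?E. w D d (\<Psi> (fst d)) (\<Psi> (snd d))))"
      unfolding T_def wavg_diff ..
    also have "\<dots> = wavg ?A (\<lambda>_. X) ?K (\<lambda>\<Psi>. overlay_kernel G H (\<Psi> (fst e)) (\<Psi> (snd e)) * ?R D \<Psi>)"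
    proof (rule wavg_cong)
      fix \<Psi>
      have "?R (insert e D) \<Psi> = ?R D \<Psi>" by (intro prod.cong) (auto simp: w_def)
      then show "(\<Prod>d\<in>?E. w (insert e D) d (\<Psi> (fst d)) (\<Psi> (snd d))) - (\<Prod>d\<in>?E. w D d (\<Psi> (fst d)) (\<Psi> (snd d)))
        = overlay_kernel G H (\<Psi> (fst e)) (\<Psi> (snd e)) * ?R D \<Psi>"
        unfolding prod.remove[OF E e(1)] using e(2) by (simp add: w_def left_diff_distrib)
    qed
    also have "\<bar>\<dots>\<bar> \<le> c"
    proof (rule wavg_edge_bound[OF _ _ _ _ _ X0 X1 c])
      show "\<not> (fst e \<in> {fst d, snd d} \<and> snd e \<in> {fst d, snd d})" if "d \<in> ?E - {e}" for d
      proof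
        assume "fst e \<in> {fst d, snd d} \<and> snd e \<in> {fst d, snd d}"
        then have "d = e" using Ein(3)[OF e(1)] Ein(3)[of d] that by (auto simp: prod_eq_iff)
        then show False using that by simp
      qed
    qed (use Ein[OF e(1)] E w01 in auto)
    finally show ?thesis .
  qed
  have "\<bar>T D - T {}\<bar> \<le> real (card D) * c" if "D \<subseteq> ?E" for D
  proof -
    have "finite D" using that E by (rule finite_subset)
    then show ?thesis using that
    proof (induction D rule: finite_induct)
      case (insert e D)
      then have "\<bar>T (insert e D) - T D\<bar> \<le> c" "\<bar>T D - T {}\<bar> \<le> real (card D) * c" using step by auto
      then have "\<bar>T (insert e D) - T {}\<bar> \<le> c + real (card D) * c" by linarith
      then show ?case using insert.hyps by (simp add: distrib_right)
    qed simp
  qed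
  from this[of ?E] show ?thesis using TE T0 by simp
qed

section \<open>Subsequences with convergent homomorphism densities\<close>

lemma hom_density_bounds:
  assumes G: "G \<in> wgraphs"
  shows "0 \<le> hom_density F G" "hom_density F G \<le> 1"
proof -
  let ?P = "\<lambda>\<Phi>. \<Prod>e\<in>simple_edges F. eweight G (\<Phi> (fst e)) (\<Phi> (snd e))"
  have cst: "wavg {1..nverts F} (\<lambda>_. nweight G) (verts G) (\<lambda>_. r) = r" for r
    using sum_nweight[OF G] by (intro wavg_const) auto
  have "0 \<le> ?P \<Phi>" "?P \<Phi> \<le> 1" for \<Phi>
    using eweight_bounds[OF G] by (auto intro!: prod_nonneg prod_le_1)
  then have "wavg {1..nverts F} (\<lambda>_. nweight G) (verts G) (\<lambda>_. 0) \<le> hom_density F G"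
    "hom_density F G \<le> wavg {1..nverts F} (\<lambda>_. nweight G) (verts G) (\<lambda>_. 1)"
    unfolding hom_density_wavg by (auto intro!: wavg_mono nweight_nonneg[OF G])
  then show "0 \<le> hom_density F G" "hom_density F G \<le> 1" unfolding cst .
qed

lemma simple_graph_of_simple:
  assumes "1 \<le> k" "E \<subseteq> pairs k"
  shows "simple_graph_of k E \<in> simple_graphs" "simple_edges (simple_graph_of k E) = E" "nverts (simple_graph_of k E) = k"
  using assms unfolding simple_graphs_def wgraphs_def simple_edges_def verts_def simple_graph_of_def pairs_def
  by auto

lemma simple_graph_eq:
  assumes "F \<in> simple_graphs"
  shows "F = simple_graph_of (nverts F) (simple_edges F)"
proof (rule wgraph.expand, intro conjI)
  have F: "F \<in> wgraphs" and v: "\<And>i. i \<in> verts F \<Longrightarrow> vweight F i = 1"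
    and e: "\<And>i j. i \<in> verts F \<Longrightarrow> j \<in> verts F \<Longrightarrow> eweight F i j \<in> {0, 1}" and l: "\<And>i. i \<in> verts F \<Longrightarrow> eweight F i i = 0"
    using assms by (auto simp: simple_graphs_def)
  have out: "vweight F i = 0" "eweight F i j = 0" "eweight F j i = 0" if "i \<notin> verts F" for i j
    using F that by (auto simp: wgraphs_def)
  show "nverts F = nverts (simple_graph_of (nverts F) (simple_edges F))" by (simp add: simple_graph_of_def)
  show "vweight F = vweight (simple_graph_of (nverts F) (simple_edges F))"
    using v out by (auto simp: simple_graph_of_def fun_eq_iff verts_def)
  show "eweight F = eweight (simple_graph_of (nverts F) (simple_edges F))"
  proof (intro ext)
    fix i j
    show "eweight F i j = eweight (simple_graph_of (nverts F) (simple_edges F)) i j"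
    proof (cases "i \<in> verts F \<and> j \<in> verts F")
      case True
      then have "eweight F i j = 0 \<or> eweight F i j = 1" using e by blast
      then show ?thesis
        using True l eweight_sym[OF F, of i j] by (cases i j rule: linorder_cases) (auto simp: simple_graph_of_def simple_edges_def)
    next
      case False
      then show ?thesis using out by (auto simp: simple_graph_of_def simple_edges_def)
    qed
  qed
qed

lemma countable_simple_graphs: "countable simple_graphs"
proof (rule countable_subset)
  show "simple_graphs \<subseteq> (\<lambda>(k, E). simple_graph_of k E) ` (UNIV \<times> {E. finite E})"
  proof
    fix F assume "F \<in> simple_graphs"
    moreover have "finite (simple_edges F)" using simple_edges_pairs finite_pairs by (rule finite_subset)
    ultimately show "F \<in> (\<lambda>(k, E). simple_graph_of k E) ` (UNIV \<times> {E. finite E})"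
      using simple_graph_eq[of F] by force
  qed
  show "countable ((\<lambda>(k, E). simple_graph_of k E) ` (UNIV \<times> {E::(nat \<times> nat) set. finite E}))"
    by (intro countable_image countable_SIGMA countable_Collect_finite) auto
qed

lemma convergent_subsequence:
  fixes G :: "nat \<Rightarrow> wgraph"
  assumes G: "range G \<subseteq> wgraphs"
  shows "\<exists>r. strict_mono r \<and> convergent_wgraphs (\<lambda>n. G (r n))"
proof -
  have ne: "simple_graphs \<noteq> {}" using simple_graph_of_simple(1)[of 1 "{}"] by auto
  define F where "F = from_nat_into simple_graphs"
  have F: "range F = simple_graphs" unfolding F_def by (rule range_from_nat_into[OF ne countable_simple_graphs])
  interpret subseqs "\<lambda>n s. convergent (\<lambda>i. hom_density (F n) (G (s i)))"
  proof
    fix n and s :: "nat \<Rightarrow> nat"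
    have "bounded (range (\<lambda>i. hom_density (F n) (G (s i))))"
    proof (rule boundedI)
      fix t assume "t \<in> range (\<lambda>i. hom_density (F n) (G (s i)))"
      then obtain i where t: "t = hom_density (F n) (G (s i))" by blast
      have "G (s i) \<in> wgraphs" using G by auto
      from hom_density_bounds[OF this] show "norm t \<le> 1" unfolding t by simp
    qed
    from bounded_imp_convergent_subsequence[OF this]
    obtain l r where "strict_mono r" "((\<lambda>i. hom_density (F n) (G (s i))) \<circ> r) \<longlonglongrightarrow> l" by blast
    then show "\<exists>r'. strict_mono r' \<and> convergent (\<lambda>i. hom_density (F n) (G ((s \<circ> r') i)))"
      by (auto simp: convergent_def comp_def)
  qed
  have "convergent (\<lambda>i. hom_density (F n) (G (diagseq i)))" for n
  proof -
    \<comment> \<open>The \<open>n\<close>-th property is guaranteed for the diagonal sequence only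
      from index \<open>Suc n\<close> on; convergence is not affected by the initial
      segment.\<close>
    have "convergent (\<lambda>i. hom_density (F n) (G ((diagseq \<circ> ((+) (Suc n))) i)))"
    proof (rule diagseq_holds)
      fix r s :: "nat \<Rightarrow> nat" and m
      assume r: "strict_mono r" and "convergent (\<lambda>i. hom_density (F m) (G (s i)))"
      then obtain l where "(\<lambda>i. hom_density (F m) (G (s i))) \<longlonglongrightarrow> l" by (auto simp: convergent_def)
      from LIMSEQ_subseq_LIMSEQ[OF this r] show "convergent (\<lambda>i. hom_density (F m) (G ((s \<circ> r) i)))"
        by (auto simp: convergent_def comp_def)
    qed
    then have "convergent (\<lambda>i. hom_density (F n) (G (diagseq (i + Suc n))))"
      unfolding comp_apply add.commute[of "Suc n"] .
    then show ?thesis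
      using convergent_ignore_initial_segment[of "\<lambda>i. hom_density (F n) (G (diagseq i))" "Suc n"] by blast
  qed
  then have "convergent_wgraphs (\<lambda>n. G (diagseq n))"
    unfolding convergent_wgraphs_def F[symmetric] by auto
  then show ?thesis using subseq_diagseq by blast
qed

section \<open>Sample probabilities as induced densities\<close>

definition sample_pr :: "nat \<Rightarrow> wgraph \<Rightarrow> (nat \<times> nat) set \<Rightarrow> real" where
  "sample_pr k G E = wavg {1..k} (\<lambda>_. nweight G) (verts G) (\<lambda>\<Phi>.
     (\<Prod>e\<in>E. eweight G (\<Phi> (fst e)) (\<Phi> (snd e))) * (\<Prod>e\<in>pairs k - E. 1 - eweight G (\<Phi> (fst e)) (\<Phi> (snd e))))"

lemma sample_avg_sample_pr:
  fixes f :: "wgraph \<Rightarrow> real"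
  shows "sample_avg k G (\<lambda>\<Phi> X. f (sample_graph k X)) = (\<Sum>E\<in>Pow (pairs k). sample_pr k G E * f (simple_graph_of k E))"
proof -
  have inner: "wavg (pairs k) (edge_weight G \<Phi>) UNIV (\<lambda>X. f (sample_graph k X))
    = (\<Sum>E\<in>Pow (pairs k). f (simple_graph_of k E) * ((\<Prod>e\<in>E. eweight G (\<Phi> (fst e)) (\<Phi> (snd e))) * (\<Prod>e\<in>pairs k - E. 1 - eweight G (\<Phi> (fst e)) (\<Phi> (snd e)))))" for \<Phi>
  proof -
    have "wavg (pairs k) (edge_weight G \<Phi>) UNIV (\<lambda>X. f (sample_graph k X))
      = (\<Sum>E\<in>Pow (pairs k). (\<Prod>e\<in>pairs k. edge_weight G \<Phi> e (e \<in> E)) * f (simple_graph_of k E))"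
      unfolding wavg_def
    proof (rule sum.reindex_bij_witness[of _ "\<lambda>E. restrict (\<lambda>e. e \<in> E) (pairs k)" "\<lambda>X. {e\<in>pairs k. X e}"])
      fix X assume X: "X \<in> pairs k \<rightarrow>\<^sub>E (UNIV :: bool set)"
      then show "restrict (\<lambda>e. e \<in> {e\<in>pairs k. X e}) (pairs k) = X"
        by (intro extensionalityI[of _ "pairs k"]) (auto simp: PiE_iff)
      show "(\<Prod>e\<in>pairs k. edge_weight G \<Phi> e (e \<in> {e\<in>pairs k. X e})) * f (simple_graph_of k {e\<in>pairs k. X e})
        = (\<Prod>e\<in>pairs k. edge_weight G \<Phi> e (X e)) * f (sample_graph k X)"
        unfolding sample_graph_def by (intro arg_cong2[where f="(*)"] prod.cong refl) auto
    qed (auto intro: Collect_cong)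
    also have "\<dots> = (\<Sum>E\<in>Pow (pairs k). f (simple_graph_of k E) * ((\<Prod>e\<in>E. eweight G (\<Phi> (fst e)) (\<Phi> (snd e))) * (\<Prod>e\<in>pairs k - E. 1 - eweight G (\<Phi> (fst e)) (\<Phi> (snd e)))))"
    proof (intro sum.cong refl)
      fix E assume E: "E \<in> Pow (pairs k)"
      have "(\<Prod>e\<in>pairs k. edge_weight G \<Phi> e (e \<in> E)) = (\<Prod>e\<in>pairs k - E. edge_weight G \<Phi> e (e \<in> E)) * (\<Prod>e\<in>E. edge_weight G \<Phi> e (e \<in> E))"
        using E by (intro prod.subset_diff) auto
      then show "(\<Prod>e\<in>pairs k. edge_weight G \<Phi> e (e \<in> E)) * f (simple_graph_of k E)
        = f (simple_graph_of k E) * ((\<Prod>e\<in>E. eweight G (\<Phi> (fst e)) (\<Phi> (snd e))) * (\<Prod>e\<in>pairs k - E. 1 - eweight G (\<Phi> (fst e)) (\<Phi> (snd e))))"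
        by (simp add: edge_weight_def Let_def mult_ac)
    qed
    finally show ?thesis .
  qed
  show ?thesis
    unfolding sample_avg_def inner wavg_sum wavg_cmult sample_pr_def by (simp add: mult_ac)
qed

lemma sample_pr_nonneg: "G \<in> wgraphs \<Longrightarrow> 0 \<le> sample_pr k G E"
  unfolding sample_pr_def wavg_def using eweight_bounds[of G] nweight_nonneg[of G]
  by (intro sum_nonneg mult_nonneg_nonneg prod_nonneg) auto

lemma sum_sample_pr: "G \<in> wgraphs \<Longrightarrow> (\<Sum>E\<in>Pow (pairs k). sample_pr k G E) = 1"
  using sample_avg_sample_pr[of k G "\<lambda>_. 1"] sample_avg_const[of G k 1] by simp

text \<open>Inclusion-exclusion, one forbidden edge at a time: forbidding \<open>d\<close> gives the
  average without any condition on \<open>d\<close> minus the average with \<open>d\<close>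
  required. With no forbidden edge left, the average is a homomorphism density.\<close>

lemma convergent_sample_pr:
  assumes c: "convergent_wgraphs G" and k: "1 \<le> k" and E: "E \<subseteq> pairs k"
  shows "convergent (\<lambda>n. sample_pr k (G n) E)"
proof -
  define Q where "Q = (\<lambda>E D n. wavg {1..k} (\<lambda>_. nweight (G n)) (verts (G n)) (\<lambda>\<Phi>.
     (\<Prod>e\<in>E. eweight (G n) (\<Phi> (fst e)) (\<Phi> (snd e))) * (\<Prod>e\<in>D. 1 - eweight (G n) (\<Phi> (fst e)) (\<Phi> (snd e)))))"
  have "convergent (Q E D)" if "finite D" "D \<subseteq> pairs k" "E \<subseteq> pairs k" "D \<inter> E = {}" for D E
    using that
  proof (induction D arbitrary: E rule: finite_induct)
    case empty
    note s = simple_graph_of_simple[OF k empty(2)]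
    have "Q E {} = (\<lambda>n. hom_density (simple_graph_of k E) (G n))"
      by (simp add: Q_def hom_density_wavg s)
    then show ?case using c s(1) by (simp add: convergent_wgraphs_def)
  next
    case (insert d D)
    have finE: "finite E" using insert.prems(2) finite_pairs by (rule finite_subset)
    have "d \<notin> E" using insert.prems by auto
    have "Q E (insert d D) = (\<lambda>n. Q E D n - Q (insert d E) D n)"
    proof
      fix n
      show "Q E (insert d D) n = Q E D n - Q (insert d E) D n"
        unfolding Q_def wavg_diff[symmetric] using insert.hyps finE \<open>d \<notin> E\<close>
        by (intro wavg_cong) (simp add: algebra_simps)
    qed
    moreover have "convergent (Q E D)" "convergent (Q (insert d E) D)"
      using insert.prems insert.hyps by (auto intro!: insert.IH)
    ultimately show ?case using convergent_diff[of "Q E D" "Q (insert d E) D"] by simp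
  qed
  from this[of "pairs k - E" E] E show ?thesis by (auto simp: Q_def sample_pr_def)
qed

lemma convergent_sample_expectation:
  fixes f :: "wgraph \<Rightarrow> real"
  assumes "range G \<subseteq> wgraphs" "convergent_wgraphs G" "1 \<le> k"
  shows "convergent (\<lambda>n. measure_pmf.expectation (random_sample k (G n)) f)"
proof -
  have "(\<lambda>n. measure_pmf.expectation (random_sample k (G n)) f)
    = (\<lambda>n. \<Sum>E\<in>Pow (pairs k). sample_pr k (G n) E * f (simple_graph_of k E))"
  proof (rule ext)
    fix n
    have "G n \<in> wgraphs" using assms(1) by auto
    then show "measure_pmf.expectation (random_sample k (G n)) f = (\<Sum>E\<in>Pow (pairs k). sample_pr k (G n) E * f (simple_graph_of k E))"
      by (simp add: expectation_random_sample sample_avg_sample_pr)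
  qed
  then show ?thesis using convergent_sample_pr[OF assms(2,3)]
    by (auto intro!: convergent_sum convergent_mult convergent_const)
qed

text \<open>For late \<open>m\<close> and \<open>n\<close> the two sample laws differ by at most 1/4
  in total. Under the law of \<open>G m\<close> the set \<open>B m\<close> then has mass at most 1/4
  and \<open>B n\<close> at most 1/4 + 1/4, so some outcome avoids both.\<close>

lemma common_sample:
  assumes G: "range G \<subseteq> wgraphs" and c: "convergent_wgraphs G" and k: "1 \<le> k"
    and B: "\<And>n. N0 \<le> n \<Longrightarrow> measure_pmf.prob (random_sample k (G n)) (B n) \<le> 1 / 4"
  shows "\<exists>N. \<forall>m\<ge>N. \<forall>n\<ge>N. \<exists>X. sample_graph k X \<notin> B m \<and> sample_graph k X \<notin> B n"
proof -
  let ?P = "Pow (pairs k)"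
  define p where "p = (\<lambda>n E. sample_pr k (G n) E)"
  have Gn: "G n \<in> wgraphs" for n using G by auto
  \<comment> \<open>The number of possible samples; a tolerance of \<open>1 / (4 * M)\<close> for
    each adds up to 1/4.\<close>
  define M where "M = real (card ?P)"
  have M: "0 < M" by (simp add: M_def card_Pow)
  have "\<exists>N. \<forall>m\<ge>N. \<forall>n\<ge>N. \<bar>p m E - p n E\<bar> < 1 / (4 * M)" if "E \<in> ?P" for E
  proof -
    have "Cauchy (\<lambda>n. p n E)" unfolding p_def using convergent_sample_pr[OF c k] that by (auto intro: convergent_Cauchy)
    then show ?thesis using M unfolding Cauchy_iff by auto
  qed
  then obtain N where N: "\<And>E m n. E \<in> ?P \<Longrightarrow> N E \<le> m \<Longrightarrow> N E \<le> n \<Longrightarrow> \<bar>p m E - p n E\<bar> < 1 / (4 * M)"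
    by metis
  define N1 where "N1 = max N0 (Max (N ` ?P))"
  have N1: "N0 \<le> N1" "\<And>E. E \<in> ?P \<Longrightarrow> N E \<le> N1"
    by (auto simp: N1_def intro: max.coboundedI2 Max_ge)
  have prob: "measure_pmf.prob (random_sample k (G n)) A = (\<Sum>E\<in>?P. p n E * indicator A (simple_graph_of k E))" for n A
    unfolding p_def prob_random_sample[OF Gn] by (rule sample_avg_sample_pr)
  show ?thesis
  proof (rule exI[of _ N1], intro allI impI, rule ccontr)
    fix m n assume mn: "N1 \<le> m" "N1 \<le> n" and no: "\<nexists>X. sample_graph k X \<notin> B m \<and> sample_graph k X \<notin> B n"
    have all: "simple_graph_of k E \<in> B m \<or> simple_graph_of k E \<in> B n" if "E \<in> ?P" for E
    proof -
      have "sample_graph k (\<lambda>e. e \<in> E) = simple_graph_of k E"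
        unfolding sample_graph_def using that by (intro arg_cong[where f="simple_graph_of k"]) auto
      then show ?thesis using no by metis
    qed
    have "1 = (\<Sum>E\<in>?P. p m E)" unfolding p_def using sum_sample_pr[OF Gn] by simp
    also have "\<dots> \<le> (\<Sum>E\<in>?P. p m E * indicator (B m) (simple_graph_of k E)
        + (p n E * indicator (B n) (simple_graph_of k E) + 1 / (4 * M)))"
    proof (rule sum_mono)
      fix E assume E: "E \<in> ?P"
      have "\<bar>p m E - p n E\<bar> < 1 / (4 * M)" using N[OF E] N1(2)[OF E] mn by force
      moreover have "0 \<le> p m E" "0 \<le> p n E" unfolding p_def by (intro sample_pr_nonneg Gn)+
      moreover have "0 \<le> 1 / (4 * M)" using M by simp
      ultimately show "p m E \<le> p m E * indicator (B m) (simple_graph_of k E)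
        + (p n E * indicator (B n) (simple_graph_of k E) + 1 / (4 * M))"
        using all[OF E] by (cases "simple_graph_of k E \<in> B m"; cases "simple_graph_of k E \<in> B n") simp_all
    qed
    also have "\<dots> = measure_pmf.prob (random_sample k (G m)) (B m) + (measure_pmf.prob (random_sample k (G n)) (B n) + 1 / 4)"
      unfolding prob sum.distrib using M by (auto simp: M_def)
    also have "\<dots> \<le> 1 / 4 + (1 / 4 + 1 / 4)"
      using B[of m] B[of n] N1(1) mn by (intro add_mono) auto
    finally show False by simp
  qed
qed

subsection \<open>Equivalence of the notions of testability\<close>

text \<open>This definition and the next three name the clauses (b) to (e), so that their
  equivalence becomes a propositional consequence of single implications.\<close>

definition mean_testable :: "(wgraph \<Rightarrow> real) \<Rightarrow> bool" where
  "mean_testable f \<longleftrightarrow> (\<forall>\<epsilon>>0. \<exists>k\<ge>1. \<forall>G\<in>wgraphs. max_rel_weight G \<le> 1 / real k \<longrightarrow>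
     \<bar>f G - measure_pmf.expectation (random_sample k G) f\<bar> \<le> \<epsilon>)"

definition limit_testable :: "(wgraph \<Rightarrow> real) \<Rightarrow> bool" where
  "limit_testable f \<longleftrightarrow> (\<forall>G :: nat \<Rightarrow> wgraph. range G \<subseteq> wgraphs \<longrightarrow> convergent_wgraphs G \<longrightarrow>
     (\<lambda>n. max_rel_weight (G n)) \<longlonglongrightarrow> 0 \<longrightarrow> convergent (\<lambda>n. f (G n)))"

definition graphon_extendable :: "(wgraph \<Rightarrow> real) \<Rightarrow> bool" where
  "graphon_extendable f \<longleftrightarrow> (\<exists>g. graphon_functional g \<and> cut_norm_continuous g \<and>
     (\<forall>G :: nat \<Rightarrow> wgraph. range G \<subseteq> wgraphs \<longrightarrow> (\<lambda>n. max_rel_weight (G n)) \<longlonglongrightarrow> 0 \<longrightarrow>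
        (\<lambda>n. g (graphon_of (G n)) - f (G n)) \<longlonglongrightarrow> 0))"

definition cut_uniform :: "(wgraph \<Rightarrow> real) \<Rightarrow> bool" where
  "cut_uniform f \<longleftrightarrow> (\<forall>\<epsilon>>0. \<exists>\<epsilon>\<^sub>0>0. \<exists>n\<^sub>0::nat. n\<^sub>0 > 0 \<and>
     (\<forall>G\<^sub>1\<in>wgraphs. \<forall>G\<^sub>2\<in>wgraphs.
        max_rel_weight G\<^sub>1 \<le> 1 / real n\<^sub>0 \<longrightarrow> max_rel_weight G\<^sub>2 \<le> 1 / real n\<^sub>0 \<longrightarrow>
        wgraph_cut_dist G\<^sub>1 G\<^sub>2 < \<epsilon>\<^sub>0 \<longrightarrow> \<bar>f G\<^sub>1 - f G\<^sub>2\<bar> < \<epsilon>))"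

lemma cut_uniformE:
  assumes "cut_uniform f" "0 < \<epsilon>"
  obtains \<epsilon>\<^sub>0 n\<^sub>0 where "0 < \<epsilon>\<^sub>0" "0 < (n\<^sub>0::nat)"
      "\<forall>G\<^sub>1\<in>wgraphs. \<forall>G\<^sub>2\<in>wgraphs. max_rel_weight G\<^sub>1 \<le> 1 / real n\<^sub>0 \<longrightarrow> max_rel_weight G\<^sub>2 \<le> 1 / real n\<^sub>0 \<longrightarrow>
        wgraph_cut_dist G\<^sub>1 G\<^sub>2 < \<epsilon>\<^sub>0 \<longrightarrow> \<bar>f G\<^sub>1 - f G\<^sub>2\<bar> < \<epsilon>"
proof -
  define P where "P = (\<lambda>\<epsilon>\<^sub>0 (n\<^sub>0::nat). \<forall>G\<^sub>1\<in>wgraphs. \<forall>G\<^sub>2\<in>wgraphs.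
        max_rel_weight G\<^sub>1 \<le> 1 / real n\<^sub>0 \<longrightarrow> max_rel_weight G\<^sub>2 \<le> 1 / real n\<^sub>0 \<longrightarrow>
        wgraph_cut_dist G\<^sub>1 G\<^sub>2 < \<epsilon>\<^sub>0 \<longrightarrow> \<bar>f G\<^sub>1 - f G\<^sub>2\<bar> < \<epsilon>)"
  have "\<exists>\<epsilon>\<^sub>0>0. \<exists>n\<^sub>0. n\<^sub>0 > 0 \<and> P \<epsilon>\<^sub>0 n\<^sub>0"
    unfolding P_def by (rule assms(1)[unfolded cut_uniform_def, rule_format, OF assms(2)])
  then obtain \<epsilon>\<^sub>0 n\<^sub>0 where P: "0 < \<epsilon>\<^sub>0" "0 < n\<^sub>0" "P \<epsilon>\<^sub>0 n\<^sub>0" by blast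
  show thesis by (rule that[OF P(1,2) P(3)[unfolded P_def]])
qed

text \<open>The failure is used with the thresholds \<open>1 / (n + 1)\<close> and
  \<open>n + 1\<close>, so that the weights and the distances shrink along one sequence.\<close>

lemma not_cut_uniformE:
  assumes "\<not> cut_uniform f"
  obtains \<epsilon> A B where "0 < \<epsilon>" "\<forall>n. A n \<in> wgraphs \<and> B n \<in> wgraphs \<and>
    max_rel_weight (A n) \<le> 1 / real (Suc n) \<and> max_rel_weight (B n) \<le> 1 / real (Suc n) \<and>
    wgraph_cut_dist (A n) (B n) < 1 / real (Suc n) \<and> \<epsilon> \<le> \<bar>f (A n) - f (B n)\<bar>"
proof -
  define P where "P = (\<lambda>\<epsilon> \<epsilon>\<^sub>0 (n\<^sub>0::nat). \<forall>G\<^sub>1\<in>wgraphs. \<forall>G\<^sub>2\<in>wgraphs.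
        max_rel_weight G\<^sub>1 \<le> 1 / real n\<^sub>0 \<longrightarrow> max_rel_weight G\<^sub>2 \<le> 1 / real n\<^sub>0 \<longrightarrow>
        wgraph_cut_dist G\<^sub>1 G\<^sub>2 < \<epsilon>\<^sub>0 \<longrightarrow> \<bar>f G\<^sub>1 - f G\<^sub>2\<bar> < \<epsilon>)"
  have "\<not> (\<forall>\<epsilon>>0. \<exists>\<epsilon>\<^sub>0>0. \<exists>n\<^sub>0. n\<^sub>0 > 0 \<and> P \<epsilon> \<epsilon>\<^sub>0 n\<^sub>0)"
    using assms unfolding cut_uniform_def P_def .
  then obtain \<epsilon> where e: "0 < \<epsilon>" and bad: "\<And>\<epsilon>\<^sub>0 n\<^sub>0. 0 < \<epsilon>\<^sub>0 \<Longrightarrow> 0 < n\<^sub>0 \<Longrightarrow> \<not> P \<epsilon> \<epsilon>\<^sub>0 n\<^sub>0" by blast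
  have "\<not> P \<epsilon> (1 / real (Suc n)) (Suc n)" for n by (rule bad) auto
  then have "\<forall>n. \<exists>p. fst p \<in> wgraphs \<and> snd p \<in> wgraphs \<and> max_rel_weight (fst p) \<le> 1 / real (Suc n) \<and> max_rel_weight (snd p) \<le> 1 / real (Suc n) \<and>
     wgraph_cut_dist (fst p) (snd p) < 1 / real (Suc n) \<and> \<epsilon> \<le> \<bar>f (fst p) - f (snd p)\<bar>"
    unfolding P_def by (simp add: not_less) blast
  from choice[OF this] obtain p where p: "\<And>n. fst (p n) \<in> wgraphs \<and> snd (p n) \<in> wgraphs \<and>
     max_rel_weight (fst (p n)) \<le> 1 / real (Suc n) \<and> max_rel_weight (snd (p n)) \<le> 1 / real (Suc n) \<and>
     wgraph_cut_dist (fst (p n)) (snd (p n)) < 1 / real (Suc n) \<and> \<epsilon> \<le> \<bar>f (fst (p n)) - f (snd (p n))\<bar>" by blast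
  show thesis by (rule that[of \<epsilon> "\<lambda>n. fst (p n)" "\<lambda>n. snd (p n)"]) (use e p in auto)
qed

lemma eventually_max_rel_weight_le:
  assumes "(\<lambda>n. max_rel_weight (G n)) \<longlonglongrightarrow> 0" "1 \<le> (k::nat)"
  shows "\<exists>N. \<forall>n\<ge>N. max_rel_weight (G n) \<le> 1 / real k"
proof -
  have "eventually (\<lambda>n. max_rel_weight (G n) < 1 / real k) sequentially"
    using assms by (intro order_tendstoD(2)) auto
  then show ?thesis by (auto simp: eventually_sequentially intro: less_imp_le)
qed

lemma max_rel_weight_nonneg: "G \<in> wgraphs \<Longrightarrow> 0 \<le> max_rel_weight G"
proof -
  assume G: "G \<in> wgraphs"
  then have "1 \<in> verts G" "0 < vweight G 1" by (auto simp: wgraphs_def verts_def)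
  moreover then have "vweight G 1 \<le> Max (vweight G ` verts G)" by (intro Max_ge) auto
  ultimately have "0 \<le> Max (vweight G ` verts G)" by linarith
  then show ?thesis using total_weight_pos[OF G] by (simp add: max_rel_weight_def)
qed

lemma max_rel_weight_tendsto_0:
  assumes "\<And>n. G n \<in> wgraphs" "\<And>n. max_rel_weight (G n) \<le> 1 / real (Suc n)"
  shows "(\<lambda>n. max_rel_weight (G n)) \<longlonglongrightarrow> 0"
proof (rule real_tendsto_sandwich[of "\<lambda>_. 0"])
  show "(\<lambda>n. 1 / real (Suc n)) \<longlonglongrightarrow> 0" using LIMSEQ_inverse_real_of_nat by (simp add: inverse_eq_divide)
qed (use assms max_rel_weight_nonneg in auto)

lemma convergentI_common:
  fixes a :: "nat \<Rightarrow> real"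
  assumes "\<And>e. 0 < e \<Longrightarrow> \<exists>N. \<forall>m\<ge>N. \<forall>n\<ge>N. \<bar>a m - a n\<bar> < e"
  shows "convergent a"
  by (intro Cauchy_convergent CauchyI) (use assms in simp)

lemma testable_imp_limit_testable:
  assumes "testable f"
  shows "limit_testable f"
  unfolding limit_testable_def
proof (intro allI impI)
  fix G :: "nat \<Rightarrow> wgraph"
  assume G: "range G \<subseteq> wgraphs" and c: "convergent_wgraphs G" and m: "(\<lambda>n. max_rel_weight (G n)) \<longlonglongrightarrow> 0"
  show "convergent (\<lambda>n. f (G n))"
  proof (rule convergentI_common)
    fix e :: real assume e: "0 < e"
    \<comment> \<open>1/4 is the mass that \<open>common_sample\<close> allows for a bad set, and
      the way from \<open>G m\<close> to \<open>G n\<close> via a common sample costs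
      \<open>2 * \<epsilon>\<close>.\<close>
    define \<epsilon> where "\<epsilon> = min (e / 3) (1 / 4)"
    have "0 < \<epsilon>" using e by (simp add: \<epsilon>_def)
    then obtain k where k: "1 \<le> k" "\<And>G. G \<in> wgraphs \<Longrightarrow> max_rel_weight G \<le> 1 / real k \<Longrightarrow>
        measure_pmf.prob (random_sample k G) {H. \<bar>f G - f H\<bar> > \<epsilon>} \<le> \<epsilon>"
      using assms unfolding testable_def by blast
    obtain N0 where N0: "\<And>n. N0 \<le> n \<Longrightarrow> max_rel_weight (G n) \<le> 1 / real k"
      using eventually_max_rel_weight_le[OF m k(1)] by blast
    have "measure_pmf.prob (random_sample k (G n)) {H. \<bar>f (G n) - f H\<bar> > \<epsilon>} \<le> 1 / 4" if "N0 \<le> n" for n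
    proof -
      have "G n \<in> wgraphs" using G by auto
      from k(2)[OF this N0[OF that]] show ?thesis by (simp add: \<epsilon>_def)
    qed
    from common_sample[OF G c k(1), of N0 "\<lambda>n. {H. \<bar>f (G n) - f H\<bar> > \<epsilon>}", OF this]
    obtain N where N: "\<And>m n. N \<le> m \<Longrightarrow> N \<le> n \<Longrightarrow> \<exists>X. \<bar>f (G m) - f (sample_graph k X)\<bar> \<le> \<epsilon> \<and> \<bar>f (G n) - f (sample_graph k X)\<bar> \<le> \<epsilon>"
      by (auto simp: not_less)
    have "\<bar>f (G m) - f (G n)\<bar> < e" if "N \<le> m" "N \<le> n" for m n
    proof -
      obtain X where "\<bar>f (G m) - f (sample_graph k X)\<bar> \<le> \<epsilon>" "\<bar>f (G n) - f (sample_graph k X)\<bar> \<le> \<epsilon>" using N[OF \<open>N \<le> m\<close> \<open>N \<le> n\<close>] by blast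
      moreover have "\<epsilon> \<le> e / 3" by (simp add: \<epsilon>_def)
      ultimately show ?thesis using e by linarith
    qed
    then show "\<exists>N. \<forall>m\<ge>N. \<forall>n\<ge>N. \<bar>f (G m) - f (G n)\<bar> < e" by blast
  qed
qed

text \<open>For fixed \<open>k\<close> the expectation is a fixed linear combination of sample
  probabilities. It converges along the sequence, and eventually \<open>f\<close> stays as close to
  it as (b) allows.\<close>

lemma mean_testable_imp_limit_testable:
  assumes "mean_testable f"
  shows "limit_testable f"
  unfolding limit_testable_def
proof (intro allI impI)
  fix G :: "nat \<Rightarrow> wgraph"
  assume G: "range G \<subseteq> wgraphs" and c: "convergent_wgraphs G" and m: "(\<lambda>n. max_rel_weight (G n)) \<longlonglongrightarrow> 0"
  show "convergent (\<lambda>n. f (G n))"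
  proof (rule convergentI_common)
    fix e :: real assume e: "0 < e"
    then obtain k where k: "1 \<le> k" "\<And>G. G \<in> wgraphs \<Longrightarrow> max_rel_weight G \<le> 1 / real k \<Longrightarrow>
        \<bar>f G - measure_pmf.expectation (random_sample k G) f\<bar> \<le> e / 4"
      using assms unfolding mean_testable_def by (metis zero_less_divide_iff zero_less_numeral)
    let ?E = "\<lambda>n. measure_pmf.expectation (random_sample k (G n)) f"
    obtain N0 where N0: "\<And>n. N0 \<le> n \<Longrightarrow> max_rel_weight (G n) \<le> 1 / real k"
      using eventually_max_rel_weight_le[OF m k(1)] by blast
    have "Cauchy ?E" using convergent_sample_expectation[OF G c k(1)] by (rule convergent_Cauchy)
    then obtain N1 where N1: "\<And>m n. N1 \<le> m \<Longrightarrow> N1 \<le> n \<Longrightarrow> \<bar>?E m - ?E n\<bar> < e / 4"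
      using e unfolding Cauchy_iff real_norm_def by (metis zero_less_divide_iff zero_less_numeral)
    have "\<bar>f (G m) - f (G n)\<bar> < e" if "max N0 N1 \<le> m" "max N0 N1 \<le> n" for m n
    proof -
      have "G m \<in> wgraphs" "G n \<in> wgraphs" using G by auto
      then have "\<bar>f (G m) - ?E m\<bar> \<le> e / 4" "\<bar>f (G n) - ?E n\<bar> \<le> e / 4" using k(2) N0 that by auto
      moreover have "\<bar>?E m - ?E n\<bar> < e / 4" using N1 that by auto
      ultimately show ?thesis using e by linarith
    qed
    then show "\<exists>N. \<forall>m\<ge>N. \<forall>n\<ge>N. \<bar>f (G m) - f (G n)\<bar> < e" by blast
  qed
qed

text \<open>If uniform continuity failed, two sequences witnessing this could be thinned out to become convergent;
  by the counting lemma they can then be interleaved into one convergent sequence along which \<open>f\<close> oscillates.\<close>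
lemma limit_testable_imp_cut_uniform:
  assumes c: "limit_testable f"
  shows "cut_uniform f"
proof (rule ccontr)
  assume "\<not> cut_uniform f"
  then obtain \<epsilon> A B where e: "0 < \<epsilon>" and AB: "\<forall>n. A n \<in> wgraphs \<and> B n \<in> wgraphs \<and>
    max_rel_weight (A n) \<le> 1 / real (Suc n) \<and> max_rel_weight (B n) \<le> 1 / real (Suc n) \<and>
    wgraph_cut_dist (A n) (B n) < 1 / real (Suc n) \<and> \<epsilon> \<le> \<bar>f (A n) - f (B n)\<bar>"
    by (rule not_cut_uniformE)
  have A: "A n \<in> wgraphs" and B: "B n \<in> wgraphs"
    and mA: "max_rel_weight (A n) \<le> 1 / real (Suc n)" and mB: "max_rel_weight (B n) \<le> 1 / real (Suc n)"
    and d: "wgraph_cut_dist (A n) (B n) < 1 / real (Suc n)" and f: "\<epsilon> \<le> \<bar>f (A n) - f (B n)\<bar>" for n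
    using AB by blast+
  have inv0: "(\<lambda>n. 1 / real (Suc n)) \<longlonglongrightarrow> 0" using LIMSEQ_inverse_real_of_nat by (simp add: inverse_eq_divide)
  obtain r where r: "strict_mono r" and cA: "convergent_wgraphs (\<lambda>n. A (r n))"
    using convergent_subsequence[of A] A by blast
  define H where "H = (\<lambda>n. if even n then A (r (n div 2)) else B (r (n div 2)))"
  have He: "H (2 * n) = A (r n)" and Ho: "H (2 * n + 1) = B (r n)" for n by (auto simp: H_def)
  have H: "range H \<subseteq> wgraphs" using A B by (auto simp: H_def)
  have interleave: "X \<longlonglongrightarrow> l" if ev: "(\<lambda>n. X (2 * n)) \<longlonglongrightarrow> l" and od: "(\<lambda>n. X (2 * n + 1)) \<longlonglongrightarrow> l" for X :: "nat \<Rightarrow> real" and l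
  proof (rule LIMSEQ_I)
    fix q :: real assume q: "0 < q"
    obtain N1 where N1: "\<And>n. N1 \<le> n \<Longrightarrow> norm (X (2 * n) - l) < q" using LIMSEQ_D[OF ev q] by blast
    obtain N2 where N2: "\<And>n. N2 \<le> n \<Longrightarrow> norm (X (2 * n + 1) - l) < q" using LIMSEQ_D[OF od q] by blast
    have "norm (X n - l) < q" if "2 * (N1 + N2) \<le> n" for n
    proof (cases "even n")
      case True
      then show ?thesis using N1[of "n div 2"] that by auto
    next
      case False
      then show ?thesis using N2[of "n div 2"] that by (auto elim!: oddE)
    qed
    then show "\<exists>N. \<forall>n\<ge>N. norm (X n - l) < q" by blast
  qed
  have mr: "(\<lambda>n. max_rel_weight (G (r n))) \<longlonglongrightarrow> 0" if "\<And>n. G n \<in> wgraphs" "\<And>n. max_rel_weight (G n) \<le> 1 / real (Suc n)" for G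
    using LIMSEQ_subseq_LIMSEQ[OF max_rel_weight_tendsto_0[OF that] r] by (simp add: comp_def)
  have "(\<lambda>n. max_rel_weight (H n)) \<longlonglongrightarrow> 0"
    by (rule interleave) (use mr[OF A mA] mr[OF B mB] in \<open>simp_all only: He Ho\<close>)
  moreover have "convergent_wgraphs H"
    unfolding convergent_wgraphs_def
  proof
    fix F assume F: "F \<in> simple_graphs"
    obtain l where l: "(\<lambda>n. hom_density F (A (r n))) \<longlonglongrightarrow> l"
      using cA F unfolding convergent_wgraphs_def convergent_def by blast
    have "(\<lambda>n. hom_density F (A n) - hom_density F (B n)) \<longlonglongrightarrow> 0"
    proof (rule Lim_null_comparison)
      show "\<forall>\<^sub>F n in sequentially. norm (hom_density F (A n) - hom_density F (B n)) \<le> real (card (simple_edges F)) * (1 / real (Suc n))"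
        using counting_lemma[OF A B overlay_le_cut_dist[OF A B d]] by (intro always_eventually) simp
      show "(\<lambda>n. real (card (simple_edges F)) * (1 / real (Suc n))) \<longlonglongrightarrow> 0"
        using tendsto_mult_right_zero[OF inv0] by simp
    qed
    from LIMSEQ_subseq_LIMSEQ[OF this r]
    have "(\<lambda>n. hom_density F (A (r n)) - hom_density F (B (r n))) \<longlonglongrightarrow> 0" by (simp add: comp_def)
    from tendsto_diff[OF l this] have "(\<lambda>n. hom_density F (B (r n))) \<longlonglongrightarrow> l" by simp
    with l have "(\<lambda>n. hom_density F (H n)) \<longlonglongrightarrow> l"
      by (intro interleave[where X="\<lambda>n. hom_density F (H n)", unfolded He Ho])
    then show "convergent (\<lambda>n. hom_density F (H n))" by (auto simp: convergent_def)
  qed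
  ultimately have "convergent (\<lambda>n. f (H n))" using c H unfolding limit_testable_def by blast
  then obtain l where l: "(\<lambda>n. f (H n)) \<longlonglongrightarrow> l" by (auto simp: convergent_def)
  have "(\<lambda>n. f (H (2 * n))) \<longlonglongrightarrow> l" "(\<lambda>n. f (H (2 * n + 1))) \<longlonglongrightarrow> l"
    using LIMSEQ_subseq_LIMSEQ[OF l, of "\<lambda>n. 2 * n"] LIMSEQ_subseq_LIMSEQ[OF l, of "\<lambda>n. 2 * n + 1"]
    by (auto simp: strict_mono_def comp_def)
  from tendsto_rabs_zero[OF tendsto_diff[OF this, simplified He Ho diff_self]]
  have "(\<lambda>n. \<bar>f (A (r n)) - f (B (r n))\<bar>) \<longlonglongrightarrow> 0" .
  then have "\<epsilon> \<le> 0" using f by (intro LIMSEQ_le_const) auto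
  then show False using e by simp
qed

text \<open>A sample of size \<open>k\<close> has relative vertex weights \<open>1 / k\<close>, so
  for \<open>k\<close> at least \<open>n\<^sub>0\<close> it qualifies for (e) together with
  \<open>G\<close>, and the sampling lemma makes the two close. The conclusion for all large
  \<open>k\<close>, not just for one as in \<open>testable\<close>, is what allows \<open>k\<close>
  to be raised on the way from (a) to (b).\<close>

lemma cut_uniform_imp_prob:
  assumes "cut_uniform f" "0 < \<epsilon>"
  shows "\<exists>k0\<ge>1. \<forall>k\<ge>k0. \<forall>G\<in>wgraphs. max_rel_weight G \<le> 1 / real k \<longrightarrow>
     measure_pmf.prob (random_sample k G) {H. \<bar>f G - f H\<bar> > \<epsilon>} \<le> \<epsilon>"
proof -
  obtain \<epsilon>\<^sub>0 n\<^sub>0 where e0: "0 < \<epsilon>\<^sub>0" and n0: "0 < (n\<^sub>0::nat)"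
    and ub:
      "\<forall>G\<^sub>1\<in>wgraphs. \<forall>G\<^sub>2\<in>wgraphs. max_rel_weight G\<^sub>1 \<le> 1 / real n\<^sub>0 \<longrightarrow> max_rel_weight G\<^sub>2 \<le> 1 / real n\<^sub>0 \<longrightarrow>
        wgraph_cut_dist G\<^sub>1 G\<^sub>2 < \<epsilon>\<^sub>0 \<longrightarrow> \<bar>f G\<^sub>1 - f G\<^sub>2\<bar> < \<epsilon>"
    using assms by (rule cut_uniformE)
  note u = ub[rule_format]
  define \<delta> where "\<delta> = min \<epsilon> (\<epsilon>\<^sub>0 / 2)"
  have "0 < \<delta>" using assms(2) e0 by (simp add: \<delta>_def)
  then obtain k1 where k1: "1 \<le> k1" "\<And>k G. k1 \<le> k \<Longrightarrow> G \<in> wgraphs \<Longrightarrow>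
      measure_pmf.prob (random_sample k G) {H. \<not> overlay_le G H \<delta>} \<le> \<delta>"
    using sampling_overlay by blast
  show ?thesis
  proof (intro exI[of _ "max k1 n\<^sub>0"] conjI allI impI ballI)
    show "1 \<le> max k1 n\<^sub>0" using k1(1) by simp
    fix k G assume k: "max k1 n\<^sub>0 \<le> k" and G: "G \<in> wgraphs" and m: "max_rel_weight G \<le> 1 / real k"
    have k': "1 \<le> k" "1 / real k \<le> 1 / real n\<^sub>0" using k k1(1) n0 by (auto simp: frac_le)
    have "measure_pmf.prob (random_sample k G) {H. \<bar>f G - f H\<bar> > \<epsilon>} \<le> measure_pmf.prob (random_sample k G) {H. \<not> overlay_le G H \<delta>}"
      unfolding prob_random_sample[OF G]
    proof (rule sample_avg_mono[OF G])
      fix \<Phi> :: "nat \<Rightarrow> nat" and X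
      let ?H = "sample_graph k X"
      note H = sample_graph_wgraphs[OF k'(1), of X]
      have "\<bar>f G - f ?H\<bar> < \<epsilon>" if "overlay_le G ?H \<delta>"
      proof (rule u[OF G H])
        show "max_rel_weight G \<le> 1 / real n\<^sub>0" "max_rel_weight ?H \<le> 1 / real n\<^sub>0"
          using m k' max_rel_weight_sample_graph[OF k'(1), of X] by auto
        show "wgraph_cut_dist G ?H < \<epsilon>\<^sub>0"
          using overlay_le_wgraph_cut_dist[OF G H that] e0 by (auto simp: \<delta>_def)
      qed
      then show "indicator {H. \<bar>f G - f H\<bar> > \<epsilon>} ?H \<le> (indicator {H. \<not> overlay_le G H \<delta>} ?H :: real)"
        by (auto simp: indicator_def)
    qed
    also have "\<dots> \<le> \<epsilon>" using k1(2)[of k G] k G by (simp add: \<delta>_def)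
    finally show "measure_pmf.prob (random_sample k G) {H. \<bar>f G - f H\<bar> > \<epsilon>} \<le> \<epsilon>" .
  qed
qed

lemma cut_uniform_imp_testable: "cut_uniform f \<Longrightarrow> testable f"
  unfolding testable_def using cut_uniform_imp_prob by (metis order_refl)

text \<open>There are finitely many simple graphs on \<open>k\<close> vertices, and
  \<open>f G\<close> is within 1/2 of the value at one of them, since a bad event of probability at
  most 1/2 leaves some sample over.\<close>

lemma testable_bounded:
  assumes "testable f"
  shows "\<exists>k\<ge>1. \<exists>M. \<forall>G\<in>wgraphs. max_rel_weight G \<le> 1 / real k \<longrightarrow> \<bar>f G\<bar> \<le> M"
proof -
  obtain k where k: "1 \<le> k" "\<And>G. G \<in> wgraphs \<Longrightarrow> max_rel_weight G \<le> 1 / real k \<Longrightarrow>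
        measure_pmf.prob (random_sample k G) {H. \<bar>f G - f H\<bar> > 1 / 2} \<le> 1 / 2"
    using assms unfolding testable_def by (metis half_gt_zero_iff zero_less_one)
  define M where "M = Max ((\<lambda>E. \<bar>f (simple_graph_of k E)\<bar>) ` Pow (pairs k)) + 1 / 2"
  have "\<bar>f G\<bar> \<le> M" if G: "G \<in> wgraphs" and m: "max_rel_weight G \<le> 1 / real k" for G
  proof -
    have "\<exists>X. \<bar>f G - f (sample_graph k X)\<bar> \<le> 1 / 2"
    proof (rule ccontr)
      assume "\<not> ?thesis"
      then have "indicator {H. \<bar>f G - f H\<bar> > 1 / 2} (sample_graph k X) = (1 :: real)" for X by (auto simp: not_le)
      then have "measure_pmf.prob (random_sample k G) {H. \<bar>f G - f H\<bar> > 1 / 2} = 1"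
        unfolding prob_random_sample[OF G] by (simp add: sample_avg_const[OF G])
      then show False using k(2)[OF G m] by simp
    qed
    then obtain X where X: "\<bar>f G - f (sample_graph k X)\<bar> \<le> 1 / 2" by blast
    have "\<bar>f (sample_graph k X)\<bar> \<le> Max ((\<lambda>E. \<bar>f (simple_graph_of k E)\<bar>) ` Pow (pairs k))"
      unfolding sample_graph_def by (intro Max_ge) auto
    then show ?thesis using X unfolding M_def by linarith
  qed
  then show ?thesis using k(1) by blast
qed

text \<open>Closeness in probability gives closeness in the mean once \<open>f\<close> is bounded.
  The bound holds only for small vertex weights, so \<open>k\<close> is taken at least
  \<open>k1\<close>, where it covers both \<open>G\<close> and the sample.\<close>

lemma testable_imp_mean_testable:
  assumes t: "testable f"
  shows "mean_testable f"
  unfolding mean_testable_def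
proof (intro allI impI)
  fix \<epsilon> :: real assume e: "0 < \<epsilon>"
  obtain k1 M where k1: "1 \<le> k1" and M: "\<And>G. G \<in> wgraphs \<Longrightarrow> max_rel_weight G \<le> 1 / real k1 \<Longrightarrow> \<bar>f G\<bar> \<le> M"
    using testable_bounded[OF t] by blast
  define M' where "M' = max M 0"
  \<comment> \<open>A deviation of \<delta> in general, and of \<open>2 * M'\<close> on an event of
    mass \<delta>, add up to \<epsilon>.\<close>
  define \<delta> where "\<delta> = \<epsilon> / (1 + 2 * M')"
  have M': "0 \<le> M'" by (simp add: M'_def)
  have "0 < \<delta>" "\<delta> * (1 + 2 * M') = \<epsilon>" using e M' by (simp_all add: \<delta>_def)
  then have d: "0 < \<delta>" "\<delta> + 2 * M' * \<delta> = \<epsilon>" by (simp_all add: algebra_simps)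
  obtain k0 where k0: "\<And>k G. k0 \<le> k \<Longrightarrow> G \<in> wgraphs \<Longrightarrow> max_rel_weight G \<le> 1 / real k \<Longrightarrow>
      measure_pmf.prob (random_sample k G) {H. \<bar>f G - f H\<bar> > \<delta>} \<le> \<delta>"
    using cut_uniform_imp_prob[OF limit_testable_imp_cut_uniform[OF testable_imp_limit_testable[OF t]] d(1)] by blast
  define k where "k = max k0 k1"
  have k: "1 \<le> k" "k0 \<le> k" "1 / real k \<le> 1 / real k1" using k1 by (auto simp: k_def frac_le)
  show "\<exists>k\<ge>1. \<forall>G\<in>wgraphs. max_rel_weight G \<le> 1 / real k \<longrightarrow> \<bar>f G - measure_pmf.expectation (random_sample k G) f\<bar> \<le> \<epsilon>"
  proof (intro exI[of _ k] conjI ballI impI k(1))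
    fix G assume G: "G \<in> wgraphs" and m: "max_rel_weight G \<le> 1 / real k"
    let ?B = "{H. \<bar>f G - f H\<bar> > \<delta>}"
    let ?i = "\<lambda>X. indicator ?B (sample_graph k X) :: real"
    have fG: "\<bar>f G\<bar> \<le> M'" using M[OF G] m k(3) by (auto simp: M'_def)
    have pt: "\<bar>f G - f (sample_graph k X)\<bar> \<le> \<delta> + 2 * M' * ?i X" for X
    proof -
      have "\<bar>f (sample_graph k X)\<bar> \<le> M'"
        using M[OF sample_graph_wgraphs[OF k(1), of X]] max_rel_weight_sample_graph[OF k(1), of X] k(3) by (auto simp: M'_def)
      then show ?thesis using fG d(1) by (auto simp: indicator_def)
    qed
    have up: "sample_avg k G (\<lambda>\<Phi> X. \<delta> + 2 * M' * ?i X) \<le> \<epsilon>"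
    proof -
      have "sample_avg k G (\<lambda>\<Phi> X. \<delta> + 2 * M' * ?i X) = \<delta> + 2 * M' * measure_pmf.prob (random_sample k G) ?B"
        unfolding sample_avg_add sample_avg_cmult sample_avg_const[OF G] prob_random_sample[OF G] ..
      also have "\<dots> \<le> \<delta> + 2 * M' * \<delta>"
        using k0[OF k(2) G m] M' by (intro add_left_mono mult_left_mono) auto
      finally show ?thesis using d(2) by simp
    qed
    let ?E = "sample_avg k G (\<lambda>\<Phi> X. f (sample_graph k X))"
    have "?E \<le> sample_avg k G (\<lambda>\<Phi> X. f G + (\<delta> + 2 * M' * ?i X))"
    proof (rule sample_avg_mono[OF G])
      fix X show "f (sample_graph k X) \<le> f G + (\<delta> + 2 * M' * ?i X)" using pt[of X] by linarith
    qed
    moreover have "sample_avg k G (\<lambda>\<Phi> X. f G) \<le> sample_avg k G (\<lambda>\<Phi> X. f (sample_graph k X) + (\<delta> + 2 * M' * ?i X))"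
    proof (rule sample_avg_mono[OF G])
      fix X show "f G \<le> f (sample_graph k X) + (\<delta> + 2 * M' * ?i X)" using pt[of X] by linarith
    qed
    ultimately have "\<bar>f G - ?E\<bar> \<le> \<epsilon>"
      using up unfolding sample_avg_add[of k G "\<lambda>\<Phi> X. f G"] sample_avg_add[of k G "\<lambda>\<Phi> X. f (sample_graph k X)"] sample_avg_const[OF G]
      by linarith
    then show "\<bar>f G - measure_pmf.expectation (random_sample k G) f\<bar> \<le> \<epsilon>"
      unfolding expectation_random_sample[OF G] .
  qed
qed

text \<open>The extension sends a graphon \<open>W\<close> to the limit of \<open>f\<close> along step approximations of \<open>W\<close> in \<open>L\<^sup>1\<close>.\<close>
lemma cut_uniform_imp_graphon_extendable:
  assumes u: "cut_uniform f"
  shows "graphon_extendable f"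
proof -
  define Q where "Q = (\<lambda>W n G. G \<in> wgraphs \<and> max_rel_weight G \<le> 1 / real (Suc n)
    \<and> l1_norm (\<lambda>x y. W x y - graphon_of G x y) < 1 / real (Suc n))"
  have ex: "\<exists>G. Q W n G" if "W \<in> graphons" for W n
    using graphon_L1_approx[OF that, of "1 / real (Suc n)" "Suc n"] unfolding Q_def by auto
  define A where "A = (\<lambda>W n. SOME G. Q W n G)"
  have QA: "Q W n (A W n)" if "W \<in> graphons" for W n unfolding A_def using ex[OF that] by (rule someI_ex)
  have A: "A W n \<in> wgraphs" and mA: "max_rel_weight (A W n) \<le> 1 / real (Suc n)"
    and lA: "l1_norm (\<lambda>x y. W x y - graphon_of (A W n) x y) < 1 / real (Suc n)" if "W \<in> graphons" for W n
    using QA[OF that, of n] unfolding Q_def by blast+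
  note g = graphon_of_in_graphons
  \<comment> \<open>The approximation of \<open>V\<close> has to be pulled back along \<nu> together
    with \<open>V\<close>. Its error is measured in the \<open>l1_norm\<close>, which the pull-back
    preserves.\<close>
  have near: "cut_norm (\<lambda>x y. graphon_of (A W m) x y - graphon_of (A V n) (\<nu> x) (\<nu> y))
     < cut_norm (\<lambda>x y. W x y - V (\<nu> x) (\<nu> y)) + 1 / real (Suc m) + 1 / real (Suc n)"
    if W: "W \<in> graphons" and V: "V \<in> graphons" and n: "\<nu> \<in> mp_bijections" for W V \<nu> m n
  proof -
    note k1 = kernel_graphon[OF g[OF A[OF W, of m]]] and k2 = kernel_graphon[OF W]
      and k3 = kernel_graphon[OF graphons_pull[OF V n]] and k4 = kernel_graphon[OF graphons_pull[OF g[OF A[OF V, of n]] n]]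
    have "cut_norm (\<lambda>x y. V (\<nu> x) (\<nu> y) - graphon_of (A V n) (\<nu> x) (\<nu> y)) \<le> l1_norm (\<lambda>x y. V (\<nu> x) (\<nu> y) - graphon_of (A V n) (\<nu> x) (\<nu> y))"
      by (rule cut_norm_le_l1[OF kernel_diff[OF k3 k4]])
    also have "\<dots> = l1_norm (\<lambda>x y. V x y - graphon_of (A V n) x y)"
      by (rule l1_norm_pull[OF n kernel_diff[OF kernel_graphon[OF V] kernel_graphon[OF g[OF A[OF V]]]]])
    finally have "cut_norm (\<lambda>x y. V (\<nu> x) (\<nu> y) - graphon_of (A V n) (\<nu> x) (\<nu> y)) < 1 / real (Suc n)" using lA[OF V, of n] by linarith
    moreover have "cut_norm (\<lambda>x y. graphon_of (A W m) x y - W x y) < 1 / real (Suc m)"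
      unfolding cut_norm_commute[of "graphon_of (A W m)"] using cut_norm_le_l1[OF kernel_diff[OF k2 k1]] lA[OF W, of m] by linarith
    ultimately show ?thesis
      using cut_norm_triangle[OF k1 k2 k4] cut_norm_triangle[OF k2 k3 k4] by linarith
  qed
  have inv0: "(\<lambda>n. 1 / real (Suc n)) \<longlonglongrightarrow> 0" using LIMSEQ_inverse_real_of_nat by (simp add: inverse_eq_divide)
  have small: "\<exists>N. \<forall>n\<ge>N. 1 / real (Suc n) < e" if "0 < e" for e
    using order_tendstoD(2)[OF inv0 that] by (auto simp: eventually_sequentially)
  \<comment> \<open>\<open>d\<close> and \<open>N\<close> do not depend on \<open>W\<close>,
    \<open>V\<close> or \<nu>. The identity as \<nu> yields existence of the limits and continuity;
    general \<nu> yields invariance under cut distance 0.\<close>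
  have key: "\<exists>d>0. \<exists>N. \<forall>W\<in>graphons. \<forall>V\<in>graphons. \<forall>\<nu>\<in>mp_bijections. cut_norm (\<lambda>x y. W x y - V (\<nu> x) (\<nu> y)) < d \<longrightarrow>
      (\<forall>m\<ge>N. \<forall>n\<ge>N. \<bar>f (A W m) - f (A V n)\<bar> < e)" if e: "0 < e" for e
  proof -
    obtain \<epsilon>\<^sub>0 n\<^sub>0 where e0: "0 < \<epsilon>\<^sub>0" and n0: "0 < (n\<^sub>0::nat)"
      and ub:
      "\<forall>G\<^sub>1\<in>wgraphs. \<forall>G\<^sub>2\<in>wgraphs. max_rel_weight G\<^sub>1 \<le> 1 / real n\<^sub>0 \<longrightarrow> max_rel_weight G\<^sub>2 \<le> 1 / real n\<^sub>0 \<longrightarrow>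
        wgraph_cut_dist G\<^sub>1 G\<^sub>2 < \<epsilon>\<^sub>0 \<longrightarrow> \<bar>f G\<^sub>1 - f G\<^sub>2\<bar> < e"
      using u e by (rule cut_uniformE)
    note u = ub[rule_format]
    obtain N where N: "\<And>n. N \<le> n \<Longrightarrow> 1 / real (Suc n) < \<epsilon>\<^sub>0 / 3" using small[of "\<epsilon>\<^sub>0 / 3"] e0 by auto
    show ?thesis
    proof (intro exI[of _ "\<epsilon>\<^sub>0 / 3"] exI[of _ "max N n\<^sub>0"] conjI ballI impI allI)
      show "0 < \<epsilon>\<^sub>0 / 3" using e0 by simp
      fix W V \<nu> m n assume W: "W \<in> graphons" and V: "V \<in> graphons" and nu: "\<nu> \<in> mp_bijections"
        and c: "cut_norm (\<lambda>x y. W x y - V (\<nu> x) (\<nu> y)) < \<epsilon>\<^sub>0 / 3" and mn: "max N n\<^sub>0 \<le> m" "max N n\<^sub>0 \<le> n"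
      have le: "1 / real (Suc i) \<le> 1 / real n\<^sub>0" if "max N n\<^sub>0 \<le> i" for i
        using that n0 by (intro frac_le) auto
      show "\<bar>f (A W m) - f (A V n)\<bar> < e"
      proof (rule u[OF A[OF W] A[OF V]])
        show "max_rel_weight (A W m) \<le> 1 / real n\<^sub>0" "max_rel_weight (A V n) \<le> 1 / real n\<^sub>0"
          using mA[OF W, of m] mA[OF V, of n] le mn by (meson order_trans)+
        have "wgraph_cut_dist (A W m) (A V n) \<le> cut_norm (\<lambda>x y. graphon_of (A W m) x y - graphon_of (A V n) (\<nu> x) (\<nu> y))"
          unfolding wgraph_cut_dist_def by (rule cut_dist_le[OF g[OF A[OF W]] g[OF A[OF V]] nu])
        also have "\<dots> < \<epsilon>\<^sub>0 / 3 + \<epsilon>\<^sub>0 / 3 + \<epsilon>\<^sub>0 / 3"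
          using near[OF W V nu, of m n] c N[of m] N[of n] mn by fastforce
        finally show "wgraph_cut_dist (A W m) (A V n) < \<epsilon>\<^sub>0" by simp
      qed
    qed
  qed
  define h where "h = (\<lambda>W. lim (\<lambda>n. f (A W n)))"
  have self: "cut_norm (\<lambda>x y. W x y - W x y) = 0" for W
  proof -
    have "kernel (\<lambda>x y. W x y - W x y)" by (simp add: kernel_def)
    moreover have "cut_norm (\<lambda>x y. W x y - W x y) \<le> 0" by (rule cut_norm_le) (simp add: rect_int_def)
    ultimately show ?thesis using cut_norm_nonneg[of "\<lambda>x y. W x y - W x y"] by linarith
  qed
  have h: "(\<lambda>n. f (A W n)) \<longlonglongrightarrow> h W" if W: "W \<in> graphons" for W
  proof -
    have "convergent (\<lambda>n. f (A W n))"
    proof (rule convergentI_common)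
      fix e :: real assume "0 < e"
      from key[OF this] obtain d N where d: "0 < d" and N: "\<forall>W\<in>graphons. \<forall>V\<in>graphons. \<forall>\<nu>\<in>mp_bijections. cut_norm (\<lambda>x y. W x y - V (\<nu> x) (\<nu> y)) < d \<longrightarrow>
        (\<forall>m\<ge>N. \<forall>n\<ge>N. \<bar>f (A W m) - f (A V n)\<bar> < e)" by blast
      have "cut_norm (\<lambda>x y. W x y - W x y) < d" using self[of W] d by simp
      note bound = N[rule_format, OF W W id_mp_bijections this]
      show "\<exists>N. \<forall>m\<ge>N. \<forall>n\<ge>N. \<bar>f (A W m) - f (A W n)\<bar> < e"
        by (rule exI[of _ N]) (intro allI impI bound)
    qed
    then show ?thesis unfolding h_def by (simp add: convergent_LIMSEQ_iff)
  qed
  have hkey: "\<exists>d>0. \<forall>W\<in>graphons. \<forall>V\<in>graphons. \<forall>\<nu>\<in>mp_bijections. cut_norm (\<lambda>x y. W x y - V (\<nu> x) (\<nu> y)) < d \<longrightarrow> \<bar>h W - h V\<bar> < e" if e: "0 < e" for e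
  proof -
    from key[OF half_gt_zero[OF e]] obtain d N where d: "0 < d" and Nb: "\<forall>W\<in>graphons. \<forall>V\<in>graphons. \<forall>\<nu>\<in>mp_bijections. cut_norm (\<lambda>x y. W x y - V (\<nu> x) (\<nu> y)) < d \<longrightarrow>
      (\<forall>m\<ge>N. \<forall>n\<ge>N. \<bar>f (A W m) - f (A V n)\<bar> < e / 2)" by blast
    note N = Nb[rule_format]
    have "\<bar>h W - h V\<bar> < e" if W: "W \<in> graphons" and V: "V \<in> graphons" and "\<nu> \<in> mp_bijections" "cut_norm (\<lambda>x y. W x y - V (\<nu> x) (\<nu> y)) < d" for W V \<nu>
    proof -
      have "(\<lambda>n. \<bar>f (A W n) - f (A V n)\<bar>) \<longlonglongrightarrow> \<bar>h W - h V\<bar>" by (intro tendsto_intros h W V)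
      moreover have "\<forall>n\<ge>N. \<bar>f (A W n) - f (A V n)\<bar> \<le> e / 2" using N[OF that] by (auto intro: less_imp_le)
      ultimately have "\<bar>h W - h V\<bar> \<le> e / 2" by (blast intro: LIMSEQ_le_const2)
      then show ?thesis using e by simp
    qed
    then show ?thesis using d by blast
  qed
  have "graphon_functional h"
    unfolding graphon_functional_def
  proof (intro ballI impI)
    fix W V assume W: "W \<in> graphons" and V: "V \<in> graphons" and z: "cut_dist W V = 0"
    have "\<bar>h W - h V\<bar> < e" if e: "0 < e" for e
    proof -
      obtain d where d: "0 < d" "\<forall>W\<in>graphons. \<forall>V\<in>graphons. \<forall>\<nu>\<in>mp_bijections. cut_norm (\<lambda>x y. W x y - V (\<nu> x) (\<nu> y)) < d \<longrightarrow> \<bar>h W - h V\<bar> < e"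
        using hkey[OF e] by blast
      obtain \<nu> where "\<nu> \<in> mp_bijections" "cut_norm (\<lambda>x y. W x y - V (\<nu> x) (\<nu> y)) < d"
        using cut_dist_lessE[OF W V, of d] z d(1) by auto
      then show ?thesis using d(2) W V by blast
    qed
    from this[of "\<bar>h W - h V\<bar>"] show "h W = h V" by fastforce
  qed
  moreover have "cut_norm_continuous h"
    unfolding cut_norm_continuous_def
  proof (intro ballI allI impI)
    fix W and e :: real assume W: "W \<in> graphons" and e: "0 < e"
    obtain d where d: "0 < d" "\<forall>W\<in>graphons. \<forall>V\<in>graphons. \<forall>\<nu>\<in>mp_bijections. cut_norm (\<lambda>x y. W x y - V (\<nu> x) (\<nu> y)) < d \<longrightarrow> \<bar>h W - h V\<bar> < e"
      using hkey[OF e] by blast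
    have "\<bar>h V - h W\<bar> < e" if "V \<in> graphons" "cut_norm (\<lambda>x y. V x y - W x y) < d" for V
      using d(2)[rule_format, OF that(1) W id_mp_bijections that(2)] .
    then show "\<exists>\<delta>>0. \<forall>U\<in>graphons. cut_norm (\<lambda>x y. U x y - W x y) < \<delta> \<longrightarrow> \<bar>h U - h W\<bar> < e" using d(1) by blast
  qed
  moreover have "(\<lambda>n. h (graphon_of (G n)) - f (G n)) \<longlonglongrightarrow> 0"
    if G: "range G \<subseteq> wgraphs" and m: "(\<lambda>n. max_rel_weight (G n)) \<longlonglongrightarrow> 0" for G :: "nat \<Rightarrow> wgraph"
  proof (rule LIMSEQ_I)
    fix r :: real assume r: "0 < r"
    obtain \<epsilon>\<^sub>0 n\<^sub>0 where e0: "0 < \<epsilon>\<^sub>0" and n0: "0 < (n\<^sub>0::nat)"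
      and ub:
      "\<forall>G\<^sub>1\<in>wgraphs. \<forall>G\<^sub>2\<in>wgraphs. max_rel_weight G\<^sub>1 \<le> 1 / real n\<^sub>0 \<longrightarrow> max_rel_weight G\<^sub>2 \<le> 1 / real n\<^sub>0 \<longrightarrow>
        wgraph_cut_dist G\<^sub>1 G\<^sub>2 < \<epsilon>\<^sub>0 \<longrightarrow> \<bar>f G\<^sub>1 - f G\<^sub>2\<bar> < r / 2"
      using u half_gt_zero[OF r] by (rule cut_uniformE)
    note u = ub[rule_format]
    obtain N where N: "\<And>n. N \<le> n \<Longrightarrow> max_rel_weight (G n) \<le> 1 / real n\<^sub>0"
      using eventually_max_rel_weight_le[OF m, of n\<^sub>0] n0 by auto
    obtain K where K: "\<And>n. K \<le> n \<Longrightarrow> 1 / real (Suc n) < \<epsilon>\<^sub>0" using small[OF e0] by blast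
    have "\<bar>h (graphon_of (G n)) - f (G n)\<bar> < r" if n: "N \<le> n" for n
    proof -
      have Gn: "G n \<in> wgraphs" using G by auto
      let ?W = "graphon_of (G n)"
      note W = g[OF Gn]
      \<comment> \<open>\<open>G n\<close> and the approximations of its own step function are close
        in cut distance, so (e) compares \<open>f\<close> on them; for \<open>n\<close> only the
        bound on the weights of \<open>G n\<close> matters.\<close>
      have "\<bar>f (A ?W k) - f (G n)\<bar> \<le> r / 2" if k: "max K n\<^sub>0 \<le> k" for k
      proof (rule less_imp_le, rule u[OF A[OF W] Gn _ N[OF n]])
        have "1 / real (Suc k) \<le> 1 / real n\<^sub>0" using k n0 by (intro frac_le) auto
        then show "max_rel_weight (A ?W k) \<le> 1 / real n\<^sub>0" using mA[OF W, of k] by linarith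
        have "wgraph_cut_dist (A ?W k) (G n) \<le> cut_norm (\<lambda>x y. graphon_of (A ?W k) x y - ?W x y)"
          unfolding wgraph_cut_dist_def by (rule cut_dist_le[OF g[OF A[OF W]] W id_mp_bijections])
        also have "\<dots> = cut_norm (\<lambda>x y. ?W x y - graphon_of (A ?W k) x y)" by (rule cut_norm_commute)
        also have "\<dots> \<le> l1_norm (\<lambda>x y. ?W x y - graphon_of (A ?W k) x y)"
          by (intro cut_norm_le_l1 kernel_diff kernel_graphon W g A)
        also have "\<dots> < 1 / real (Suc k)" by (rule lA[OF W])
        also have "\<dots> < \<epsilon>\<^sub>0" using K k by simp
        finally show "wgraph_cut_dist (A ?W k) (G n) < \<epsilon>\<^sub>0" .
      qed
      moreover have "(\<lambda>k. \<bar>f (A ?W k) - f (G n)\<bar>) \<longlonglongrightarrow> \<bar>h ?W - f (G n)\<bar>" by (intro tendsto_intros h W)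
      ultimately have "\<bar>h ?W - f (G n)\<bar> \<le> r / 2" by (blast intro: LIMSEQ_le_const2)
      then show ?thesis using r by simp
    qed
    then show "\<exists>N. \<forall>n\<ge>N. norm (h (graphon_of (G n)) - f (G n) - 0) < r" by auto
  qed
  ultimately show ?thesis unfolding graphon_extendable_def by blast
qed

text \<open>By \<open>sampling_overlay\<close> each graph is close to its typical samples, and by
  \<open>common_sample\<close> two late graphs share such a sample. The triangle inequality bounds
  their distance by \<open>2 * \<delta>\<close>.\<close>

lemma convergent_imp_cut_Cauchy:
  assumes G: "range G \<subseteq> wgraphs" and c: "convergent_wgraphs G" and e: "0 < e"
  shows "\<exists>N. \<forall>m\<ge>N. \<forall>n\<ge>N. wgraph_cut_dist (G m) (G n) < e"
proof -
  define \<delta> where "\<delta> = min (e / 3) (1 / 4)"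
  have "0 < \<delta>" using e by (simp add: \<delta>_def)
  then obtain k where k: "1 \<le> k" "\<And>G. G \<in> wgraphs \<Longrightarrow> measure_pmf.prob (random_sample k G) {H. \<not> overlay_le G H \<delta>} \<le> \<delta>"
    using sampling_overlay by (metis order_refl)
  have Gn: "G n \<in> wgraphs" for n using G by auto
  have "measure_pmf.prob (random_sample k (G n)) {H. \<not> overlay_le (G n) H \<delta>} \<le> 1 / 4" if "0 \<le> n" for n
    using k(2)[OF Gn[of n]] by (simp add: \<delta>_def)
  from common_sample[OF G c k(1), of 0 "\<lambda>n. {H. \<not> overlay_le (G n) H \<delta>}", OF this]
  obtain N where N: "\<And>m n. N \<le> m \<Longrightarrow> N \<le> n \<Longrightarrow> \<exists>X. overlay_le (G m) (sample_graph k X) \<delta> \<and> overlay_le (G n) (sample_graph k X) \<delta>"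
    by auto
  have "wgraph_cut_dist (G m) (G n) < e" if "N \<le> m" "N \<le> n" for m n
  proof -
    obtain X where X: "overlay_le (G m) (sample_graph k X) \<delta>" "overlay_le (G n) (sample_graph k X) \<delta>"
      using N[OF \<open>N \<le> m\<close> \<open>N \<le> n\<close>] by blast
    note H = sample_graph_wgraphs[OF k(1), of X]
    have "wgraph_cut_dist (G m) (G n) \<le> \<delta> + \<delta>"
      using wgraph_cut_dist_triangle[OF Gn H Gn, of m n] overlay_le_wgraph_cut_dist[OF Gn H X(1)]
        overlay_le_wgraph_cut_dist[OF H Gn overlay_le_commute[OF X(2)]] by linarith
    moreover have "\<delta> \<le> e / 3" by (simp add: \<delta>_def)
    ultimately show ?thesis using e by linarith
  qed
  then show ?thesis by blast
qed

lemma fast_Cauchy_subsequence: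
  fixes d :: "nat \<Rightarrow> nat \<Rightarrow> real"
  assumes "\<And>e. 0 < e \<Longrightarrow> \<exists>N. \<forall>m\<ge>N. \<forall>n\<ge>N. d m n < e"
  shows "\<exists>r. strict_mono r \<and> (\<forall>n. d (r n) (r (Suc n)) < (1 / 2) ^ n)"
proof -
  have "\<exists>N. \<forall>m\<ge>N. \<forall>k\<ge>N. d m k < (1 / 2) ^ n" for n by (rule assms) simp
  then obtain N where N: "\<And>n m k. N n \<le> m \<Longrightarrow> N n \<le> k \<Longrightarrow> d m k < (1 / 2) ^ n" by metis
  define r where "r = rec_nat (N 0) (\<lambda>n x. Suc (max x (N (Suc n))))"
  have r0: "r 0 = N 0" and rS: "r (Suc n) = Suc (max (r n) (N (Suc n)))" for n by (simp_all add: r_def)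
  have mono: "strict_mono r" by (simp add: strict_mono_Suc_iff rS less_Suc_eq_le)
  have ge: "N n \<le> r n" for n by (cases n) (auto simp: r0 rS)
  have "d (r n) (r (Suc n)) < (1 / 2) ^ n" for n
    using N[OF ge[of n], of "r (Suc n)"] ge[of n] by (simp add: rS)
  then show ?thesis using mono by blast
qed

text \<open>Near-optimal bijections between consecutive graphs are composed, which draws all graphs
  in the coordinates of \<open>G 0\<close>. There consecutive cut norms stay below
  \<open>(1 / 2) ^ n\<close>, so the sequence is Cauchy in the norm itself and
  \<open>cut_norm_complete\<close> applies.\<close>

lemma wgraph_limit_graphon:
  assumes G: "\<And>n. G n \<in> wgraphs" and d: "\<And>n. wgraph_cut_dist (G n) (G (Suc n)) < (1 / 2) ^ n"
  shows "\<exists>W\<in>graphons. \<exists>\<mu>. (\<forall>n. \<mu> n \<in> mp_bijections) \<and> (\<lambda>n. cut_norm (\<lambda>x y. graphon_of (G n) (\<mu> n x) (\<mu> n y) - W x y)) \<longlonglongrightarrow> 0"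
proof -
  note g = graphon_of_in_graphons[OF G]
  have "\<forall>n. \<exists>\<nu>. \<nu> \<in> mp_bijections \<and> cut_norm (\<lambda>x y. graphon_of (G n) x y - graphon_of (G (Suc n)) (\<nu> x) (\<nu> y)) < (1 / 2) ^ n"
    using cut_dist_lessE[OF g g d[unfolded wgraph_cut_dist_def]] by blast
  from choice[OF this] obtain \<nu> where nu: "\<And>n. \<nu> n \<in> mp_bijections"
    and dn: "\<And>n. cut_norm (\<lambda>x y. graphon_of (G n) x y - graphon_of (G (Suc n)) (\<nu> n x) (\<nu> n y)) < (1 / 2) ^ n"
    by blast
  define \<mu> where "\<mu> = rec_nat (\<lambda>x::real. x) (\<lambda>n m x. \<nu> n (m x))"
  have m0: "\<mu> 0 = (\<lambda>x. x)" and mS: "\<mu> (Suc n) = (\<lambda>x. \<nu> n (\<mu> n x))" for n by (simp_all add: \<mu>_def)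
  have mu: "\<mu> n \<in> mp_bijections" for n
    by (induction n) (auto simp: m0 mS id_mp_bijections intro: mp_bijections_comp nu)
  define U where "U = (\<lambda>n. pull (\<mu> n) (graphon_of (G n)))"
  have U: "U n \<in> graphons" for n unfolding U_def by (rule graphons_pull[OF g mu])
  note kU = kernel_graphon[OF U]
  have step: "cut_norm (\<lambda>x y. U n x y - U (Suc n) x y) < (1 / 2) ^ n" for n
    using cut_norm_overlay_pull[OF G[of n] G[of "Suc n"] nu[of n] mu[of n]] dn[of n] unfolding U_def mS by linarith
  have self: "cut_norm (\<lambda>x y. U n x y - U n x y) \<le> 0" for n
    by (rule cut_norm_le) (simp add: rect_int_def)
  \<comment> \<open>The geometric sum in closed form; the subtracted term is what carries the
    induction.\<close>
  have tail: "cut_norm (\<lambda>x y. U n x y - U (n + k) x y) \<le> 2 * (1 / 2) ^ n - 2 * (1 / 2) ^ (n + k)" for n k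
  proof (induction k)
    case 0
    then show ?case using self[of n] by simp
  next
    case (Suc k)
    have "cut_norm (\<lambda>x y. U n x y - U (n + Suc k) x y) \<le> cut_norm (\<lambda>x y. U n x y - U (n + k) x y) + cut_norm (\<lambda>x y. U (n + k) x y - U (Suc (n + k)) x y)"
      using cut_norm_triangle[OF kU[of n] kU[of "n + k"] kU[of "n + Suc k"]] by simp
    moreover have "(1 / 2 :: real) ^ (n + Suc k) = (1 / 2) ^ (n + k) / 2" by simp
    ultimately show ?case using Suc step[of "n + k"] by linarith
  qed
  have tail': "cut_norm (\<lambda>x y. U m x y - U n x y) \<le> 2 * (1 / 2) ^ min m n" for m n
  proof -
    have a: "cut_norm (\<lambda>x y. U m x y - U n x y) \<le> 2 * (1 / 2) ^ m" if "m \<le> n" for m n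
    proof -
      have "0 \<le> (1 / 2 :: real) ^ n" by simp
      moreover have "cut_norm (\<lambda>x y. U m x y - U n x y) \<le> 2 * (1 / 2) ^ m - 2 * (1 / 2) ^ n"
        using tail[of m "n - m"] that by simp
      ultimately show ?thesis by linarith
    qed
    show ?thesis
    proof (cases "m \<le> n")
      case True
      then show ?thesis using a by (simp add: min_def)
    next
      case False
      then show ?thesis using a[of n m] cut_norm_commute[of "U m" "U n"] by (simp add: min_def)
    qed
  qed
  have "\<exists>W\<in>graphons. (\<lambda>n. cut_norm (\<lambda>x y. U n x y - W x y)) \<longlonglongrightarrow> 0"
  proof (rule cut_norm_complete[OF U])
    fix e :: real assume e: "0 < e"
    obtain N where N: "(1 / 2 :: real) ^ N < e / 2" using real_arch_pow_inv[of "e / 2" "1 / 2"] e by auto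
    have "cut_norm (\<lambda>x y. U m x y - U n x y) < e" if "N \<le> m" "N \<le> n" for m n
    proof -
      have "(1 / 2 :: real) ^ min m n \<le> (1 / 2) ^ N" using that by (intro power_decreasing) auto
      then show ?thesis using tail'[of m n] N by linarith
    qed
    then show "\<exists>N. \<forall>m\<ge>N. \<forall>n\<ge>N. cut_norm (\<lambda>x y. U m x y - U n x y) < e" by blast
  next
    show "rect_int (U n) S T = rect_int (U n) T S" if "S \<in> sets unit_leb" "T \<in> sets unit_leb" for n S T
      by (rule rect_int_sym[OF U that])
  qed
  then show ?thesis using mu unfolding U_def by blast
qed

text \<open>Compactness is what turns the pointwise continuity of the extension into uniform continuity.\<close>
lemma graphon_extendable_imp_cut_uniform:
  assumes "graphon_extendable f"
  shows "cut_uniform f"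
proof (rule ccontr)
  obtain g where gf: "graphon_functional g" and gc: "cut_norm_continuous g"
    and gl: "\<And>G :: nat \<Rightarrow> wgraph. range G \<subseteq> wgraphs \<Longrightarrow> (\<lambda>n. max_rel_weight (G n)) \<longlonglongrightarrow> 0 \<Longrightarrow>
        (\<lambda>n. g (graphon_of (G n)) - f (G n)) \<longlonglongrightarrow> 0"
    using assms unfolding graphon_extendable_def by blast
  assume "\<not> cut_uniform f"
  then obtain \<epsilon> A0 B0 where e: "0 < \<epsilon>" and AB: "\<forall>n. A0 n \<in> wgraphs \<and> B0 n \<in> wgraphs \<and>
    max_rel_weight (A0 n) \<le> 1 / real (Suc n) \<and> max_rel_weight (B0 n) \<le> 1 / real (Suc n) \<and>
    wgraph_cut_dist (A0 n) (B0 n) < 1 / real (Suc n) \<and> \<epsilon> \<le> \<bar>f (A0 n) - f (B0 n)\<bar>"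
    by (rule not_cut_uniformE)
  have A0: "A0 n \<in> wgraphs" and B0: "B0 n \<in> wgraphs"
    and mA0: "max_rel_weight (A0 n) \<le> 1 / real (Suc n)" and mB0: "max_rel_weight (B0 n) \<le> 1 / real (Suc n)"
    and d0: "wgraph_cut_dist (A0 n) (B0 n) < 1 / real (Suc n)" and f0: "\<epsilon> \<le> \<bar>f (A0 n) - f (B0 n)\<bar>" for n
    using AB by blast+
  have inv0: "(\<lambda>n. 1 / real (Suc n)) \<longlonglongrightarrow> 0" using LIMSEQ_inverse_real_of_nat by (simp add: inverse_eq_divide)
  obtain r where r: "strict_mono r" and cA: "convergent_wgraphs (\<lambda>n. A0 (r n))"
    using convergent_subsequence[of A0] A0 by blast
  have rA: "range (\<lambda>n. A0 (r n)) \<subseteq> wgraphs" using A0 by auto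
  \<comment> \<open>A second thinning makes consecutive distances summable, as
    \<open>wgraph_limit_graphon\<close> requires.\<close>
  obtain s where s: "strict_mono s" and fast: "\<And>n. wgraph_cut_dist (A0 (r (s n))) (A0 (r (s (Suc n)))) < (1 / 2) ^ n"
    using fast_Cauchy_subsequence[of "\<lambda>m n. wgraph_cut_dist (A0 (r m)) (A0 (r n))"] convergent_imp_cut_Cauchy[OF rA cA] by blast
  have rs: "strict_mono (\<lambda>n. r (s n))" using strict_mono_o[OF r s] by (simp add: comp_def)
  define A where "A = (\<lambda>n. A0 (r (s n)))"
  define B where "B = (\<lambda>n. B0 (r (s n)))"
  have A: "A n \<in> wgraphs" and B: "B n \<in> wgraphs" for n using A0 B0 by (auto simp: A_def B_def)
  obtain W \<mu> where W: "W \<in> graphons" and mu: "\<And>n. \<mu> n \<in> mp_bijections"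
    and lim: "(\<lambda>n. cut_norm (\<lambda>x y. graphon_of (A n) (\<mu> n x) (\<mu> n y) - W x y)) \<longlonglongrightarrow> 0"
    using wgraph_limit_graphon[of A] A fast unfolding A_def by blast
  note gr = graphon_of_in_graphons
  have "\<forall>n. \<exists>\<kappa>. \<kappa> \<in> mp_bijections \<and> cut_norm (\<lambda>x y. graphon_of (A n) x y - graphon_of (B n) (\<kappa> x) (\<kappa> y)) < 1 / real (Suc (r (s n)))"
  proof
    fix n
    have "cut_dist (graphon_of (A n)) (graphon_of (B n)) < 1 / real (Suc (r (s n)))"
      using d0[of "r (s n)"] by (simp add: A_def B_def wgraph_cut_dist_def)
    then show "\<exists>\<kappa>. \<kappa> \<in> mp_bijections \<and> cut_norm (\<lambda>x y. graphon_of (A n) x y - graphon_of (B n) (\<kappa> x) (\<kappa> y)) < 1 / real (Suc (r (s n)))"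
      using cut_dist_lessE[OF gr[OF A[of n]] gr[OF B[of n]]] by blast
  qed
  from choice[OF this] obtain \<kappa> where ka: "\<And>n. \<kappa> n \<in> mp_bijections"
    and dk: "\<And>n. cut_norm (\<lambda>x y. graphon_of (A n) x y - graphon_of (B n) (\<kappa> n x) (\<kappa> n y)) < 1 / real (Suc (r (s n)))"
    by blast
  \<comment> \<open>The bijections that align \<open>B n\<close> with \<open>A n\<close> are
    composed with those that align \<open>A n\<close> with the limit, so both sequences tend to the
    same \<open>W\<close>.\<close>
  have limB: "(\<lambda>n. cut_norm (\<lambda>x y. graphon_of (B n) (\<kappa> n (\<mu> n x)) (\<kappa> n (\<mu> n y)) - W x y)) \<longlonglongrightarrow> 0"
  proof (rule real_tendsto_sandwich[of "\<lambda>_. 0"])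
    note kB = kernel_graphon[OF graphons_pull[OF gr[OF B] mp_bijections_comp[OF ka mu]]]
      and kA = kernel_graphon[OF graphons_pull[OF gr[OF A] mu]] and kW = kernel_graphon[OF W]
    show "\<forall>\<^sub>F n in sequentially. 0 \<le> cut_norm (\<lambda>x y. graphon_of (B n) (\<kappa> n (\<mu> n x)) (\<kappa> n (\<mu> n y)) - W x y)"
      by (intro always_eventually allI cut_norm_nonneg kernel_diff kB kW)
    show "\<forall>\<^sub>F n in sequentially. cut_norm (\<lambda>x y. graphon_of (B n) (\<kappa> n (\<mu> n x)) (\<kappa> n (\<mu> n y)) - W x y)
      \<le> 1 / real (Suc (r (s n))) + cut_norm (\<lambda>x y. graphon_of (A n) (\<mu> n x) (\<mu> n y) - W x y)"
    proof (intro always_eventually allI)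
      fix n
      have "cut_norm (\<lambda>x y. graphon_of (B n) (\<kappa> n (\<mu> n x)) (\<kappa> n (\<mu> n y)) - graphon_of (A n) (\<mu> n x) (\<mu> n y))
        = cut_norm (\<lambda>x y. graphon_of (A n) (\<mu> n x) (\<mu> n y) - graphon_of (B n) (\<kappa> n (\<mu> n x)) (\<kappa> n (\<mu> n y)))"
        by (rule cut_norm_commute)
      also have "\<dots> < 1 / real (Suc (r (s n)))"
        using cut_norm_overlay_pull[OF A[of n] B[of n] ka[of n] mu[of n]] dk[of n] by linarith
      finally show "cut_norm (\<lambda>x y. graphon_of (B n) (\<kappa> n (\<mu> n x)) (\<kappa> n (\<mu> n y)) - W x y)
        \<le> 1 / real (Suc (r (s n))) + cut_norm (\<lambda>x y. graphon_of (A n) (\<mu> n x) (\<mu> n y) - W x y)"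
        using cut_norm_triangle[OF kB[of n n n] kA[of n n] kW] by linarith
    qed
    show "(\<lambda>n. 1 / real (Suc (r (s n))) + cut_norm (\<lambda>x y. graphon_of (A n) (\<mu> n x) (\<mu> n y) - W x y)) \<longlonglongrightarrow> 0"
      using tendsto_add[OF LIMSEQ_subseq_LIMSEQ[OF inv0 rs] lim] by (simp add: comp_def)
  qed simp
  \<comment> \<open>Continuity of \<open>g\<close> in the cut norm applies to the relabelled
    graphons. Here \<tau> itself witnesses that relabelling is a move by cut distance 0, which does
    not change \<open>g\<close>.\<close>
  have ext: "(\<lambda>n. g (graphon_of (G n))) \<longlonglongrightarrow> g W"
    if G: "\<And>n. G n \<in> wgraphs" and t: "\<And>n. \<tau> n \<in> mp_bijections"
      and l: "(\<lambda>n. cut_norm (\<lambda>x y. graphon_of (G n) (\<tau> n x) (\<tau> n y) - W x y)) \<longlonglongrightarrow> 0" for G \<tau>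
  proof -
    have pg: "pull (\<tau> n) (graphon_of (G n)) \<in> graphons" for n by (rule graphons_pull[OF gr[OF G] t])
    have eq: "g (pull (\<tau> n) (graphon_of (G n))) = g (graphon_of (G n))" for n
    proof -
      have "cut_norm (\<lambda>x y. pull (\<tau> n) (graphon_of (G n)) x y - graphon_of (G n) (\<tau> n x) (\<tau> n y)) \<le> 0"
        by (rule cut_norm_le) (simp add: rect_int_def)
      then have "cut_dist (pull (\<tau> n) (graphon_of (G n))) (graphon_of (G n)) = 0"
        using cut_dist_le[OF pg gr[OF G] t, of n n n] cut_dist_nonneg[OF pg gr[OF G], of n n] by linarith
      then show ?thesis using gf pg gr[OF G] unfolding graphon_functional_def by blast
    qed
    show ?thesis
    proof (rule LIMSEQ_I)
      fix q :: real assume q: "0 < q"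
      obtain \<delta> where "0 < \<delta>" and D: "\<And>U. U \<in> graphons \<Longrightarrow> cut_norm (\<lambda>x y. U x y - W x y) < \<delta> \<Longrightarrow> \<bar>g U - g W\<bar> < q"
        using gc W q unfolding cut_norm_continuous_def by blast
      from order_tendstoD(2)[OF l this(1)]
      obtain N where N: "\<forall>n\<ge>N. cut_norm (\<lambda>x y. graphon_of (G n) (\<tau> n x) (\<tau> n y) - W x y) < \<delta>"
        unfolding eventually_sequentially by blast
      show "\<exists>N. \<forall>n\<ge>N. norm (g (graphon_of (G n)) - g W) < q"
        using D[OF pg N[rule_format], unfolded eq] by (intro exI[of _ N]) simp
    qed
  qed
  have mr: "(\<lambda>n. max_rel_weight (G (r (s n)))) \<longlonglongrightarrow> 0" if "\<And>n. G n \<in> wgraphs" "\<And>n. max_rel_weight (G n) \<le> 1 / real (Suc n)" for G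
    using LIMSEQ_subseq_LIMSEQ[OF max_rel_weight_tendsto_0[OF that] rs] by (simp add: comp_def)
  have fA: "(\<lambda>n. f (A n)) \<longlonglongrightarrow> g W"
    using tendsto_diff[OF ext[OF A mu lim] gl[of A]] A mr[OF A0 mA0] unfolding A_def by auto
  have fB: "(\<lambda>n. f (B n)) \<longlonglongrightarrow> g W"
    using tendsto_diff[OF ext[OF B mp_bijections_comp[OF ka mu] limB] gl[of B]] B mr[OF B0 mB0] unfolding B_def by auto
  have "(\<lambda>n. \<bar>f (A n) - f (B n)\<bar>) \<longlonglongrightarrow> 0"
    using tendsto_rabs_zero[OF tendsto_diff[OF fA fB, simplified diff_self]] .
  then have "\<epsilon> \<le> 0" using f0 by (intro LIMSEQ_le_const) (auto simp: A_def B_def)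
  then show False using e by simp
qed

theorem theorem5:
  fixes f :: "wgraph \<Rightarrow> real"
  assumes "wgraph_parameter f"
  shows
    "(testable f \<longleftrightarrow>
        (\<forall>\<epsilon>>0. \<exists>k\<ge>1. \<forall>G\<in>wgraphs. max_rel_weight G \<le> 1 / real k \<longrightarrow>
           \<bar>f G - measure_pmf.expectation (random_sample k G) f\<bar> \<le> \<epsilon>)) \<and>
     (testable f \<longleftrightarrow>
        (\<forall>G :: nat \<Rightarrow> wgraph. range G \<subseteq> wgraphs \<longrightarrow> convergent_wgraphs G \<longrightarrow>
           (\<lambda>n. max_rel_weight (G n)) \<longlonglongrightarrow> 0 \<longrightarrow> convergent (\<lambda>n. f (G n)))) \<and>
     (testable f \<longleftrightarrow>
        (\<exists>g. graphon_functional g \<and> cut_norm_continuous g \<and>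
           (\<forall>G :: nat \<Rightarrow> wgraph. range G \<subseteq> wgraphs \<longrightarrow>
              (\<lambda>n. max_rel_weight (G n)) \<longlonglongrightarrow> 0 \<longrightarrow>
              (\<lambda>n. g (graphon_of (G n)) - f (G n)) \<longlonglongrightarrow> 0))) \<and>
     (testable f \<longleftrightarrow>
        (\<forall>\<epsilon>>0. \<exists>\<epsilon>\<^sub>0>0. \<exists>n\<^sub>0::nat. n\<^sub>0 > 0 \<and>
           (\<forall>G\<^sub>1\<in>wgraphs. \<forall>G\<^sub>2\<in>wgraphs.
              max_rel_weight G\<^sub>1 \<le> 1 / real n\<^sub>0 \<longrightarrow> max_rel_weight G\<^sub>2 \<le> 1 / real n\<^sub>0 \<longrightarrow>
              wgraph_cut_dist G\<^sub>1 G\<^sub>2 < \<epsilon>\<^sub>0 \<longrightarrow> \<bar>f G\<^sub>1 - f G\<^sub>2\<bar> < \<epsilon>)))"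
  \<comment> \<open>The implications form the cycle (a), (c), (e), (a), with a detour from (a)
    through (b) to (c), and (d) is equivalent to (e).\<close>
  unfolding mean_testable_def[symmetric] limit_testable_def[symmetric]
    graphon_extendable_def[symmetric] cut_uniform_def[symmetric]
  using testable_imp_limit_testable[of f] mean_testable_imp_limit_testable[of f]
    limit_testable_imp_cut_uniform[of f] cut_uniform_imp_testable[of f] testable_imp_mean_testable[of f]
    cut_uniform_imp_graphon_extendable[of f] graphon_extendable_imp_cut_uniform[of f]
  by blast

end
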